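(* Let $n\ge 1$ and $k\in\mathbb{N}$. Any choice of $\binom{n+k}{k}+1$ general points in $\mathbb{Z}^n$ gives a configuration $\mathcal{A}$ such that $X_{\mathcal{A}}$ is $k$-selfdual.
   Context: $\mathbb{K}$ is an algebraically closed field of characteristic zero. "General" means: there is a nonempty Zariski open subset $U$ of $(\mathbb{A}^n)^{\binom{n+k}{k}+1}$ such that the assertion holds for every tuple of lattice points lying in $U$. For a configuration $\mathcal{A}$ of distinct points $a_0,\dots,a_N\in\mathbb{Z}^n$, $X_{\mathcal{A}}\subset\mathbb{P}^N$ is the Zariski closure of $\{(\mathbf{t}^{a_0}:\dots:\mathbf{t}^{a_N}) : \mathbf{t}\in(\mathbb{K}^* )^n\}$. Higher duals: let $X\subset\mathbb{P}^N$ be a nondegenerate irreducible projective variety. For a smooth point $x\in X$, let $j_{k,x}:\mathbb{K}^{N+1}\to\mathcal{L}_x/\mathfrak{m}_x^{k+1}\mathcal{L}_x$, with $\mathcal{L}=\mathcal{O}_{\mathbb{P}^N}(1)|_X$, be the linear map sending a linear form to the Taylor expansion up to order $k$ at $x$ of its restriction to $X$. The $k$-th osculating space is $\mathbb{T}^k_{X,x}=\mathbb{P}(\operatorname{Im} j_{k,x})\subset\mathbb{P}^N$; thus a hyperplane contains $\mathbb{T}^k_{X,x}$ iff its equation restricted to $X$ vanishes to order at least $k+1$ at $x$. Let $X_{k\text{-cst}}$ be the open dense subset of $X$ where the rank of $j_k$ is constant. The $k$-th dual variety $X^{(k)}\subset(\mathbb{P}^N)^\vee$ is the Zariski closure of $\{H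 : H\supseteq\mathbb{T}^k_{X,x}\text{ for some }x\in X_{k\text{-cst}}\}$. $X$ is $k$-selfdual if there is a linear isomorphism $\varphi:\mathbb{P}^N\to(\mathbb{P}^N)^\vee$ with $\varphi(X)=X^{(k)}$. *)

theory Defs
  imports
    "HOL-Analysis.Analysis"
    "HOL-Computational_Algebra.Polynomial"
    "HOL-Library.Extended_Nat"
begin

text \<open>
  Polynomials are represented by the functions they induce; over an infinite field this loses
  no information.  \<open>poly_funs M\<close> consists of the polynomials with exponent vectors in \<open>M\<close>.
\<close>

definition poly_funs :: "('i::finite \<Rightarrow> nat) set \<Rightarrow> ('a::field ^ 'i \<Rightarrow> 'a) set" where
  "poly_funs M =
     {f. \<exists>E c. finite E \<and> E \<subseteq> M \<and> f = (\<lambda>x. \<Sum>e\<in>E. c e * (\<Prod>i\<in>UNIV. x $ i ^ e i))}"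

definition hom_poly_funs :: "nat \<Rightarrow> ('a::field ^ 'i::finite \<Rightarrow> 'a) set" where
  "hom_poly_funs d = poly_funs {e. (\<Sum>i\<in>UNIV. e i) = d}"

definition zariski_affine :: "('a::field ^ 'i::finite) topology" where
  "zariski_affine = topology_generated_by {{x. f x \<noteq> 0} | f. f \<in> poly_funs UNIV}"

text \<open>
  Points of \<open>\<P>\<^sup>N\<close>, \<open>N + 1 = CARD('m)\<close>, are given by their homogeneous coordinates: a subset of
  \<open>\<P>\<^sup>N\<close> is represented by the set of all nonzero vectors lying over it.  The topology below is the
  Zariski topology of \<open>\<P>\<^sup>N\<close> pulled back to \<open>K\<^sup>N\<^sup>+\<^sup>1 - {0}\<close>; its open (closed) sets are stable under
  nonzero scalars and correspond bijectively to the open (closed) subsets of \<open>\<P>\<^sup>N\<close>.  In particular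
  the closure of a set of representatives contains all representatives of its points.
\<close>

definition zariski_proj :: "('a::field ^ 'm::finite) topology" where
  "zariski_proj =
     topology_generated_by {{x. x \<noteq> 0 \<and> f x \<noteq> 0} | f. \<exists>d. f \<in> hom_poly_funs d}"

definition irreducible_in :: "'b topology \<Rightarrow> 'b set \<Rightarrow> bool" where
  "irreducible_in T Z \<longleftrightarrow> Z \<subseteq> topspace T \<and> Z \<noteq> {} \<and>
     (\<forall>A B. closedin T A \<and> closedin T B \<and> Z \<subseteq> A \<union> B \<longrightarrow> Z \<subseteq> A \<or> Z \<subseteq> B)"

definition krull_dim :: "'b topology \<Rightarrow> enat" where
  "krull_dim T = (SUP d \<in> {d. \<exists>Z :: nat \<Rightarrow> 'b set.
      (\<forall>i\<le>d. closedin T (Z i) \<and> irreducible_in T (Z i)) \<and> (\<forall>i<d. Z i \<subset> Z (Suc i))}. enat d)"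

text \<open>
  The stalk at \<open>x \<in> X\<close> of \<open>\<O>(d)|\<^sub>X\<close>, for \<open>X\<close> a (reduced) projective variety.  A germ is represented
  by every function that agrees with \<open>F / G\<close> on a neighbourhood of \<open>x\<close> in \<open>X\<close>, where \<open>F\<close>, \<open>G\<close> are
  homogeneous, \<open>deg F = d + deg G\<close> and \<open>G x \<noteq> 0\<close>; the values elsewhere are arbitrary.
\<close>

definition stalk :: "('a::field ^ 'm::finite) set \<Rightarrow> 'a ^ 'm \<Rightarrow> nat \<Rightarrow> ('a ^ 'm \<Rightarrow> 'a) set" where
  "stalk X x d = {s. \<exists>e. \<exists>F \<in> hom_poly_funs (d + e). \<exists>G \<in> hom_poly_funs e.
      G x \<noteq> 0 \<and> (\<forall>y\<in>X. G y \<noteq> 0 \<longrightarrow> s y = F y / G y)}"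

definition max_ideal :: "('a::field ^ 'm::finite) set \<Rightarrow> 'a ^ 'm \<Rightarrow> ('a ^ 'm \<Rightarrow> 'a) set" where
  "max_ideal X x = {s \<in> stalk X x 0. s x = 0}"

text \<open>
  The product of an ideal \<open>I\<close> of \<open>\<O>\<^bsub>X,x\<^esub>\<close> with a submodule \<open>M\<close> of a stalk.  If \<open>I = max_ideal X x\<close>
  and \<open>M\<close> is closed under changing the representatives of germs, then so is the product: a
  representative \<open>z\<close> of the zero germ is \<open>f * z\<close> with \<open>f\<close> the indicator function of \<open>{y. z y \<noteq> 0}\<close>,
  which again represents zero.
\<close>

definition ideal_mult :: "('b \<Rightarrow> 'a::field) set \<Rightarrow> ('b \<Rightarrow> 'a) set \<Rightarrow> ('b \<Rightarrow> 'a) set" where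
  "ideal_mult I M = {\<lambda>y. \<Sum>i<p. f i y * s i y | (p::nat) f s. \<forall>i<p. f i \<in> I \<and> s i \<in> M}"

text \<open>The submodule \<open>\<mm>\<^sub>x\<^sup>r \<L>\<^sub>x\<close> of \<open>\<L>\<^sub>x\<close>, where \<open>\<L> = \<O>(1)|\<^sub>X\<close>.\<close>

definition max_power :: "('a::field ^ 'm::finite) set \<Rightarrow> 'a ^ 'm \<Rightarrow> nat \<Rightarrow> ('a ^ 'm \<Rightarrow> 'a) set" where
  "max_power X x r = (ideal_mult (max_ideal X x) ^^ r) (stalk X x 1)"

text \<open>
  \<open>dim_mod W S\<close> is the dimension of the image of the space of functions \<open>S\<close> in the quotient by the
  subspace \<open>W\<close>: the largest number of elements of \<open>S\<close> that are linearly independent modulo \<open>W\<close>.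
\<close>

definition independent_mod :: "('b \<Rightarrow> 'a::field) set \<Rightarrow> ('b \<Rightarrow> 'a) set \<Rightarrow> bool" where
  "independent_mod W B \<longleftrightarrow>
     (\<forall>c. (\<lambda>y. \<Sum>b\<in>B. c b * b y) \<in> W \<longrightarrow> (\<forall>b\<in>B. c b = 0))"

definition dim_mod :: "('b \<Rightarrow> 'a::field) set \<Rightarrow> ('b \<Rightarrow> 'a) set \<Rightarrow> enat" where
  "dim_mod W S = (SUP B \<in> {B. finite B \<and> B \<subseteq> S \<and> independent_mod W B}. enat (card B))"

text \<open>
  Regularity of \<open>\<O>\<^bsub>X,x\<^esub>\<close>, that is \<open>dim (\<mm>\<^sub>x / \<mm>\<^sub>x\<^sup>2) = dim \<O>\<^bsub>X,x\<^esub>\<close>.  For an irreducible \<open>X\<close>, the only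
  case of interest here, the right-hand side is \<open>dim X\<close>.
\<close>

definition smooth_point :: "('a::field ^ 'm::finite) set \<Rightarrow> 'a ^ 'm \<Rightarrow> bool" where
  "smooth_point X x \<longleftrightarrow> x \<in> X \<and>
     dim_mod (ideal_mult (max_ideal X x) (max_ideal X x)) (max_ideal X x)
       = krull_dim (subtopology zariski_proj X)"

text \<open>
  A linear form is given by its vector of coefficients, and \<open>(\<P>\<^sup>N)\<^sup>\<or>\<close> is represented by the nonzero
  coefficient vectors, just as \<open>\<P>\<^sup>N\<close> above.
\<close>

definition lin_form :: "'a::field ^ 'm::finite \<Rightarrow> 'a ^ 'm \<Rightarrow> 'a" where
  "lin_form c = (\<lambda>y. \<Sum>i\<in>UNIV. c $ i * y $ i)"

definition hyperplane :: "'a::field ^ 'm::finite \<Rightarrow> ('a ^ 'm) set" where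
  "hyperplane c = {y. y \<noteq> 0 \<and> lin_form c y = 0}"

text \<open>
  Kernel and rank of \<open>j\<^bsub>k,x\<^esub> : K\<^sup>N\<^sup>+\<^sup>1 \<rightarrow> \<L>\<^sub>x / \<mm>\<^sub>x\<^sup>k\<^sup>+\<^sup>1 \<L>\<^sub>x\<close>, which sends a linear form to the class of
  its restriction to \<open>X\<close>.
\<close>

definition jet_kernel :: "nat \<Rightarrow> ('a::field ^ 'm::finite) set \<Rightarrow> 'a ^ 'm \<Rightarrow> ('a ^ 'm) set" where
  "jet_kernel k X x = {c. lin_form c \<in> max_power X x (k + 1)}"

definition jet_rank :: "nat \<Rightarrow> ('a::field ^ 'm::finite) set \<Rightarrow> 'a ^ 'm \<Rightarrow> enat" where
  "jet_rank k X x = dim_mod (max_power X x (k + 1)) (range lin_form)"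

text \<open>
  \<open>\<P>(Im j\<^bsub>k,x\<^esub>)\<close> is embedded in \<open>\<P>\<^sup>N\<close> through the surjection of the space of linear forms onto
  \<open>Im j\<^bsub>k,x\<^esub>\<close>; it is thus the linear subspace cut out by the linear forms in the kernel.
\<close>

definition osculating_space :: "nat \<Rightarrow> ('a::field ^ 'm::finite) set \<Rightarrow> 'a ^ 'm \<Rightarrow> ('a ^ 'm) set" where
  "osculating_space k X x = {p. p \<noteq> 0 \<and> (\<forall>c \<in> jet_kernel k X x. lin_form c p = 0)}"

text \<open>
  The largest dense open subset of \<open>X\<close> on which \<open>j\<^sub>k\<close> is defined and has constant rank.  The rank
  is constant on the union because dense open subsets of an irreducible \<open>X\<close> meet.
\<close>

definition cst_locus :: "nat \<Rightarrow> ('a::field ^ 'm::finite) set \<Rightarrow> ('a ^ 'm) set" where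
  "cst_locus k X = \<Union> {V. openin (subtopology zariski_proj X) V \<and>
      (subtopology zariski_proj X) closure_of V = X \<and>
      (\<forall>x\<in>V. smooth_point X x) \<and> (\<exists>r. \<forall>x\<in>V. jet_rank k X x = r)}"

definition dual_variety :: "nat \<Rightarrow> ('a::field ^ 'm::finite) set \<Rightarrow> ('a ^ 'm) set" where
  "dual_variety k X = zariski_proj closure_of
     {c. c \<noteq> 0 \<and> (\<exists>x \<in> cst_locus k X. osculating_space k X x \<subseteq> hyperplane c)}"

definition selfdual :: "nat \<Rightarrow> ('a::field ^ 'm::finite) set \<Rightarrow> bool" where
  "selfdual k X \<longleftrightarrow>
     (\<exists>\<phi>. Vector_Spaces.linear (*s) (*s) \<phi> \<and> bij \<phi> \<and> \<phi> ` X = dual_variety k X)"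

definition toric_variety :: "('m::finite \<Rightarrow> int ^ 'n::finite) \<Rightarrow> ('a::field ^ 'm) set" where
  "toric_variety a = zariski_proj closure_of
     {\<chi> i. \<Prod>j\<in>UNIV. t $ j powi (a i $ j) | t :: 'a ^ 'n. \<forall>j. t $ j \<noteq> 0}"

text \<open>A tuple of lattice points, indexed by \<open>'m\<close>, as a point of the affine space \<open>(\<A>\<^sup>n)\<^sup>N\<^sup>+\<^sup>1\<close>.\<close>

definition lattice_tuple :: "('m::finite \<Rightarrow> int ^ 'n::finite) \<Rightarrow> 'a::field ^ ('m \<times> 'n)" where
  "lattice_tuple a = (\<chi> ij. of_int (a (fst ij) $ snd ij))"

end

theory Submission
  imports Defs "HOL-Library.Multiset" "HOL-Library.Numeral_Type" "HOL-Computational_Algebra.Primes"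
begin

text \<open>
  The Euler derivations of the torus multiply the coordinate \<open>x\<^sub>i\<close> by the coordinates of the lattice
  point \<open>a\<^sub>i\<close>.  If a linear form with coefficients \<open>c\<close> vanishes to order \<open>k + 1\<close> at \<open>x\<close>, then the vector
  \<open>(c\<^sub>i x\<^sub>i)\<close> is therefore annihilated by all monomials of degree at most \<open>k\<close> in the points \<open>a\<^sub>i\<close>.  For
  a general configuration this system of \<open>N\<close> equations in \<open>N + 1\<close> unknowns has a one-dimensional
  solution space, spanned by a vector \<open>w\<close> without zero entries.  So the kernel of \<open>j\<^sub>k\<close> at a point \<open>x\<close>
  of the torus is the line spanned by \<open>(w\<^sub>i / x\<^sub>i)\<close>.  Since inversion preserves the torus orbit, these
  vectors sweep out the image of the orbit under the diagonal map \<open>diag(w)\<close>.  At a boundary point of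
  the constancy locus the kernel is still a line, because \<open>X\<close> is smooth there and the rank is \<open>N\<close>, and
  it is a limit of kernel lines at points of the torus.  Hence the dual variety is \<open>diag(w) X\<close>.
\<close>

section \<open>Polynomial functions and the Zariski topology\<close>

text \<open>The number \<open>(n + k) choose k\<close>, with \<open>n\<close> the rank of the
  lattice, counts the monomials of degree at most \<open>k\<close> in \<open>n\<close> variables,
  and it enters twice. On the torus it is the number of moment equations; at any smooth point it
  bounds the number of conditions for vanishing to order \<open>k + 1\<close>, because
  \<open>n\<close> local parameters suffice there. The moments bound the kernel only from above;
  that it is nonzero comes from the second count, \<open>N\<close> conditions on
  \<open>N + 1\<close> coefficients. The obstacle is the limit at a boundary point \<open>x\<close>:
  the kernel has to be followed from \<open>x\<close> into the torus by polynomial formulas. Taylor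
  expansions are therefore made with both points variable, modulo powers of the ideal of the
  diagonal, so that their coefficients are polynomials in the base point. Smoothness is measured
  against the Krull dimension, so \<open>dim X = n\<close> is needed too; it comes from counting
  forms of large degree and from a chain of subtori. For \<open>k = 0\<close> there are only two
  points, which do not span when \<open>n > 1\<close>, and \<open>X\<close> is the projective line
  for every \<open>n\<close>; this case is reduced to \<open>n = 1\<close>.\<close>

lemma poly_funs_sumI:
  assumes "finite J" "\<And>j. j \<in> J \<Longrightarrow> \<epsilon> j \<in> M"
  shows "(\<lambda>x. \<Sum>j\<in>J. d j * (\<Prod>i\<in>UNIV. x $ i ^ \<epsilon> j i)) \<in> poly_funs M"
proof -
  have "(\<Sum>j\<in>J. d j * (\<Prod>i\<in>UNIV. x $ i ^ \<epsilon> j i)) =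
      (\<Sum>e\<in>\<epsilon> ` J. (\<Sum>j\<in>{j\<in>J. \<epsilon> j = e}. d j) * (\<Prod>i\<in>UNIV. x $ i ^ e i))" for x
    by (subst sum.image_gen[OF assms(1), of _ \<epsilon>]) (auto simp: sum_distrib_right intro!: sum.cong)
  then show ?thesis
    unfolding poly_funs_def using assms by (intro CollectI exI[of _ "\<epsilon> ` J"]) auto
qed

lemma poly_funsE:
  assumes "f \<in> poly_funs M"
  obtains E c where "finite E" "E \<subseteq> M" "\<And>x. f x = (\<Sum>e\<in>E. c e * (\<Prod>i\<in>UNIV. x $ i ^ e i))"
  using assms unfolding poly_funs_def by auto

lemma poly_funs_add:
  assumes "f \<in> poly_funs M" "g \<in> poly_funs M"
  shows "(\<lambda>x. f x + g x) \<in> poly_funs M"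
proof -
  obtain E c where E: "finite E" "E \<subseteq> M" "\<And>x. f x = (\<Sum>e\<in>E. c e * (\<Prod>i\<in>UNIV. x $ i ^ e i))"
    using poly_funsE[OF assms(1)] by metis
  obtain E' c' where E': "finite E'" "E' \<subseteq> M"
    "\<And>x. g x = (\<Sum>e\<in>E'. c' e * (\<Prod>i\<in>UNIV. x $ i ^ e i))"
    using poly_funsE[OF assms(2)] by metis
  have "(\<lambda>x. f x + g x) = (\<lambda>x. \<Sum>j\<in>E <+> E'. case_sum c c' j * (\<Prod>i\<in>UNIV. x $ i ^ case_sum id id j i))"
    using E(1) E'(1) by (auto simp: E(3) E'(3) sum.Plus)
  then show ?thesis
    using E E' by (auto intro!: poly_funs_sumI)
qed

lemma poly_funs_mult:
  assumes "f \<in> poly_funs M" "g \<in> poly_funs M'"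
    and "\<And>e e'. e \<in> M \<Longrightarrow> e' \<in> M' \<Longrightarrow> (\<lambda>i. e i + e' i) \<in> M''"
  shows "(\<lambda>x. f x * g x) \<in> poly_funs M''"
proof -
  obtain E c where E: "finite E" "E \<subseteq> M" "\<And>x. f x = (\<Sum>e\<in>E. c e * (\<Prod>i\<in>UNIV. x $ i ^ e i))"
    using poly_funsE[OF assms(1)] by metis
  obtain E' c' where E': "finite E'" "E' \<subseteq> M'"
    "\<And>x. g x = (\<Sum>e\<in>E'. c' e * (\<Prod>i\<in>UNIV. x $ i ^ e i))"
    using poly_funsE[OF assms(2)] by metis
  have "(\<lambda>x. f x * g x) = (\<lambda>x. \<Sum>j\<in>E \<times> E'. (c (fst j) * c' (snd j)) *
      (\<Prod>i\<in>UNIV. x $ i ^ (fst j i + snd j i)))"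
    by (auto simp: E(3) E'(3) sum_product sum.cartesian_product power_add prod.distrib
      intro!: sum.cong)
  moreover have "(\<lambda>x. \<Sum>j\<in>E \<times> E'. (c (fst j) * c' (snd j)) *
      (\<Prod>i\<in>UNIV. x $ i ^ (fst j i + snd j i))) \<in> poly_funs M''"
    by (rule poly_funs_sumI[where \<epsilon> = "\<lambda>j i. fst j i + snd j i"]) (use E E' assms(3) in \<open>auto simp: subset_iff\<close>)
  ultimately show ?thesis by simp
qed

lemma poly_funs_monom: "e \<in> M \<Longrightarrow> (\<lambda>x. c * (\<Prod>i\<in>UNIV. x $ i ^ e i)) \<in> poly_funs M"
  unfolding poly_funs_def by (intro CollectI exI[of _ "{e}"] exI[of _ "\<lambda>_. c"]) auto

lemma poly_funs_zero: "(\<lambda>x. 0) \<in> poly_funs M"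
  unfolding poly_funs_def by (intro CollectI exI[of _ "{}"]) auto

lemma prod_power_indicator:
  "(\<Prod>i\<in>UNIV. (x :: 'a::comm_monoid_mult ^ 'i::finite) $ i ^ (if i = j then 1 else 0)) = x $ j"
proof -
  have "(\<Prod>i\<in>UNIV. x $ i ^ (if i = j then 1 else 0)) = (\<Prod>i\<in>UNIV. if i = j then x $ i else 1)"
    by (rule prod.cong) auto
  then show ?thesis by simp
qed

lemma sum_indicator:
  "(\<Sum>l\<in>UNIV. (if l = i then 1 else 0) * f l) = (f (i :: 'i::finite) :: 'b::semiring_1)"
proof -
  have "(\<Sum>l\<in>UNIV. (if l = i then 1 else 0) * f l) = (\<Sum>l\<in>UNIV. if l = i then f l else 0)"
    by (rule sum.cong) auto
  then show ?thesis by simp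
qed

abbreviation pol :: "('a::field ^ 'i::finite \<Rightarrow> 'a) \<Rightarrow> bool" where
  "pol f \<equiv> f \<in> poly_funs UNIV"

lemma pol_const: "pol (\<lambda>x. c)"
  using poly_funs_monom[of "\<lambda>_. 0" UNIV c] by simp

lemma pol_nth: "pol (\<lambda>x. x $ i)"
  using poly_funs_monom[of "\<lambda>j. if j = i then 1 else 0" UNIV 1] by (simp add: prod_power_indicator)

lemma pol_add: "pol f \<Longrightarrow> pol g \<Longrightarrow> pol (\<lambda>x. f x + g x)"
  by (rule poly_funs_add)

lemma pol_mult: "pol f \<Longrightarrow> pol g \<Longrightarrow> pol (\<lambda>x. f x * g x)"
  by (rule poly_funs_mult) auto

lemma pol_minus: "pol f \<Longrightarrow> pol (\<lambda>x. - f x)"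
  using pol_mult[OF pol_const[of "-1"], of f] by simp

lemma pol_diff: "pol f \<Longrightarrow> pol g \<Longrightarrow> pol (\<lambda>x. f x - g x)"
  using pol_add[of f "\<lambda>x. - g x"] pol_minus[of g] by simp

lemma pol_sum: "(\<And>i. i \<in> A \<Longrightarrow> pol (f i)) \<Longrightarrow> pol (\<lambda>x. \<Sum>i\<in>A. f i x)"
  by (induction A rule: infinite_finite_induct) (auto intro!: pol_const pol_add)

lemma pol_prod: "(\<And>i. i \<in> A \<Longrightarrow> pol (f i)) \<Longrightarrow> pol (\<lambda>x. \<Prod>i\<in>A. f i x)"
  by (induction A rule: infinite_finite_induct) (auto intro!: pol_const pol_mult)

lemma pol_power: "pol f \<Longrightarrow> pol (\<lambda>x. f x ^ n)"
  by (induction n) (auto intro!: pol_const pol_mult)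

lemma pol_prod_mset: "(\<And>i. i \<in># M \<Longrightarrow> pol (f i)) \<Longrightarrow> pol (\<lambda>x. \<Prod>i\<in>#M. f i x)"
  by (induction M) (auto intro!: pol_const pol_mult)

lemma pol_if: "(b \<Longrightarrow> pol f) \<Longrightarrow> (\<not> b \<Longrightarrow> pol g) \<Longrightarrow> pol (\<lambda>x. if b then f x else g x)"
  by (cases b) auto

lemma pol_det:
  assumes "\<And>i j. pol (\<lambda>x. A x $ i $ j)"
  shows "pol (\<lambda>x. det (A x))"
  unfolding det_def by (intro pol_sum pol_mult pol_const pol_prod assms)

text \<open>Polynomial functions are generated by constants and coordinates under sums and products.
  Homogenization, linearization at a point and the existence of gradients are proved along this
  structure.\<close>

lemma pol_induct [consumes 1, case_names const nth add mult]:
  assumes "pol f"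
    and const: "\<And>c. P (\<lambda>x. c)" and nth: "\<And>i. P (\<lambda>x. x $ i)"
    and add: "\<And>f g. pol f \<Longrightarrow> pol g \<Longrightarrow> P f \<Longrightarrow> P g \<Longrightarrow> P (\<lambda>x. f x + g x)"
    and mult: "\<And>f g. pol f \<Longrightarrow> pol g \<Longrightarrow> P f \<Longrightarrow> P g \<Longrightarrow> P (\<lambda>x. f x * g x)"
  shows "P f"
proof -
  obtain E c where E: "finite E" "\<And>x. f x = (\<Sum>e\<in>E. c e * (\<Prod>i\<in>UNIV. x $ i ^ e i))"
    using poly_funsE[OF assms(1)] by metis
  have pw: "P (\<lambda>x. x $ i ^ n)" for i n
    by (induction n) (auto intro!: const mult nth pol_nth pol_power)
  have pr: "P (\<lambda>x. \<Prod>i\<in>I. x $ i ^ e i)" if "finite I" for I :: "'b set" and e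
    using that by induction (auto intro!: const mult pw pol_nth pol_power pol_prod)
  have "P (\<lambda>x. \<Sum>e\<in>F. c e * (\<Prod>i\<in>UNIV. x $ i ^ e i))" if "finite F" for F
    using that
    by induction (auto intro!: const add mult pr pol_nth pol_power pol_prod pol_sum pol_mult pol_const)
  from this[OF E(1)] show ?thesis unfolding E(2)[symmetric] .
qed

lemma pol_compose:
  assumes "pol f" "\<And>i. pol (\<lambda>x. g x $ i)"
  shows "pol (\<lambda>x. f (g x))"
  using assms(1)
  by (induction rule: pol_induct) (auto intro!: assms pol_const pol_add pol_mult)

lemma hom_imp_pol: "f \<in> hom_poly_funs d \<Longrightarrow> pol f"
  unfolding hom_poly_funs_def poly_funs_def by blast

lemma hom_const: "(\<lambda>x. c) \<in> hom_poly_funs 0"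
  using poly_funs_monom[of "\<lambda>_. 0" "{e. sum e UNIV = 0}" c] unfolding hom_poly_funs_def by simp

lemma hom_zero: "(\<lambda>x. 0) \<in> hom_poly_funs d"
  unfolding hom_poly_funs_def by (rule poly_funs_zero)

lemma hom_nth: "(\<lambda>x. x $ i) \<in> hom_poly_funs 1"
  using poly_funs_monom[of "\<lambda>j. if j = i then 1 else 0" "{e. sum e UNIV = 1}" 1]
  unfolding hom_poly_funs_def by (simp add: prod_power_indicator)

lemma hom_add:
  "f \<in> hom_poly_funs d \<Longrightarrow> g \<in> hom_poly_funs d \<Longrightarrow> (\<lambda>x. f x + g x) \<in> hom_poly_funs d"
  unfolding hom_poly_funs_def by (rule poly_funs_add)

lemma hom_mult:
  "f \<in> hom_poly_funs d \<Longrightarrow> g \<in> hom_poly_funs e \<Longrightarrow> (\<lambda>x. f x * g x) \<in> hom_poly_funs (d + e)"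
  unfolding hom_poly_funs_def by (rule poly_funs_mult) (auto simp: sum.distrib)

lemma hom_scale: "f \<in> hom_poly_funs d \<Longrightarrow> (\<lambda>x. c * f x) \<in> hom_poly_funs d"
  using hom_mult[OF hom_const[of c], of f d] by simp

lemma hom_minus: "f \<in> hom_poly_funs d \<Longrightarrow> (\<lambda>x. - f x) \<in> hom_poly_funs d"
  using hom_scale[of f d "-1"] by simp

lemma hom_diff:
  "f \<in> hom_poly_funs d \<Longrightarrow> g \<in> hom_poly_funs d \<Longrightarrow> (\<lambda>x. f x - g x) \<in> hom_poly_funs d"
  using hom_add[of f d "\<lambda>x. - g x"] hom_minus[of g d] by simp

lemma hom_sum: "(\<And>i. i \<in> A \<Longrightarrow> f i \<in> hom_poly_funs d) \<Longrightarrow> (\<lambda>x. \<Sum>i\<in>A. f i x) \<in> hom_poly_funs d"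
  by (induction A rule: infinite_finite_induct) (auto intro!: hom_zero hom_add)

lemma hom_power: "f \<in> hom_poly_funs d \<Longrightarrow> (\<lambda>x. f x ^ n) \<in> hom_poly_funs (n * d)"
  by (induction n) (auto intro!: hom_const hom_mult)

lemma hom_prod:
  "(\<And>i. i \<in> A \<Longrightarrow> f i \<in> hom_poly_funs (d i)) \<Longrightarrow>
    (\<lambda>x. \<Prod>i\<in>A. f i x) \<in> hom_poly_funs (\<Sum>i\<in>A. d i)"
  by (induction A rule: infinite_finite_induct) (auto intro!: hom_const hom_mult)

lemma hom_monom: "(\<Sum>i\<in>UNIV. e i) = d \<Longrightarrow> (\<lambda>x. \<Prod>i\<in>UNIV. x $ i ^ e i) \<in> hom_poly_funs d"
  using poly_funs_monom[of e "{e. sum e UNIV = d}" 1] unfolding hom_poly_funs_def by simp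

lemma hom_lin_form: "lin_form c \<in> hom_poly_funs 1"
  unfolding lin_form_def by (intro hom_sum hom_scale hom_nth)

lemma hom_polyE:
  assumes "f \<in> hom_poly_funs d"
  obtains E c where "finite E" "\<And>e. e \<in> E \<Longrightarrow> (\<Sum>i\<in>UNIV. e i) = d"
    "\<And>x. f x = (\<Sum>e\<in>E. c e * (\<Prod>i\<in>UNIV. x $ i ^ e i))"
  by (rule poly_funsE[OF assms[unfolded hom_poly_funs_def]]) (auto intro!: that)

lemma hom_homogeneous:
  assumes "f \<in> hom_poly_funs d"
  shows "f (c *s x) = c ^ d * f x"
proof -
  obtain E b where E: "\<And>e. e \<in> E \<Longrightarrow> (\<Sum>i\<in>UNIV. e i) = d"
    "\<And>x. f x = (\<Sum>e\<in>E. b e * (\<Prod>i\<in>UNIV. x $ i ^ e i))"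
    using hom_polyE[OF assms] by metis
  have "(\<Prod>i\<in>UNIV. (c *s x) $ i ^ e i) = c ^ d * (\<Prod>i\<in>UNIV. x $ i ^ e i)" if "e \<in> E" for e
    by (simp add: power_mult_distrib prod.distrib power_sum[symmetric] E(1)[OF that])
  then show ?thesis by (simp add: E(2) sum_distrib_left mult.left_commute)
qed

lemma hom_diag:
  assumes "f \<in> hom_poly_funs d"
  shows "(\<lambda>x. f (\<chi> i. g i * x $ i)) \<in> hom_poly_funs d"
proof -
  obtain E c where E: "finite E" "\<And>e. e \<in> E \<Longrightarrow> (\<Sum>i\<in>UNIV. e i) = d"
    "\<And>x. f x = (\<Sum>e\<in>E. c e * (\<Prod>i\<in>UNIV. x $ i ^ e i))"
    using hom_polyE[OF assms] by metis
  have "(\<lambda>x. \<Sum>e\<in>E. (c e * (\<Prod>i\<in>UNIV. g i ^ e i)) * (\<Prod>i\<in>UNIV. x $ i ^ e i)) \<in> hom_poly_funs d"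
    by (intro hom_sum hom_scale hom_monom E)
  then show ?thesis
    by (simp add: E(3) power_mult_distrib prod.distrib mult.assoc)
qed

text \<open>Each exponent \<open>e i\<close> is at most \<open>d\<close>, so the \<open>d\<close>-th
  power of the product of all coordinates turns the inverse power of \<open>x $ i\<close> into the
  power \<open>d - e i\<close>. Equations of the variety are transported through coordinatewise
  inversion in this way.\<close>

lemma hom_inverse:
  assumes "f \<in> hom_poly_funs d"
  obtains g e where "g \<in> hom_poly_funs e"
    "\<And>x. (\<forall>i. x $ i \<noteq> 0) \<Longrightarrow> g x = (\<Prod>i\<in>UNIV. x $ i) ^ d * f (\<chi> i. inverse (x $ i))"
proof -
  obtain E c where E: "finite E" "\<And>e. e \<in> E \<Longrightarrow> (\<Sum>i\<in>UNIV. e i) = d"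
    "\<And>x. f x = (\<Sum>e\<in>E. c e * (\<Prod>i\<in>UNIV. x $ i ^ e i))"
    using hom_polyE[OF assms] by metis
  have le: "e i \<le> d" if "e \<in> E" for e i
    using member_le_sum[of i UNIV e] E(2)[OF that] by auto
  let ?g = "\<lambda>x. \<Sum>e\<in>E. c e * (\<Prod>i\<in>UNIV. x $ i ^ (d - e i))"
  have "?g \<in> hom_poly_funs (CARD('b) * d - d)"
  proof (intro hom_sum hom_scale hom_monom)
    fix e assume "e \<in> E"
    then show "(\<Sum>i\<in>UNIV. d - e i) = CARD('b) * d - d"
      using le E(2) by (subst sum_subtractf_nat) auto
  qed
  moreover have "?g x = (\<Prod>i\<in>UNIV. x $ i) ^ d * f (\<chi> i. inverse (x $ i))" if "\<forall>i. x $ i \<noteq> 0" for x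
    unfolding E(3) sum_distrib_left
  proof (rule sum.cong[OF refl])
    fix e assume "e \<in> E"
    then show "c e * (\<Prod>i\<in>UNIV. x $ i ^ (d - e i)) = (\<Prod>i\<in>UNIV. x $ i) ^ d *
        (c e * (\<Prod>i\<in>UNIV. (\<chi> i. inverse (x $ i)) $ i ^ e i))"
      using that le by (simp add: prod_power_distrib prod.distrib[symmetric] power_diff
          divide_simps power_inverse)
  qed
  ultimately show ?thesis using that by blast
qed

text \<open>A power of \<open>z $ i\<close> clears the denominators that arise when \<open>z\<close>
  is rescaled to the slice where its \<open>i\<close>-th coordinate is \<open>\<xi>\<close>.
  Polynomial equations on the slice thereby become forms, the only functions that the closure in
  projective space can test.\<close>

lemma pol_homogenize:
  assumes "pol f" "\<xi> \<noteq> 0"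
  obtains d F where "F \<in> hom_poly_funs d"
    "\<And>z. z $ i \<noteq> 0 \<Longrightarrow> F z = (z $ i) ^ d * f ((\<xi> / z $ i) *s z)"
proof -
  have "\<exists>d. \<exists>F\<in>hom_poly_funs d. \<forall>z. z $ i \<noteq> 0 \<longrightarrow> F z = (z $ i) ^ d * f ((\<xi> / z $ i) *s z)"
    using assms(1)
  proof (induction rule: pol_induct)
    case (const c)
    then show ?case by (intro exI[of _ 0] bexI[OF _ hom_const[of c]]) auto
  next
    case (nth j)
    then show ?case
      by (intro exI[of _ 1] bexI[OF _ hom_scale[OF hom_nth[of j], of \<xi>]]) auto
  next
    case (add f g)
    then obtain d F e G where *: "F \<in> hom_poly_funs d" "G \<in> hom_poly_funs e"
      "\<And>z. z $ i \<noteq> 0 \<Longrightarrow> F z = (z $ i) ^ d * f ((\<xi> / z $ i) *s z)"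
      "\<And>z. z $ i \<noteq> 0 \<Longrightarrow> G z = (z $ i) ^ e * g ((\<xi> / z $ i) *s z)" by blast
    have "(\<lambda>z. z $ i ^ e * F z + z $ i ^ d * G z) \<in> hom_poly_funs (e + d)"
      using hom_mult[OF hom_power[OF hom_nth[of i], of e] *(1)]
        hom_mult[OF hom_power[OF hom_nth[of i], of d] *(2)]
      by (intro hom_add) (auto simp: add.commute)
    then show ?case
      by (intro exI[of _ "e + d"] bexI[rotated]) (use * in \<open>auto simp: power_add algebra_simps\<close>)
  next
    case (mult f g)
    then obtain d F e G where *: "F \<in> hom_poly_funs d" "G \<in> hom_poly_funs e"
      "\<And>z. z $ i \<noteq> 0 \<Longrightarrow> F z = (z $ i) ^ d * f ((\<xi> / z $ i) *s z)"
      "\<And>z. z $ i \<noteq> 0 \<Longrightarrow> G z = (z $ i) ^ e * g ((\<xi> / z $ i) *s z)" by blast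
    show ?case
      by (intro exI[of _ "d + e"] bexI[OF _ hom_mult[OF *(1,2)]]) (use * in \<open>auto simp: power_add algebra_simps\<close>)
  qed
  then show ?thesis using that by blast
qed

lemma hom_along_curve:
  assumes "f \<in> hom_poly_funs d"
  obtains p where "\<And>s. poly p s = f (\<chi> i. poly (q i) s)"
proof -
  obtain E c where E: "\<And>x. f x = (\<Sum>e\<in>E. c e * (\<Prod>i\<in>UNIV. x $ i ^ e i))"
    using hom_polyE[OF assms] by metis
  show ?thesis
    by (rule that[of "\<Sum>e\<in>E. smult (c e) (\<Prod>i\<in>UNIV. q i ^ e i)"]) (simp add: E poly_sum poly_prod)
qed

section \<open>Underdetermined linear systems and the number of monomials\<close>

lemma ex_nonzero_solution:
  fixes A :: "'e \<Rightarrow> 'i \<Rightarrow> 'a::field"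
  assumes "finite E" "finite I" "card E < card I"
  obtains c where "\<And>e. e \<in> E \<Longrightarrow> (\<Sum>i\<in>I. c i * A e i) = 0" "\<exists>i\<in>I. c i \<noteq> 0"
proof -
  have "\<exists>c. (\<forall>e\<in>E. (\<Sum>i\<in>I. c i * A e i) = 0) \<and> (\<exists>i\<in>I. c i \<noteq> 0)"
    using assms
  proof (induction E arbitrary: I A rule: finite_induct)
    case empty
    then obtain i where "i \<in> I" by fastforce
    then show ?case by (intro exI[of _ "\<lambda>_. 1"]) auto
  next
    case (insert e E)
    show ?case
    proof (cases "\<forall>i\<in>I. A e i = 0")
      case True
      then show ?thesis using insert.IH[of I A] insert.prems insert.hyps by auto
    next
      case False
      then obtain j where j: "j \<in> I" "A e j \<noteq> 0" by auto
      \<comment> \<open>\<open>?B\<close> is the system after the unknown \<open>j\<close> has been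
        eliminated by means of the equation \<open>e\<close>; below, \<open>?t\<close> is the value
        that this equation forces on the unknown \<open>j\<close>.\<close>
      let ?B = "\<lambda>f i. A f i - A e i / A e j * A f j"
      obtain c where c: "\<And>f. f \<in> E \<Longrightarrow> (\<Sum>i\<in>I - {j}. c i * ?B f i) = 0" "\<exists>i\<in>I - {j}. c i \<noteq> 0"
      proof -
        have "finite (I - {j})" "card E < card (I - {j})" using insert.prems insert.hyps j by auto
        from insert.IH[OF this, of ?B] show ?thesis using that by blast
      qed
      let ?t = "- (\<Sum>i\<in>I - {j}. c i * A e i) / A e j"
      define c' where "c' = c(j := ?t)"
      have eq: "(\<Sum>i\<in>I. c' i * A f i) = ?t * A f j + (\<Sum>i\<in>I - {j}. c i * A f i)" for f
        using insert.prems j by (subst sum.remove[of I j]) (auto simp: c'_def intro!: sum.cong)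
      have "(\<Sum>i\<in>I. c' i * A f i) = 0" if "f \<in> E" for f
      proof -
        have "(\<Sum>i\<in>I - {j}. c i * ?B f i) = (\<Sum>i\<in>I - {j}. c i * A f i) + ?t * A f j"
          by (simp add: right_diff_distrib sum_subtractf sum_distrib_right sum_divide_distrib)
            (simp add: algebra_simps)
        then show ?thesis using c(1)[OF that] eq[of f] by simp
      qed
      moreover have "(\<Sum>i\<in>I. c' i * A e i) = 0" using eq[of e] j by simp
      moreover have "\<exists>i\<in>I. c' i \<noteq> 0" using c(2) by (auto simp: c'_def)
      ultimately show ?thesis by blast
    qed
  qed
  then show ?thesis using that by blast
qed

text \<open>A multiset stands for a monomial, so these are the monomials of degree at most
  \<open>k\<close> in the variables \<open>J\<close>; with multisets their values are plain products
  over \<open>M\<close>.\<close>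

definition msets :: "'b set \<Rightarrow> nat \<Rightarrow> 'b multiset set" where
  "msets J k = {M. set_mset M \<subseteq> J \<and> size M \<le> k}"

text \<open>Pascal's rule for monomials: either the variable \<open>j\<close> does not occur, or it
  can be divided out.\<close>

lemma msets_insert_Suc:
  "msets (insert j J) (Suc k) = msets J (Suc k) \<union> add_mset j ` msets (insert j J) k" (is "?L = ?R")
proof
  show "?L \<subseteq> ?R"
  proof
    fix M assume M: "M \<in> ?L"
    show "M \<in> ?R"
    proof (cases "j \<in># M")
      case True
      then obtain M' where "M = add_mset j M'" by (metis mset_add)
      then show ?thesis using M by (auto simp: msets_def)
    next
      case False
      then show ?thesis using M by (auto simp: msets_def)
    qed
  qed
qed (auto simp: msets_def)

lemma card_msets:
  assumes "finite J"
  shows "finite (msets J k) \<and> card (msets J k) = (card J + k) choose k"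
  using assms
proof (induction J arbitrary: k rule: finite_induct)
  case empty
  have "msets {} k = {{#} :: 'a multiset}" by (auto simp: msets_def)
  then show ?case by simp
next
  case (insert j J)
  show ?case
  proof (induction k)
    case 0
    have "msets (insert j J) 0 = {{#}}" by (auto simp: msets_def)
    then show ?case by simp
  next
    case (Suc k)
    have "msets J (Suc k) \<inter> add_mset j ` msets (insert j J) k = {}"
      using insert.hyps by (auto simp: msets_def)
    moreover have "card (add_mset j ` msets (insert j J) k) = card (msets (insert j J) k)"
      by (rule card_image) (auto simp: inj_on_def)
    ultimately show ?case
      using Suc insert.IH[of "Suc k"] insert.hyps
      by (simp add: msets_insert_Suc card_Un_disjoint)
  qed
qed

text \<open>Products of forms are forms, so the generating sets are closed under intersection and
  already constitute a basis.\<close>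

lemma openin_zariski_proj:
  "openin (zariski_proj :: ('a::field ^ 'm::finite) topology) V \<longleftrightarrow>
    (\<forall>x\<in>V. x \<noteq> 0 \<and> (\<exists>d. \<exists>f\<in>hom_poly_funs d. f x \<noteq> 0 \<and> (\<forall>y. y \<noteq> 0 \<and> f y \<noteq> 0 \<longrightarrow> y \<in> V)))"
  (is "_ \<longleftrightarrow> ?R V")
proof
  assume "openin zariski_proj V"
  then have "generate_topology_on {{x :: 'a ^ 'm. x \<noteq> 0 \<and> f x \<noteq> 0} | f. \<exists>d. f \<in> hom_poly_funs d} V"
    unfolding zariski_proj_def by (simp add: openin_topology_generated_by_iff)
  then show "?R V"
  proof induction
    case Empty
    then show ?case by simp
  next
    case (Int A B)
    show ?case
    proof
      fix x assume x: "x \<in> A \<inter> B"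
      obtain d f where f: "f \<in> hom_poly_funs d" "f x \<noteq> 0" "\<forall>y. y \<noteq> 0 \<and> f y \<noteq> 0 \<longrightarrow> y \<in> A"
        using Int.IH(1) x by blast
      obtain e g where g: "g \<in> hom_poly_funs e" "g x \<noteq> 0" "\<forall>y. y \<noteq> 0 \<and> g y \<noteq> 0 \<longrightarrow> y \<in> B"
        using Int.IH(2) x by blast
      show "x \<noteq> 0 \<and> (\<exists>d. \<exists>f\<in>hom_poly_funs d. f x \<noteq> 0 \<and> (\<forall>y. y \<noteq> 0 \<and> f y \<noteq> 0 \<longrightarrow> y \<in> A \<inter> B))"
        using Int.IH(1) x f g by (intro conjI exI[of _ "d + e"] bexI[OF _ hom_mult[OF f(1) g(1)]]) auto
    qed
  next
    case (UN K)
    show ?case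
    proof
      fix x assume "x \<in> \<Union> K"
      then obtain k where k: "k \<in> K" "x \<in> k" by blast
      then obtain d f where "x \<noteq> 0" "f \<in> hom_poly_funs d" "f x \<noteq> 0"
        "\<forall>y. y \<noteq> 0 \<and> f y \<noteq> 0 \<longrightarrow> y \<in> k" using UN.IH[OF k(1)] by blast
      moreover have "k \<subseteq> \<Union> K" using k(1) by blast
      ultimately show "x \<noteq> 0 \<and> (\<exists>d. \<exists>f\<in>hom_poly_funs d. f x \<noteq> 0 \<and> (\<forall>y. y \<noteq> 0 \<and> f y \<noteq> 0 \<longrightarrow> y \<in> \<Union> K))"
        by (metis in_mono)
    qed
  next
    case (Basis S)
    then show ?case by blast
  qed
next
  assume R: "?R V"
  have "V = \<Union> {{x. x \<noteq> 0 \<and> f x \<noteq> 0} | f. (\<exists>d. f \<in> hom_poly_funs d) \<and> (\<forall>y. y \<noteq> 0 \<and> f y \<noteq> 0 \<longrightarrow> y \<in> V)}"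
    (is "V = \<Union> ?K")
  proof
    show "V \<subseteq> \<Union> ?K"
    proof
      fix x assume "x \<in> V"
      then obtain d f where "x \<noteq> 0" "f \<in> hom_poly_funs d" "f x \<noteq> 0" "\<forall>y. y \<noteq> 0 \<and> f y \<noteq> 0 \<longrightarrow> y \<in> V"
        using R by blast
      then show "x \<in> \<Union> ?K" by (intro UnionI[of "{x. x \<noteq> 0 \<and> f x \<noteq> 0}"]) auto
    qed
  qed auto
  moreover have "openin zariski_proj (\<Union> ?K)"
    unfolding zariski_proj_def
    by (intro openin_Union) (auto intro!: topology_generated_by_Basis)
  ultimately show "openin zariski_proj V" by simp
qed

lemma openin_basic: "f \<in> hom_poly_funs d \<Longrightarrow> openin zariski_proj {x. x \<noteq> 0 \<and> f x \<noteq> 0}"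
  unfolding openin_zariski_proj by blast

lemma topspace_zariski_proj: "topspace zariski_proj = {x. x \<noteq> 0}"
proof
  show "topspace zariski_proj \<subseteq> {x :: 'a ^ 'b. x \<noteq> 0}"
    using openin_topspace[of "zariski_proj :: ('a ^ 'b) topology"] unfolding openin_zariski_proj by blast
  show "{x :: 'a ^ 'b. x \<noteq> 0} \<subseteq> topspace zariski_proj"
    using openin_subset[OF openin_basic[OF hom_const[of 1]]] by simp
qed

text \<open>A nonzero vector outside the closure has a basic neighbourhood that misses
  \<open>S\<close>, that is, a form vanishing on \<open>S\<close> but not there. The guard
  \<open>y \<noteq> 0\<close> accounts for a zero vector in \<open>S\<close>, which lies outside the
  space.\<close>

lemma closure_zariski_proj:
  "x \<in> zariski_proj closure_of S \<longleftrightarrow>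
    x \<noteq> 0 \<and> (\<forall>d. \<forall>f\<in>hom_poly_funs d. (\<forall>y\<in>S. y \<noteq> 0 \<longrightarrow> f y = 0) \<longrightarrow> f x = 0)" (is "?L \<longleftrightarrow> ?R")
proof
  assume L: ?L
  then have "x \<noteq> 0" by (auto simp: in_closure_of topspace_zariski_proj)
  moreover have "f x = 0" if f: "f \<in> hom_poly_funs d" "\<forall>y\<in>S. y \<noteq> 0 \<longrightarrow> f y = 0" for d f
  proof (rule ccontr)
    assume "f x \<noteq> 0"
    then have *: "x \<in> {y. y \<noteq> 0 \<and> f y \<noteq> 0}" using \<open>x \<noteq> 0\<close> by simp
    have "\<And>T. x \<in> T \<Longrightarrow> openin zariski_proj T \<Longrightarrow> \<exists>y. y \<in> S \<and> y \<in> T"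
      using L by (simp add: in_closure_of)
    from this[OF * openin_basic[OF f(1)]]
    obtain y where "y \<in> S" "y \<in> {y. y \<noteq> 0 \<and> f y \<noteq> 0}" by (elim exE conjE)
    then have y: "y \<in> S" "y \<noteq> 0" "f y \<noteq> 0" by simp_all
    have "y \<noteq> 0 \<longrightarrow> f y = 0" by (rule bspec[OF f(2) y(1)])
    then show False using y(2,3) by (rule_tac notE[OF y(3) mp])
  qed
  ultimately show ?R by blast
next
  assume R: ?R
  show ?L unfolding in_closure_of topspace_zariski_proj
  proof (intro conjI allI impI)
    show "x \<in> {x. x \<noteq> 0}" using R by simp
    fix T assume T: "x \<in> T \<and> openin zariski_proj T"
    then obtain d f where f: "f \<in> hom_poly_funs d" "f x \<noteq> 0" "\<forall>y. y \<noteq> 0 \<and> f y \<noteq> 0 \<longrightarrow> y \<in> T"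
      unfolding openin_zariski_proj by blast
    then show "\<exists>y. y \<in> S \<and> y \<in> T" using R by blast
  qed
qed

lemma closedin_zariski_proj_vanishing:
  assumes "f \<in> hom_poly_funs d"
  shows "closedin zariski_proj {x. x \<noteq> 0 \<and> f x = 0}"
proof -
  have "{x. x \<noteq> 0} - {x. x \<noteq> 0 \<and> f x = 0} = {x. x \<noteq> 0 \<and> f x \<noteq> 0}" by auto
  then show ?thesis
    using openin_basic[OF assms] by (auto simp: closedin_def topspace_zariski_proj)
qed

lemma closedin_separate:
  assumes "closedin zariski_proj Z" "x \<notin> Z" "x \<noteq> 0"
  obtains d f where "f \<in> hom_poly_funs d" "\<And>y. y \<in> Z \<Longrightarrow> f y = 0" "f x \<noteq> 0"
proof -
  have "x \<notin> zariski_proj closure_of Z" using assms by (simp add: closure_of_closedin)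
  moreover have "z \<noteq> 0" if "z \<in> Z" for z
    using closedin_subset[OF assms(1)] that by (auto simp: topspace_zariski_proj)
  ultimately show ?thesis using that assms(3) unfolding closure_zariski_proj by blast
qed

section \<open>Local rings and jets\<close>

lemma stalkI:
  assumes "F \<in> hom_poly_funs (d + e)" "G \<in> hom_poly_funs e" "G x \<noteq> 0"
    "\<And>y. y \<in> X \<Longrightarrow> G y \<noteq> 0 \<Longrightarrow> s y = F y / G y"
  shows "s \<in> stalk X x d"
  using assms unfolding stalk_def by blast

lemma stalkE:
  assumes "s \<in> stalk X x d"
  obtains e F G where "F \<in> hom_poly_funs (d + e)" "G \<in> hom_poly_funs e" "G x \<noteq> 0"
    "\<And>y. y \<in> X \<Longrightarrow> G y \<noteq> 0 \<Longrightarrow> s y = F y / G y"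
  using assms unfolding stalk_def by blast

lemma stalk_hom: "F \<in> hom_poly_funs d \<Longrightarrow> F \<in> stalk X x d"
  by (rule stalkI[where e = 0 and F = F and G = "\<lambda>_. 1"]) (auto intro: hom_const)

lemma stalk_const: "(\<lambda>_. c) \<in> stalk X x 0"
  by (intro stalk_hom hom_const)

lemma stalk_quotient:
  "F \<in> hom_poly_funs d \<Longrightarrow> G \<in> hom_poly_funs d \<Longrightarrow> G x \<noteq> 0 \<Longrightarrow> (\<lambda>y. F y / G y) \<in> stalk X x 0"
  by (rule stalkI[where e = d and F = F and G = G]) auto

lemma stalk_add:
  assumes "s \<in> stalk X x d" "t \<in> stalk X x d"
  shows "(\<lambda>y. s y + t y) \<in> stalk X x d"
proof -
  obtain e F G where 1: "F \<in> hom_poly_funs (d + e)" "G \<in> hom_poly_funs e" "G x \<noteq> 0"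
    "\<And>y. y \<in> X \<Longrightarrow> G y \<noteq> 0 \<Longrightarrow> s y = F y / G y" using stalkE[OF assms(1)] by metis
  obtain e' F' G' where 2: "F' \<in> hom_poly_funs (d + e')" "G' \<in> hom_poly_funs e'" "G' x \<noteq> 0"
    "\<And>y. y \<in> X \<Longrightarrow> G' y \<noteq> 0 \<Longrightarrow> t y = F' y / G' y" using stalkE[OF assms(2)] by metis
  show ?thesis
    by (rule stalkI[where F = "\<lambda>y. F y * G' y + F' y * G y" and G = "\<lambda>y. G y * G' y" and e = "e + e'"])
      (use 1 2 hom_mult[OF 1(1) 2(2)] hom_mult[OF 2(1) 1(2)] in
        \<open>auto intro!: hom_add hom_mult simp: ac_simps field_simps\<close>)
qed

lemma stalk_mult:
  assumes "s \<in> stalk X x d" "t \<in> stalk X x d'"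
  shows "(\<lambda>y. s y * t y) \<in> stalk X x (d + d')"
proof -
  obtain e F G where 1: "F \<in> hom_poly_funs (d + e)" "G \<in> hom_poly_funs e" "G x \<noteq> 0"
    "\<And>y. y \<in> X \<Longrightarrow> G y \<noteq> 0 \<Longrightarrow> s y = F y / G y" using stalkE[OF assms(1)] by metis
  obtain e' F' G' where 2: "F' \<in> hom_poly_funs (d' + e')" "G' \<in> hom_poly_funs e'" "G' x \<noteq> 0"
    "\<And>y. y \<in> X \<Longrightarrow> G' y \<noteq> 0 \<Longrightarrow> t y = F' y / G' y" using stalkE[OF assms(2)] by metis
  show ?thesis
    by (rule stalkI[where F = "\<lambda>y. F y * F' y" and G = "\<lambda>y. G y * G' y" and e = "e + e'"])
      (use 1 2 hom_mult[OF 1(1) 2(1)] hom_mult[OF 1(2) 2(2)] in \<open>auto simp: ac_simps\<close>)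
qed

lemma stalk_mult0: "s \<in> stalk X x 0 \<Longrightarrow> t \<in> stalk X x d \<Longrightarrow> (\<lambda>y. s y * t y) \<in> stalk X x d"
  using stalk_mult[of s X x 0 t d] by simp

lemma stalk_scale: "t \<in> stalk X x d \<Longrightarrow> (\<lambda>y. c * t y) \<in> stalk X x d"
  using stalk_mult0[OF stalk_const] .

lemma stalk_diff: "s \<in> stalk X x d \<Longrightarrow> t \<in> stalk X x d \<Longrightarrow> (\<lambda>y. s y - t y) \<in> stalk X x d"
  using stalk_add[of s X x d "\<lambda>y. -1 * t y"] stalk_scale[of t X x d "-1"] by simp

text \<open>The functions that represent zero in the stalk. For \<open>x\<close> in \<open>X\<close>
  they belong to all the ideals and powers below, so that membership depends on germs only.\<close>

definition zero_germ :: "('a::field ^ 'm::finite) set \<Rightarrow> 'a ^ 'm \<Rightarrow> ('a ^ 'm \<Rightarrow> 'a) \<Rightarrow> bool" where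
  "zero_germ X x z \<longleftrightarrow> (\<exists>e. \<exists>G\<in>hom_poly_funs e. G x \<noteq> 0 \<and> (\<forall>y\<in>X. G y \<noteq> 0 \<longrightarrow> z y = 0))"

lemma zero_germI:
  "G \<in> hom_poly_funs e \<Longrightarrow> G x \<noteq> 0 \<Longrightarrow> (\<And>y. y \<in> X \<Longrightarrow> G y \<noteq> 0 \<Longrightarrow> z y = 0) \<Longrightarrow> zero_germ X x z"
  unfolding zero_germ_def by blast

lemma zero_germ_stalk: "zero_germ X x z \<Longrightarrow> z \<in> stalk X x d"
  unfolding zero_germ_def by (auto intro!: stalkI[where F = "\<lambda>_. 0"] hom_zero)

lemma zero_germ_at: "zero_germ X x z \<Longrightarrow> x \<in> X \<Longrightarrow> z x = 0"
  unfolding zero_germ_def by blast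

lemma zero_germ_indicator:
  "zero_germ X x z \<Longrightarrow> zero_germ X x (\<lambda>y. if z y = 0 then 0 else 1)"
  unfolding zero_germ_def by auto

lemma sum_lessThan_add:
  "(\<Sum>i<p + q. h i) = (\<Sum>i<p. h i) + (\<Sum>i<q. h (p + i :: nat) :: 'b::comm_monoid_add)"
  by (induction q) (simp_all add: add.assoc)

lemma ideal_multI: "f \<in> I \<Longrightarrow> s \<in> M \<Longrightarrow> (\<lambda>y. f y * s y) \<in> ideal_mult I M"
  unfolding ideal_mult_def
  by (intro CollectI exI[of _ 1] exI[of _ "\<lambda>_. f"] exI[of _ "\<lambda>_. s"]) auto

lemma ideal_mult_zero: "(\<lambda>y. 0) \<in> ideal_mult I M"
  unfolding ideal_mult_def by (intro CollectI exI[of _ 0]) auto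

lemma ideal_mult_add:
  assumes "g \<in> ideal_mult I M" "h \<in> ideal_mult I M"
  shows "(\<lambda>y. g y + h y) \<in> ideal_mult I M"
proof -
  obtain p f s where 1: "g = (\<lambda>y. \<Sum>i<p::nat. f i y * s i y)" "\<forall>i<p. f i \<in> I \<and> s i \<in> M"
    using assms(1) unfolding ideal_mult_def by blast
  obtain p' f' s' where 2: "h = (\<lambda>y. \<Sum>i<p'::nat. f' i y * s' i y)" "\<forall>i<p'. f' i \<in> I \<and> s' i \<in> M"
    using assms(2) unfolding ideal_mult_def by blast
  have "(\<Sum>i<p. f i y * s i y) + (\<Sum>i<p'. f' i y * s' i y) =
    (\<Sum>i<p + p'. (if i < p then f i else f' (i - p)) y * (if i < p then s i else s' (i - p)) y)" for y
    by (simp add: sum_lessThan_add)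
  then show ?thesis
    unfolding ideal_mult_def
    by (intro CollectI exI[of _ "p + p'"] exI[of _ "\<lambda>i. if i < p then f i else f' (i - p)"]
        exI[of _ "\<lambda>i. if i < p then s i else s' (i - p)"]) (use 1 2 in auto)
qed

lemma ideal_mult_induct [consumes 1, case_names zero step]:
  assumes "g \<in> ideal_mult I M"
    and zero: "P (\<lambda>y. 0)"
    and step: "\<And>f s g. f \<in> I \<Longrightarrow> s \<in> M \<Longrightarrow> g \<in> ideal_mult I M \<Longrightarrow> P g \<Longrightarrow> P (\<lambda>y. g y + f y * s y)"
  shows "P g"
proof -
  obtain p f s where 1: "g = (\<lambda>y. \<Sum>i<p::nat. f i y * s i y)" "\<And>i. i < p \<Longrightarrow> f i \<in> I \<and> s i \<in> M"
    using assms(1) unfolding ideal_mult_def by blast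
  have "P (\<lambda>y. \<Sum>i<q. f i y * s i y)" if "q \<le> p" for q
    using that
  proof (induction q)
    case (Suc q)
    have "(\<lambda>y. \<Sum>i<q. f i y * s i y) \<in> ideal_mult I M"
      unfolding ideal_mult_def using 1(2) Suc.prems by fastforce
    with Suc show ?case using step[of "f q" "s q"] 1(2)[of q] by simp
  qed (use zero in simp)
  then show ?thesis using 1 by simp
qed

lemma max_ideal_stalk: "f \<in> max_ideal X x \<Longrightarrow> f \<in> stalk X x 0"
  unfolding max_ideal_def by simp

lemma max_ideal_zero_germ: "zero_germ X x z \<Longrightarrow> x \<in> X \<Longrightarrow> z \<in> max_ideal X x"
  unfolding max_ideal_def by (auto intro: zero_germ_stalk zero_germ_at)

lemma max_ideal_add: "f \<in> max_ideal X x \<Longrightarrow> g \<in> max_ideal X x \<Longrightarrow> (\<lambda>y. f y + g y) \<in> max_ideal X x"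
  unfolding max_ideal_def by (auto intro: stalk_add)

lemma max_ideal_mult: "f \<in> stalk X x 0 \<Longrightarrow> g \<in> max_ideal X x \<Longrightarrow> (\<lambda>y. f y * g y) \<in> max_ideal X x"
  unfolding max_ideal_def by (auto intro: stalk_mult0)

lemma max_ideal_scale: "g \<in> max_ideal X x \<Longrightarrow> (\<lambda>y. c * g y) \<in> max_ideal X x"
  using max_ideal_mult[OF stalk_const] .

lemma max_ideal_zero: "(\<lambda>_. 0) \<in> max_ideal X x"
  unfolding max_ideal_def by (auto intro: stalk_const)

lemma max_ideal_sum:
  "(\<And>i. i \<in> A \<Longrightarrow> f i \<in> max_ideal X x) \<Longrightarrow> (\<lambda>y. \<Sum>i\<in>A. f i y) \<in> max_ideal X x"
  by (induction A rule: infinite_finite_induct) (auto intro!: max_ideal_zero max_ideal_add)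

lemma max_ideal_minus_value: "f \<in> stalk X x 0 \<Longrightarrow> (\<lambda>y. f y - f x) \<in> max_ideal X x"
  unfolding max_ideal_def by (auto intro: stalk_diff stalk_const)

lemma ideal_mult_zero_germ:
  assumes "zero_germ X x z" "x \<in> X" "z \<in> M"
  shows "z \<in> ideal_mult (max_ideal X x) M"
proof -
  have "(\<lambda>y. (if z y = 0 then 0 else 1) * z y) \<in> ideal_mult (max_ideal X x) M"
    by (intro ideal_multI max_ideal_zero_germ zero_germ_indicator assms)
  moreover have "(\<lambda>y. (if z y = 0 then 0 else 1) * z y) = z" by auto
  ultimately show ?thesis by simp
qed

lemma ideal_mult_stalk_mult:
  assumes "g \<in> ideal_mult (max_ideal X x) M" "h \<in> stalk X x 0"
  shows "(\<lambda>y. h y * g y) \<in> ideal_mult (max_ideal X x) M"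
  using assms(1)
proof (induction rule: ideal_mult_induct)
  case zero
  then show ?case by (simp add: ideal_mult_zero)
next
  case (step f s g)
  have "(\<lambda>y. h y * g y + (h y * f y) * s y) \<in> ideal_mult (max_ideal X x) M"
    by (intro ideal_mult_add ideal_multI max_ideal_mult step assms)
  then show ?case by (simp add: algebra_simps)
qed

definition max_square :: "('a::field ^ 'm::finite) set \<Rightarrow> 'a ^ 'm \<Rightarrow> ('a ^ 'm \<Rightarrow> 'a) set" where
  "max_square X x = ideal_mult (max_ideal X x) (max_ideal X x)"

lemma max_squareI:
  "f \<in> max_ideal X x \<Longrightarrow> g \<in> max_ideal X x \<Longrightarrow> (\<lambda>y. f y * g y) \<in> max_square X x"
  unfolding max_square_def by (rule ideal_multI)

lemma max_square_zero: "(\<lambda>_. 0) \<in> max_square X x"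
  unfolding max_square_def by (rule ideal_mult_zero)

lemma max_square_add:
  "f \<in> max_square X x \<Longrightarrow> g \<in> max_square X x \<Longrightarrow> (\<lambda>y. f y + g y) \<in> max_square X x"
  unfolding max_square_def by (rule ideal_mult_add)

lemma max_square_mult:
  "h \<in> stalk X x 0 \<Longrightarrow> g \<in> max_square X x \<Longrightarrow> (\<lambda>y. h y * g y) \<in> max_square X x"
  unfolding max_square_def by (rule ideal_mult_stalk_mult)

lemma max_square_scale: "g \<in> max_square X x \<Longrightarrow> (\<lambda>y. c * g y) \<in> max_square X x"
  using max_square_mult[OF stalk_const] .

lemma max_square_diff:
  "f \<in> max_square X x \<Longrightarrow> g \<in> max_square X x \<Longrightarrow> (\<lambda>y. f y - g y) \<in> max_square X x"
  using max_square_add[of f X x "\<lambda>y. -1 * g y"] max_square_scale[of g X x "-1"] by simp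

lemma max_square_sum:
  "(\<And>i. i \<in> A \<Longrightarrow> f i \<in> max_square X x) \<Longrightarrow> (\<lambda>y. \<Sum>i\<in>A. f i y) \<in> max_square X x"
  by (induction A rule: infinite_finite_induct) (auto intro!: max_square_zero max_square_add)

lemma max_square_zero_germ: "zero_germ X x z \<Longrightarrow> x \<in> X \<Longrightarrow> z \<in> max_square X x"
  unfolding max_square_def by (intro ideal_mult_zero_germ max_ideal_zero_germ)

lemma max_power_0: "max_power X x 0 = stalk X x 1"
  unfolding max_power_def by simp

lemma max_power_Suc: "max_power X x (Suc r) = ideal_mult (max_ideal X x) (max_power X x r)"
  unfolding max_power_def by simp

lemma max_power_SucI:
  "f \<in> max_ideal X x \<Longrightarrow> s \<in> max_power X x r \<Longrightarrow> (\<lambda>y. f y * s y) \<in> max_power X x (Suc r)"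
  unfolding max_power_Suc by (rule ideal_multI)

lemma max_power_add:
  "f \<in> max_power X x r \<Longrightarrow> g \<in> max_power X x r \<Longrightarrow> (\<lambda>y. f y + g y) \<in> max_power X x r"
  by (cases r) (auto simp: max_power_0 max_power_Suc intro: stalk_add ideal_mult_add)

lemma max_power_zero_germ: "zero_germ X x z \<Longrightarrow> x \<in> X \<Longrightarrow> z \<in> max_power X x r"
  by (induction r) (auto simp: max_power_0 max_power_Suc intro: zero_germ_stalk ideal_mult_zero_germ)

lemma max_power_mult:
  "h \<in> stalk X x 0 \<Longrightarrow> g \<in> max_power X x r \<Longrightarrow> (\<lambda>y. h y * g y) \<in> max_power X x r"
  by (cases r) (auto simp: max_power_0 max_power_Suc intro: stalk_mult0 ideal_mult_stalk_mult)

lemma max_power_scale: "g \<in> max_power X x r \<Longrightarrow> (\<lambda>y. c * g y) \<in> max_power X x r"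
  using max_power_mult[OF stalk_const] .

lemma max_power_zero: "(\<lambda>_. 0) \<in> max_power X x r"
  by (cases r) (auto simp: max_power_0 max_power_Suc intro: ideal_mult_zero stalk_hom hom_zero)

text \<open>Two functions that agree on \<open>X\<close> near \<open>x\<close> differ by a
  representative of zero. Fractions may hence be computed where their denominators do not vanish,
  whatever their values elsewhere.\<close>

lemma max_power_germ:
  assumes "s \<in> max_power X x r" "x \<in> X" "G \<in> hom_poly_funs e" "G x \<noteq> 0"
    "\<And>y. y \<in> X \<Longrightarrow> G y \<noteq> 0 \<Longrightarrow> s' y = s y"
  shows "s' \<in> max_power X x r"
proof -
  have "zero_germ X x (\<lambda>y. s' y - s y)" using assms(3-5) by (intro zero_germI) auto
  from max_power_add[OF assms(1) max_power_zero_germ[OF this assms(2)]] show ?thesis by simp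
qed

lemma max_square_germ:
  assumes "s \<in> max_square X x" "x \<in> X" "G \<in> hom_poly_funs e" "G x \<noteq> 0"
    "\<And>y. y \<in> X \<Longrightarrow> G y \<noteq> 0 \<Longrightarrow> s' y = s y"
  shows "s' \<in> max_square X x"
proof -
  have "zero_germ X x (\<lambda>y. s' y - s y)" using assms(3-5) by (intro zero_germI) auto
  from max_square_add[OF assms(1) max_square_zero_germ[OF this assms(2)]] show ?thesis by simp
qed

text \<open>Multiplication by a linear form passes from the local ring to the stalk of the line
  bundle. Through it the estimates for jets of linear forms bear on the cotangent space.\<close>

lemma hom_mult_max_square:
  assumes "s \<in> max_square X x" "F \<in> hom_poly_funs 1"
  shows "(\<lambda>y. F y * s y) \<in> max_power X x 2"
  using assms(1) unfolding max_square_def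
proof (induction rule: ideal_mult_induct)
  case zero
  then show ?case by (simp add: max_power_zero)
next
  case (step f s g)
  have "F \<in> max_power X x 0" using assms(2) by (simp add: max_power_0 stalk_hom)
  then have "(\<lambda>y. f y * (s y * F y)) \<in> max_power X x 2"
    unfolding numeral_2_eq_2 by (intro max_power_SucI step)
  then have "(\<lambda>y. F y * g y + f y * (s y * F y)) \<in> max_power X x 2"
    by (intro max_power_add step)
  then show ?case by (simp add: algebra_simps)
qed

section \<open>Dimension modulo a subspace, computed with indexed families\<close>

definition fun_subspace :: "('b \<Rightarrow> 'a::field) set \<Rightarrow> bool" where
  "fun_subspace W \<longleftrightarrow> (\<lambda>_. 0) \<in> W \<and> (\<forall>f\<in>W. \<forall>g\<in>W. (\<lambda>y. f y + g y) \<in> W) \<and>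
     (\<forall>c. \<forall>f\<in>W. (\<lambda>y. c * f y) \<in> W)"

lemma fun_subspace_max_square: "fun_subspace (max_square X x)"
  unfolding fun_subspace_def by (auto intro: max_square_zero max_square_add max_square_scale)

lemma fun_subspace_max_power: "fun_subspace (max_power X x r)"
  unfolding fun_subspace_def by (auto intro: max_power_zero max_power_add max_power_scale)

lemma fun_subspace_scale: "fun_subspace W \<Longrightarrow> f \<in> W \<Longrightarrow> (\<lambda>y. c * f y) \<in> W"
  unfolding fun_subspace_def by simp

lemma fun_subspace_lincomb:
  assumes "fun_subspace W" "\<And>i. i \<in> A \<Longrightarrow> f i \<in> W"
  shows "(\<lambda>y. \<Sum>i\<in>A. c i * f i y) \<in> W"
  using assms(2) by (induction A rule: infinite_finite_induct)
    (use assms(1) in \<open>auto simp: fun_subspace_def\<close>)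

text \<open>If more than \<open>card T\<close> functions are expressed through \<open>T\<close>
  modulo \<open>W\<close>, their coefficient vectors are linearly dependent, and the same dependence
  holds for the functions modulo \<open>W\<close>.\<close>

lemma dim_mod_le:
  assumes W: "fun_subspace W" and T: "finite T"
    and span: "\<And>b. b \<in> S \<Longrightarrow> \<exists>l. (\<lambda>y. b y - (\<Sum>t\<in>T. l t * g t y)) \<in> W"
  shows "dim_mod W S \<le> enat (card T)"
  unfolding dim_mod_def
proof (rule SUP_least)
  fix B assume "B \<in> {B. finite B \<and> B \<subseteq> S \<and> independent_mod W B}"
  then have B: "finite B" "B \<subseteq> S" "independent_mod W B" by auto
  obtain l where l: "\<And>b. b \<in> B \<Longrightarrow> (\<lambda>y. b y - (\<Sum>t\<in>T. l b t * g t y)) \<in> W"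
    using span B(2) by (metis subsetD)
  have "\<not> card T < card B"
  proof
    assume "card T < card B"
    then obtain c where c: "\<And>t. t \<in> T \<Longrightarrow> (\<Sum>b\<in>B. c b * l b t) = 0" "\<exists>b\<in>B. c b \<noteq> 0"
      using ex_nonzero_solution[OF T B(1), of "\<lambda>t b. l b t"] by metis
    have "(\<lambda>y. \<Sum>b\<in>B. c b * (b y - (\<Sum>t\<in>T. l b t * g t y))) \<in> W"
      by (intro fun_subspace_lincomb W l)
    moreover have "(\<Sum>b\<in>B. c b * (b y - (\<Sum>t\<in>T. l b t * g t y))) = (\<Sum>b\<in>B. c b * b y)" for y
    proof -
      have "(\<Sum>b\<in>B. c b * (\<Sum>t\<in>T. l b t * g t y)) = (\<Sum>t\<in>T. (\<Sum>b\<in>B. c b * l b t) * g t y)"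
        unfolding sum_distrib_left sum_distrib_right by (subst sum.swap) (simp add: mult.assoc)
      then show ?thesis using c(1) by (simp add: right_diff_distrib sum_subtractf)
    qed
    ultimately show False using B(3) c(2) unfolding independent_mod_def by auto
  qed
  then show "enat (card B) \<le> enat (card T)" by simp
qed

text \<open>Unlike \<open>independent_mod\<close>, which speaks of sets, this counts a repeated
  member as a dependence; injectivity of \<open>g\<close> on \<open>T\<close> is thus a consequence
  in \<open>dim_mod_ge\<close>.\<close>

definition family_indep :: "('b \<Rightarrow> 'a::field) set \<Rightarrow> 't set \<Rightarrow> ('t \<Rightarrow> 'b \<Rightarrow> 'a) \<Rightarrow> bool" where
  "family_indep W T g \<longleftrightarrow> (\<forall>c. (\<lambda>y. \<Sum>t\<in>T. c t * g t y) \<in> W \<longrightarrow> (\<forall>t\<in>T. c t = 0))"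

lemma dim_mod_ge:
  assumes W: "fun_subspace W" and T: "finite T" and S: "\<And>t. t \<in> T \<Longrightarrow> g t \<in> S"
    and indep: "family_indep W T g"
  shows "enat (card T) \<le> dim_mod W S"
proof -
  have inj: "inj_on g T"
  proof (rule inj_onI, rule ccontr)
    fix s t assume st: "s \<in> T" "t \<in> T" "g s = g t" "s \<noteq> t"
    let ?c = "\<lambda>r. if r = s then 1 else if r = t then -1 else 0"
    have "(\<Sum>r\<in>T. ?c r * g r y) = 0" for y
    proof -
      have "(\<Sum>r\<in>T. ?c r * g r y) = (\<Sum>r\<in>{s, t}. ?c r * g r y)"
        using st T by (intro sum.mono_neutral_right) auto
      then show ?thesis using st by simp
    qed
    then have "(\<lambda>y. \<Sum>r\<in>T. ?c r * g r y) \<in> W" using W by (simp add: fun_subspace_def)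
    then show False using indep st unfolding family_indep_def by fastforce
  qed
  have "independent_mod W (g ` T)"
    unfolding independent_mod_def
  proof (intro allI impI ballI)
    fix c b assume c: "(\<lambda>y. \<Sum>b\<in>g ` T. c b * b y) \<in> W" "b \<in> g ` T"
    then have "(\<lambda>y. \<Sum>t\<in>T. c (g t) * g t y) \<in> W" by (simp add: sum.reindex[OF inj])
    from indep[unfolded family_indep_def, rule_format, OF this] c(2) show "c b = 0" by auto
  qed
  then have "enat (card (g ` T)) \<le> dim_mod W S"
    unfolding dim_mod_def using T S by (intro SUP_upper) auto
  then show ?thesis by (simp add: card_image[OF inj])
qed

text \<open>\<open>J\<close> is a maximal independent subfamily. Adjoining any other
  \<open>t\<close> creates a relation in which \<open>t\<close> has a nonzero coefficient, and
  dividing by it expresses \<open>g t\<close>. Local parameters are selected among the coordinates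
  in this way.\<close>

lemma dim_mod_subfamily:
  assumes W: "fun_subspace W" and T: "finite T" and S: "\<And>t. t \<in> T \<Longrightarrow> g t \<in> S"
    and le: "dim_mod W S \<le> enat n"
  obtains J l where "J \<subseteq> T" "card J \<le> n"
    "\<And>t. t \<in> T \<Longrightarrow> (\<lambda>y. g t y - (\<Sum>j\<in>J. l t j * g j y)) \<in> W"
proof -
  let ?P = "\<lambda>J. J \<subseteq> T \<and> family_indep W J g"
  have "?P {}" by (simp add: family_indep_def)
  moreover have "\<forall>J. ?P J \<longrightarrow> card J < Suc (card T)"
    using T by (auto simp: less_Suc_eq_le intro: card_mono)
  ultimately obtain J where J: "?P J" "\<And>J'. ?P J' \<Longrightarrow> card J' \<le> card J"
    using ex_has_greatest_nat[of ?P "{}" card "Suc (card T)"] by blast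
  have fJ: "finite J" using J(1) T finite_subset by blast
  have "enat (card J) \<le> dim_mod W S" using J(1) S fJ by (intro dim_mod_ge W) auto
  then have n: "card J \<le> n" using le by (metis enat_ord_simps(1) order_trans)
  have "\<exists>l. (\<lambda>y. g t y - (\<Sum>j\<in>J. l j * g j y)) \<in> W" if t: "t \<in> T" for t
  proof (cases "t \<in> J")
    case True
    have "(\<Sum>j\<in>J. (if j = t then 1 else 0) * g j y) = g t y" for y
      using True fJ by (simp add: if_distrib[of "\<lambda>c. c * _"] sum.delta cong: if_cong)
    then show ?thesis
      using W by (intro exI[of _ "\<lambda>j. if j = t then 1 else 0"]) (simp add: fun_subspace_def)
  next
    case False
    have "\<not> family_indep W (insert t J) g"
      using J(2)[of "insert t J"] J(1) t False fJ by auto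
    then obtain c r where c: "(\<lambda>y. \<Sum>j\<in>insert t J. c j * g j y) \<in> W" "r \<in> insert t J" "c r \<noteq> 0"
      unfolding family_indep_def by blast
    have ct: "c t \<noteq> 0"
    proof
      assume "c t = 0"
      then have "(\<lambda>y. \<Sum>j\<in>J. c j * g j y) \<in> W" using c(1) False fJ by simp
      then show False using J(1) c \<open>c t = 0\<close> unfolding family_indep_def by auto
    qed
    have "(\<lambda>y. (1 / c t) * (\<Sum>j\<in>insert t J. c j * g j y)) \<in> W"
      by (rule fun_subspace_scale[OF W c(1)])
    moreover have "(1 / c t) * (\<Sum>j\<in>insert t J. c j * g j y) =
        g t y - (\<Sum>j\<in>J. (- c j / c t) * g j y)" for y
      using False fJ ct by (simp add: field_simps sum_distrib_left sum_negf)
    ultimately show ?thesis by (intro exI[of _ "\<lambda>j. - c j / c t"]) simp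
  qed
  then obtain l where "\<And>t. t \<in> T \<Longrightarrow> (\<lambda>y. g t y - (\<Sum>j\<in>J. l t j * g j y)) \<in> W" by metis
  then show ?thesis using that n J(1) by blast
qed

lemma lin_form_scale: "lin_form (c *s v) y = c * lin_form v y"
  unfolding lin_form_def by (simp add: sum_distrib_left mult.assoc)

lemma lin_form_diff: "lin_form (v - w) y = lin_form v y - lin_form w y"
  unfolding lin_form_def by (simp add: left_diff_distrib sum_subtractf)

section \<open>Jets of linear forms along one-parameter subgroups\<close>

definition torus_pt :: "('m::finite \<Rightarrow> int ^ 'n::finite) \<Rightarrow> 'a::field ^ 'n \<Rightarrow> 'a ^ 'm" where
  "torus_pt a t = (\<chi> i. \<Prod>j\<in>UNIV. t $ j powi (a i $ j))"

definition torus_inv :: "'a::field ^ 'n::finite \<Rightarrow> bool" where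
  "torus_inv t \<longleftrightarrow> (\<forall>j. t $ j \<noteq> 0)"

lemma torus_pt_nz: "torus_inv t \<Longrightarrow> torus_pt a t $ i \<noteq> 0"
  by (simp add: torus_pt_def torus_inv_def)

lemma torus_pt_nonzero: "torus_inv t \<Longrightarrow> torus_pt a t \<noteq> 0"
  using torus_pt_nz[of t a] by (metis zero_index)

lemma toric_variety_eq: "toric_variety a = zariski_proj closure_of {torus_pt a t | t. torus_inv t}"
  unfolding toric_variety_def torus_pt_def torus_inv_def by simp

lemma toric_variety_iff:
  "x \<in> toric_variety a \<longleftrightarrow>
    x \<noteq> 0 \<and> (\<forall>d. \<forall>f\<in>hom_poly_funs d. (\<forall>t. torus_inv t \<longrightarrow> f (torus_pt a t) = 0) \<longrightarrow> f x = 0)"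
  unfolding toric_variety_eq closure_zariski_proj using torus_pt_nonzero by blast

lemma toric_nonzero: "x \<in> toric_variety a \<Longrightarrow> x \<noteq> 0"
  unfolding toric_variety_iff by simp

lemma toric_vanish:
  "x \<in> toric_variety a \<Longrightarrow> f \<in> hom_poly_funs d \<Longrightarrow> (\<And>t. torus_inv t \<Longrightarrow> f (torus_pt a t) = 0) \<Longrightarrow> f x = 0"
  unfolding toric_variety_iff by blast

lemma torus_pt_in: "torus_inv t \<Longrightarrow> torus_pt a t \<in> toric_variety a"
  unfolding toric_variety_iff using torus_pt_nonzero by blast

lemma closedin_toric: "closedin zariski_proj (toric_variety a)"
  unfolding toric_variety_eq by (rule closedin_closure_of)

lemma toric_scale:
  fixes x :: "'a::field ^ 'm::finite"
  assumes "x \<in> toric_variety a" "c \<noteq> 0"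
  shows "c *s x \<in> toric_variety a"
  unfolding toric_variety_iff
proof (intro conjI allI ballI impI)
  show "c *s x \<noteq> 0" using toric_nonzero[OF assms(1)] assms(2) by (simp add: vec_eq_iff)
  fix d and f :: "'a ^ 'm \<Rightarrow> 'a" assume f: "f \<in> hom_poly_funs d" "\<forall>t. torus_inv t \<longrightarrow> f (torus_pt a t) = 0"
  then have "f x = 0" using toric_vanish[OF assms(1) f(1)] by simp
  then show "f (c *s x) = 0" by (simp add: hom_homogeneous[OF f(1)])
qed

text \<open>The weights with which a one-parameter subgroup acts on the homogeneous coordinates:
  \<open>v\<close> is the subgroup, and \<open>M\<close> a common rescaling that does not move the
  projective point.\<close>

definition affine_fun :: "('m \<Rightarrow> int ^ 'n::finite) \<Rightarrow> ('m \<Rightarrow> int) \<Rightarrow> bool" where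
  "affine_fun a l \<longleftrightarrow> (\<exists>M v. \<forall>i. l i = M + (\<Sum>j\<in>UNIV. v j * a i $ j))"

lemma affine_fun_add_mult:
  assumes "affine_fun a l" "affine_fun a l'"
  shows "affine_fun a (\<lambda>i. l i + s * l' i)"
proof -
  obtain M v M' v' where 1: "\<And>i. l i = M + (\<Sum>j\<in>UNIV. v j * a i $ j)"
      "\<And>i. l' i = M' + (\<Sum>j\<in>UNIV. v' j * a i $ j)"
    using assms unfolding affine_fun_def by metis
  show ?thesis unfolding affine_fun_def
    by (intro exI[of _ "M + s * M'"] exI[of _ "\<lambda>j. v j + s * v' j"] allI)
      (simp add: 1 algebra_simps sum.distrib sum_distrib_left)
qed

lemma affine_fun_const: "affine_fun a (\<lambda>_. M)"
  unfolding affine_fun_def by (intro exI[of _ M] exI[of _ "\<lambda>_. 0"]) simp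

lemma affine_fun_coord: "affine_fun a (\<lambda>i. a i $ j)"
  unfolding affine_fun_def
  by (intro exI[of _ 0] exI[of _ "\<lambda>l. if l = j then 1 else 0"]) (simp add: sum_indicator)

lemma power_int_sum: "s \<noteq> 0 \<Longrightarrow> (s::'a::field) powi (\<Sum>j\<in>A. f j) = (\<Prod>j\<in>A. s powi f j)"
  by (induction A rule: infinite_finite_induct) (auto simp: power_int_add)

text \<open>The diagonal map carries the torus orbit into itself up to a common scalar, so composing
  with it preserves the forms that vanish on the orbit.\<close>

lemma toric_action:
  fixes y :: "'a::field ^ 'm::finite"
  assumes "y \<in> toric_variety a" "affine_fun a l" "s \<noteq> 0"
  shows "(\<chi> i. s powi l i * y $ i) \<in> toric_variety a"
  unfolding toric_variety_iff
proof (intro conjI allI ballI impI)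
  show "(\<chi> i. s powi l i * y $ i) \<noteq> 0"
    using toric_nonzero[OF assms(1)] assms(3) by (simp add: vec_eq_iff)
  obtain M v where l: "\<And>i. l i = M + (\<Sum>j\<in>UNIV. v j * a i $ j)"
    using assms(2) unfolding affine_fun_def by metis
  fix d and f :: "'a ^ 'm \<Rightarrow> 'a" assume f: "f \<in> hom_poly_funs d" "\<forall>t. torus_inv t \<longrightarrow> f (torus_pt a t) = 0"
  have "f (\<chi> i. s powi l i * torus_pt a t $ i) = 0" if t: "torus_inv t" for t
  proof -
    define t' where "t' = (\<chi> j. s powi v j * t $ j)"
    have "torus_inv t'" using t assms(3) by (simp add: torus_inv_def t'_def)
    moreover have "(\<chi> i. s powi l i * torus_pt a t $ i) = s powi M *s torus_pt a t'"
      using assms(3)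
      by (simp add: vec_eq_iff l torus_pt_def t'_def power_int_add power_int_sum power_int_mult_distrib
          prod.distrib power_int_mult)
    ultimately show ?thesis using f(2) by (simp add: hom_homogeneous[OF f(1)])
  qed
  then show "f (\<chi> i. s powi l i * y $ i) = 0"
    by (intro toric_vanish[OF assms(1) hom_diag[OF f(1), of "\<lambda>i. s powi l i"]])
qed

text \<open>For nonnegative weights the orbit of \<open>y\<close> under the subgroup is a polynomial
  curve. It passes through \<open>y\<close> at \<open>s = 1\<close>, where all orders of vanishing
  are taken.\<close>

lemma toric_curve:
  assumes "y \<in> toric_variety a" "affine_fun a (\<lambda>i. int (b i))" "s \<noteq> 0"
  shows "(\<chi> i. poly (monom (y $ i) (b i)) s) \<in> toric_variety a"
  using toric_action[OF assms] by (simp add: poly_monom mult.commute)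

lemma stalk_curve:
  assumes "y \<in> toric_variety a" "affine_fun a (\<lambda>i. int (b i))" "f \<in> stalk (toric_variety a) y d"
  obtains P Q where "poly Q 1 \<noteq> 0"
    "\<And>s. s \<noteq> 0 \<Longrightarrow> poly Q s \<noteq> 0 \<Longrightarrow> f (\<chi> i. poly (monom (y $ i) (b i)) s) = poly P s / poly Q s"
proof -
  let ?g = "\<lambda>s. \<chi> i. poly (monom (y $ i) (b i)) s"
  obtain e F G where *: "F \<in> hom_poly_funs (d + e)" "G \<in> hom_poly_funs e" "G y \<noteq> 0"
    "\<And>z. z \<in> toric_variety a \<Longrightarrow> G z \<noteq> 0 \<Longrightarrow> f z = F z / G z" using stalkE[OF assms(3)] by metis
  obtain P where P: "\<And>s. poly P s = F (?g s)"
    using hom_along_curve[OF *(1), of "\<lambda>i. monom (y $ i) (b i)"] by blast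
  obtain Q where Q: "\<And>s. poly Q s = G (?g s)"
    using hom_along_curve[OF *(2), of "\<lambda>i. monom (y $ i) (b i)"] by blast
  have "?g 1 = y" by (simp add: vec_eq_iff poly_monom)
  then show ?thesis
    using that[of Q P] * toric_curve[OF assms(1,2)] by (simp add: P Q)
qed

lemma max_ideal_curve:
  assumes "y \<in> toric_variety a" "affine_fun a (\<lambda>i. int (b i))" "f \<in> max_ideal (toric_variety a) y"
  obtains P Q where "poly Q 1 \<noteq> 0"
    "\<And>s. s \<noteq> 0 \<Longrightarrow> poly Q s \<noteq> 0 \<Longrightarrow>
      f (\<chi> i. poly (monom (y $ i) (b i)) s) = (s - 1) * poly P s / poly Q s"
proof -
  obtain P Q where *: "poly Q 1 \<noteq> 0"
    "\<And>s. s \<noteq> 0 \<Longrightarrow> poly Q s \<noteq> 0 \<Longrightarrow> f (\<chi> i. poly (monom (y $ i) (b i)) s) = poly P s / poly Q s"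
    using stalk_curve[OF assms(1,2) max_ideal_stalk[OF assms(3)]] by blast
  have "f y = 0" using assms(3) by (simp add: max_ideal_def)
  moreover have "(\<chi> i. poly (monom (y $ i) (b i)) 1) = y" by (simp add: vec_eq_iff poly_monom)
  ultimately have "poly P 1 = 0" using *(2)[of 1] *(1) by simp
  then obtain P' where P': "P = [:-1, 1:] * P'" using poly_eq_0_iff_dvd by (metis dvdE)
  have "poly P s = (s - 1) * poly P' s" for s unfolding P' by (simp add: algebra_simps)
  then show ?thesis using that[of Q P'] * by simp
qed

lemma fraction_combine:
  fixes w :: "'a::field"
  assumes "q1 \<noteq> 0" "q2 \<noteq> 0" "q3 \<noteq> 0"
  shows "w ^ Suc r * p3 / q3 + (w * p1 / q1) * (w ^ r * p2 / q2) =
    w ^ Suc r * (p3 * q1 * q2 + p1 * p2 * q3) / (q1 * q2 * q3)"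
  using assms by (simp add: field_simps)

text \<open>Pulled back to the curve, each element of the maximal ideal of \<open>y\<close> acquires
  a factor \<open>s - 1\<close>, so the \<open>r\<close>-th power acquires
  \<open>(s - 1) ^ r\<close>. The value \<open>s = 0\<close> is excluded because there the curve may
  leave the variety.\<close>

lemma max_power_curve:
  assumes "y \<in> toric_variety a" "affine_fun a (\<lambda>i. int (b i))" "f \<in> max_power (toric_variety a) y r"
  shows "\<exists>P Q. poly Q 1 \<noteq> 0 \<and> (\<forall>s. s \<noteq> 0 \<longrightarrow> poly Q s \<noteq> 0 \<longrightarrow>
      f (\<chi> i. poly (monom (y $ i) (b i)) s) = (s - 1) ^ r * poly P s / poly Q s)"
  using assms(3)
proof (induction r arbitrary: f)
  case 0
  then have "f \<in> stalk (toric_variety a) y 1" by (simp add: max_power_0)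
  from stalk_curve[OF assms(1,2) this] obtain P Q where "poly Q 1 \<noteq> 0"
    "\<And>s. s \<noteq> 0 \<Longrightarrow> poly Q s \<noteq> 0 \<Longrightarrow> f (\<chi> i. poly (monom (y $ i) (b i)) s) = poly P s / poly Q s"
    by blast
  then show ?case by (intro exI[of _ P] exI[of _ Q]) simp
next
  case (Suc r)
  show ?case using Suc.prems unfolding max_power_Suc
  proof (induction rule: ideal_mult_induct)
    case zero
    then show ?case by (intro exI[of _ 0] exI[of _ 1]) simp
  next
    case (step f s g)
    obtain P1 Q1 where 1: "poly Q1 1 \<noteq> 0"
      "\<And>s. s \<noteq> 0 \<Longrightarrow> poly Q1 s \<noteq> 0 \<Longrightarrow>
        f (\<chi> i. poly (monom (y $ i) (b i)) s) = (s - 1) * poly P1 s / poly Q1 s"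
      using max_ideal_curve[OF assms(1,2) step(1)] by blast
    obtain P2 Q2 where 2: "poly Q2 1 \<noteq> 0"
      "\<And>z. z \<noteq> 0 \<Longrightarrow> poly Q2 z \<noteq> 0 \<Longrightarrow>
        s (\<chi> i. poly (monom (y $ i) (b i)) z) = (z - 1) ^ r * poly P2 z / poly Q2 z"
      using Suc.IH[OF step(2)] by blast
    obtain P3 Q3 where 3: "poly Q3 1 \<noteq> 0"
      "\<And>z. z \<noteq> 0 \<Longrightarrow> poly Q3 z \<noteq> 0 \<Longrightarrow>
        g (\<chi> i. poly (monom (y $ i) (b i)) z) = (z - 1) ^ Suc r * poly P3 z / poly Q3 z"
      using step(4) by blast
    show ?case
    proof (intro exI conjI allI impI)
      show "poly (Q1 * Q2 * Q3) 1 \<noteq> 0" using 1 2 3 by simp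
      fix z assume "z \<noteq> 0" "poly (Q1 * Q2 * Q3) z \<noteq> 0"
      then show "g (\<chi> i. poly (monom (y $ i) (b i)) z) +
          f (\<chi> i. poly (monom (y $ i) (b i)) z) * s (\<chi> i. poly (monom (y $ i) (b i)) z) =
        (z - 1) ^ Suc r * poly (P3 * Q1 * Q2 + P1 * P2 * Q3) z / poly (Q1 * Q2 * Q3) z"
        using 1(2)[of z] 2(2)[of z] 3(2)[of z] fraction_combine[of "poly Q1 z" "poly Q2 z" "poly Q3 z"]
        by simp
    qed
  qed
qed

section \<open>Order of vanishing at 1 and power moments\<close>

lemma linear_power_dvd_cancel:
  fixes p Q :: "'a::field poly"
  assumes "[:-c, 1:] ^ n dvd p * Q" "poly Q c \<noteq> 0"
  shows "[:-c, 1:] ^ n dvd p"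
proof (cases "p = 0")
  case False
  moreover have "Q \<noteq> 0" using assms(2) by auto
  moreover have "order c Q = 0" using assms(2) by (simp add: order_root)
  ultimately show ?thesis using assms(1) by (simp add: order_divides order_mult)
qed simp

lemma linear_power_dvd_pderiv:
  assumes "[:-c, 1:] ^ Suc n dvd p"
  shows "[:-c, 1:] ^ n dvd pderiv p"
proof -
  obtain q where "p = [:-c, 1:] ^ Suc n * q" using assms by (auto elim: dvdE)
  then have "pderiv p = [:-c, 1:] ^ n * ([:-c, 1:] * pderiv q + smult (of_nat (Suc n)) q)"
    by (simp only: pderiv_mult pderiv_power_Suc) (simp add: algebra_simps pderiv_pCons)
  then show ?thesis by simp
qed

lemma pderiv_sum: "pderiv (\<Sum>i\<in>A. f i) = (\<Sum>i\<in>A. pderiv (f i))"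
  by (induction A rule: infinite_finite_induct) (simp_all add: pderiv_add)

text \<open>The operator \<open>s d/ds\<close> multiplies \<open>\<gamma> i\<close> by
  \<open>b i\<close> and lowers the order of vanishing at 1 by at most one. Applied \<open>q\<close>
  times and evaluated at 1, it gives the \<open>q\<close>-th moment.\<close>

lemma vanishing_moments:
  fixes \<gamma> :: "'i \<Rightarrow> 'a::field_char_0"
  assumes "[:-1, 1:] ^ Suc k dvd (\<Sum>i\<in>A. monom (\<gamma> i) (b i))" "q \<le> k"
  shows "(\<Sum>i\<in>A. \<gamma> i * of_nat (b i) ^ q) = 0"
  using assms
proof (induction q arbitrary: \<gamma> k)
  case 0
  have "[:-1, 1:] dvd (\<Sum>i\<in>A. monom (\<gamma> i) (b i))"
    by (rule dvd_trans[OF _ 0(1)]) (simp only: power_Suc dvd_triv_left)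
  then have "poly (\<Sum>i\<in>A. monom (\<gamma> i) (b i)) 1 = 0" using poly_eq_0_iff_dvd by blast
  then show ?case by (simp add: poly_sum poly_monom)
next
  case (Suc q)
  then obtain k' where k': "k = Suc k'" by (cases k) auto
  have "[:-1, 1:] ^ Suc k' dvd pCons 0 (pderiv (\<Sum>i\<in>A. monom (\<gamma> i) (b i)))"
    using dvd_mult[OF linear_power_dvd_pderiv[OF Suc.prems(1)], of "[:0, 1:]"] k' by simp
  also have "pCons 0 (pderiv (\<Sum>i\<in>A. monom (\<gamma> i) (b i))) = (\<Sum>i\<in>A. monom (\<gamma> i * of_nat (b i)) (b i))"
  proof (rule poly_eqI)
    fix n show "coeff (pCons 0 (pderiv (\<Sum>i\<in>A. monom (\<gamma> i) (b i)))) n =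
        coeff (\<Sum>i\<in>A. monom (\<gamma> i * of_nat (b i)) (b i)) n"
      by (cases n) (auto simp: coeff_pderiv coeff_sum sum_distrib_left intro!: sum.cong sum.neutral)
  qed
  finally have "(\<Sum>i\<in>A. (\<gamma> i * of_nat (b i)) * of_nat (b i) ^ q) = 0"
    using Suc.IH Suc.prems(2) k' by simp
  then show ?case by (simp add: mult.assoc)
qed

lemma jet_moment_nat:
  fixes y :: "'a::field_char_0 ^ 'm::finite"
  assumes y: "y \<in> toric_variety a" and b: "affine_fun a (\<lambda>i. int (b i))"
    and c: "lin_form c \<in> max_power (toric_variety a) y (Suc k)" and q: "q \<le> k"
  shows "(\<Sum>i\<in>UNIV. c $ i * y $ i * of_nat (b i) ^ q) = 0"
proof -
  obtain P Q where PQ: "poly Q 1 \<noteq> 0" "\<And>s. s \<noteq> 0 \<Longrightarrow> poly Q s \<noteq> 0 \<Longrightarrow>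
      lin_form c (\<chi> i. poly (monom (y $ i) (b i)) s) = (s - 1) ^ Suc k * poly P s / poly Q s"
    using max_power_curve[OF y b c] by blast
  let ?p = "\<Sum>i\<in>UNIV. monom (c $ i * y $ i) (b i)"
  have p: "lin_form c (\<chi> i. poly (monom (y $ i) (b i)) s) = poly ?p s" for s
    by (simp add: lin_form_def poly_sum poly_monom mult.assoc)
  \<comment> \<open>The equation is known only where \<open>s\<close> and \<open>Q\<close> are
    nonzero. The factor \<open>[:0, 1:] * Q\<close> makes it hold for every \<open>s\<close>, hence
    as an identity of polynomials over an infinite field.\<close>
  have "poly ([:0, 1:] * Q * (?p * Q - [:-1, 1:] ^ Suc k * P)) s = 0" for s
  proof (cases "s = 0 \<or> poly Q s = 0")
    case False
    then have "poly ?p s * poly Q s = (s - 1) ^ Suc k * poly P s" using PQ(2)[of s] p[of s] by simp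
    then have "poly (?p * Q - [:-1, 1:] ^ Suc k * P) s = 0"
      by (simp add: poly_power del: power_Suc)
    then show ?thesis by (simp only: poly_mult mult_zero_right)
  qed auto
  then have "[:0, 1:] * Q * (?p * Q - [:-1, 1:] ^ Suc k * P) = 0"
    using poly_all_0_iff_0 by blast
  moreover have "Q \<noteq> 0" using PQ(1) by auto
  ultimately have "?p * Q = [:-1, 1:] ^ Suc k * P" by auto
  then have "[:-1, 1:] ^ Suc k dvd ?p * Q" by simp
  then have "[:-1, 1:] ^ Suc k dvd ?p" using linear_power_dvd_cancel[of 1] PQ(1) by blast
  from vanishing_moments[OF this q] show ?thesis .
qed

lemma jet_moment:
  fixes y :: "'a::field_char_0 ^ 'm::finite"
  assumes y: "y \<in> toric_variety a" and l: "affine_fun a l"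
    and c: "lin_form c \<in> max_power (toric_variety a) y (Suc k)" and q: "q \<le> k"
  shows "(\<Sum>i\<in>UNIV. c $ i * y $ i * of_int (l i) ^ q) = 0"
proof -
  \<comment> \<open>A shift by \<open>M\<close> makes all weights nonnegative; the binomial theorem
    undoes it at the end.\<close>
  define M where "M = nat (\<Sum>i\<in>UNIV. \<bar>l i\<bar>)"
  have "\<bar>l i\<bar> \<le> int M" for i
    unfolding M_def using member_le_sum[of i UNIV "\<lambda>i. \<bar>l i\<bar>"] by auto
  then have nn: "0 \<le> l i + int M" for i by (smt (verit))
  define b where "b i = nat (l i + int M)" for i
  have b: "int (b i) = l i + 1 * int M" for i using nn by (simp add: b_def)
  have "affine_fun a (\<lambda>i. int (b i))"
    unfolding b using affine_fun_add_mult[OF l affine_fun_const, of 1 "int M"] by simp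
  note mom = jet_moment_nat[OF y this c]
  have li: "(of_int (l i) :: 'a) = of_nat (b i) + - of_nat M" for i
  proof -
    have "of_int (int (b i)) = (of_int (l i + 1 * int M) :: 'a)" by (simp only: b)
    then show ?thesis by simp
  qed
  have "(\<Sum>i\<in>UNIV. c $ i * y $ i * of_int (l i) ^ q) =
     (\<Sum>j\<le>q. of_nat (q choose j) * (- of_nat M) ^ (q - j) * (\<Sum>i\<in>UNIV. c $ i * y $ i * of_nat (b i) ^ j))"
    unfolding li binomial_ring sum_distrib_left by (subst sum.swap) (simp add: ac_simps)
  also have "\<dots> = 0" using mom q by simp
  finally show ?thesis .
qed

text \<open>Polarization: products of affine functions are obtained from powers by differentiating
  \<open>(l + s l')\<^sup>q\<^sup>+\<^sup>1\<close> at \<open>s = 0\<close>.\<close>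

lemma jet_moment_prod:
  fixes y :: "'a::field_char_0 ^ 'm::finite"
  assumes y: "y \<in> toric_variety a" and c: "lin_form c \<in> max_power (toric_variety a) y (Suc k)"
    and "\<And>l'. l' \<in> set ls \<Longrightarrow> affine_fun a l'" "affine_fun a l" "length ls + q \<le> k"
  shows "(\<Sum>i\<in>UNIV. c $ i * y $ i * (\<Prod>l'\<leftarrow>ls. of_int (l' i)) * of_int (l i) ^ q) = 0"
  using assms(3-)
proof (induction ls arbitrary: l q)
  case Nil
  then show ?case using jet_moment[OF y _ c] by simp
next
  case (Cons l' ls)
  let ?g = "\<lambda>i. c $ i * y $ i * (\<Prod>l'\<leftarrow>ls. of_int (l' i))"
  let ?p = "\<Sum>i\<in>UNIV. smult (?g i) ([:of_int (l i), of_int (l' i):] ^ Suc q)"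
  \<comment> \<open>For a natural number \<open>s\<close> the weight \<open>l + s l'\<close> is
    again affine with integer coefficients, so the induction hypothesis applies; in characteristic
    zero this gives infinitely many roots.\<close>
  have "poly ?p (of_nat s) = 0" for s
  proof -
    have "affine_fun a (\<lambda>i. l i + int s * l' i)"
      using Cons.prems by (intro affine_fun_add_mult) auto
    then have "(\<Sum>i\<in>UNIV. ?g i * of_int (l i + int s * l' i) ^ Suc q) = 0"
      using Cons.prems by (intro Cons.IH) auto
    then show ?thesis by (simp add: poly_sum del: power_Suc)
  qed
  then have "range of_nat \<subseteq> {s. poly ?p s = 0}" by blast
  then have "infinite {s. poly ?p s = 0}"
    by (rule infinite_super) (rule range_inj_infinite[OF inj_of_nat])
  then have "?p = 0" using poly_roots_finite by blast
  then have "poly (pderiv ?p) 0 = 0" by simp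
  moreover have "poly (pderiv ?p) 0 = of_nat (Suc q) * (\<Sum>i\<in>UNIV. ?g i * of_int (l' i) * of_int (l i) ^ q)"
    by (simp only: pderiv_sum pderiv_smult pderiv_power_Suc poly_sum sum_distrib_left)
      (simp add: pderiv_pCons ac_simps)
  ultimately have "(\<Sum>i\<in>UNIV. ?g i * of_int (l' i) * of_int (l i) ^ q) = 0"
    by (simp only: mult_eq_0_iff of_nat_eq_0_iff) simp
  then show ?case by (simp add: ac_simps)
qed

lemma jet_kernel_moments:
  fixes y :: "'a::field_char_0 ^ 'm::finite"
  assumes y: "y \<in> toric_variety a" and c: "c \<in> jet_kernel k (toric_variety a) y" and M: "size M \<le> k"
  shows "(\<Sum>i\<in>UNIV. c $ i * y $ i * (\<Prod>j\<in>#M. of_int (a i $ j))) = 0"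
proof -
  obtain js where js: "mset js = M" using ex_mset by blast
  \<comment> \<open>All factors are placed in the list; the zero weight with exponent 0 contributes
    \<open>0 ^ 0 = 1\<close>.\<close>
  have "(\<Sum>i\<in>UNIV. c $ i * y $ i * (\<Prod>l'\<leftarrow>map (\<lambda>j i. a i $ j) js. of_int (l' i)) * of_int 0 ^ 0) = 0"
    by (rule jet_moment_prod[OF y, of c k])
      (use c M js in \<open>auto simp: jet_kernel_def affine_fun_coord affine_fun_const\<close>)
  then show ?thesis
    unfolding js[symmetric] by (simp add: prod_mset_prod_list flip: mset_map) (simp add: o_def)
qed

section \<open>Cotangent spaces on the torus\<close>

lemma max_square_ideal: "f \<in> max_square X x \<Longrightarrow> f \<in> max_ideal X x"
  unfolding max_square_def
  by (induction rule: ideal_mult_induct)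
    (auto intro!: max_ideal_zero max_ideal_add max_ideal_mult max_ideal_stalk)

definition coord_diff :: "'m \<Rightarrow> 'a::field ^ 'm::finite \<Rightarrow> 'm \<Rightarrow> 'a ^ 'm \<Rightarrow> 'a" where
  "coord_diff b x i z = z $ i / z $ b - x $ i / x $ b"

lemma stalk_coord: "x $ b \<noteq> 0 \<Longrightarrow> (\<lambda>z. z $ i / z $ b) \<in> stalk X x 0"
  by (rule stalk_quotient[OF hom_nth hom_nth])

lemma coord_diff_max_ideal: "x $ b \<noteq> 0 \<Longrightarrow> coord_diff b x i \<in> max_ideal X x"
  using max_ideal_minus_value[OF stalk_coord[of x b i X]] unfolding coord_diff_def by simp

text \<open>A first-order Taylor formula in the affine coordinates \<open>z $ i / z $ b\<close>. For
  a product, the remainder consists of the scaled remainders of the factors and of the product of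
  the two increments, which lies in the square of the maximal ideal.\<close>

lemma stalk_pol_linear:
  fixes x :: "'a::field ^ 'm::finite"
  assumes "pol f" and xb: "x $ b \<noteq> 0"
  shows "(\<lambda>z. f ((1 / z $ b) *s z)) \<in> stalk X x 0 \<and>
    (\<exists>c. (\<lambda>z. f ((1 / z $ b) *s z) - f ((1 / x $ b) *s x) - (\<Sum>i\<in>UNIV. c i * coord_diff b x i z))
      \<in> max_square X x)"
  using assms(1)
proof (induction rule: pol_induct)
  case (const c)
  then show ?case by (auto intro!: stalk_const exI[of _ "\<lambda>_. 0"] max_square_zero)
next
  case (nth j)
  have "(\<Sum>i\<in>UNIV. (if i = j then 1 else 0) * coord_diff b x i z) = z $ j / z $ b - x $ j / x $ b" for z
    by (simp only: sum_indicator coord_diff_def)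
  then show ?case using stalk_coord[OF xb, of j X]
    by (intro conjI exI[of _ "\<lambda>i. if i = j then 1 else 0"]) (auto simp: max_square_zero)
next
  case (add f g)
  obtain c c' where c: "(\<lambda>z. f ((1 / z $ b) *s z) - f ((1 / x $ b) *s x) -
        (\<Sum>i\<in>UNIV. c i * coord_diff b x i z)) \<in> max_square X x"
      "(\<lambda>z. g ((1 / z $ b) *s z) - g ((1 / x $ b) *s x) -
        (\<Sum>i\<in>UNIV. c' i * coord_diff b x i z)) \<in> max_square X x"
    using add.IH by blast
  show ?case
  proof (intro conjI exI[of _ "\<lambda>i. c i + c' i"])
    show "(\<lambda>z. f ((1 / z $ b) *s z) + g ((1 / z $ b) *s z)) \<in> stalk X x 0"
      using add.IH by (intro stalk_add) auto
    show "(\<lambda>z. f ((1 / z $ b) *s z) + g ((1 / z $ b) *s z) -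
        (f ((1 / x $ b) *s x) + g ((1 / x $ b) *s x)) -
        (\<Sum>i\<in>UNIV. (c i + c' i) * coord_diff b x i z)) \<in> max_square X x"
      using max_square_add[OF c] by (simp add: algebra_simps sum.distrib)
  qed
next
  case (mult f g)
  let ?f = "\<lambda>z. f ((1 / z $ b) *s z)" and ?g = "\<lambda>z. g ((1 / z $ b) *s z)"
  let ?e = "coord_diff b x"
  obtain c c' where c: "(\<lambda>z. ?f z - ?f x - (\<Sum>i\<in>UNIV. c i * ?e i z)) \<in> max_square X x"
      "(\<lambda>z. ?g z - ?g x - (\<Sum>i\<in>UNIV. c' i * ?e i z)) \<in> max_square X x"
    using mult.IH by blast
  have st: "?f \<in> stalk X x 0" "?g \<in> stalk X x 0" using mult.IH by auto
  have "(\<lambda>z. (?g x * (?f z - ?f x - (\<Sum>i\<in>UNIV. c i * ?e i z)) +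
      ?f x * (?g z - ?g x - (\<Sum>i\<in>UNIV. c' i * ?e i z))) + (?f z - ?f x) * (?g z - ?g x)) \<in> max_square X x"
    by (intro max_square_add max_square_scale c max_squareI max_ideal_minus_value st)
  moreover have "(?g x * (?f z - ?f x - (\<Sum>i\<in>UNIV. c i * ?e i z)) +
      ?f x * (?g z - ?g x - (\<Sum>i\<in>UNIV. c' i * ?e i z))) + (?f z - ?f x) * (?g z - ?g x) =
      ?f z * ?g z - ?f x * ?g x - (\<Sum>i\<in>UNIV. (?g x * c i + ?f x * c' i) * ?e i z)" for z
    by (simp add: algebra_simps sum.distrib sum_distrib_left)
  ultimately show ?case
    using stalk_mult0[OF st] by (intro conjI exI[of _ "\<lambda>i. ?g x * c i + ?f x * c' i"]) simp_all
qed

lemma max_ideal_linear: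
  fixes x :: "'a::field ^ 'm::finite"
  assumes s: "s \<in> max_ideal X x" and x: "x \<in> X" and xb: "x $ b \<noteq> 0"
  shows "\<exists>c. (\<lambda>z. s z - (\<Sum>i\<in>UNIV. c i * coord_diff b x i z)) \<in> max_square X x"
proof -
  obtain e F G where *: "F \<in> hom_poly_funs (0 + e)" "G \<in> hom_poly_funs e" "G x \<noteq> 0"
    "\<And>z. z \<in> X \<Longrightarrow> G z \<noteq> 0 \<Longrightarrow> s z = F z / G z" using stalkE[OF max_ideal_stalk[OF s]] by metis
  \<comment> \<open>Near \<open>x\<close> the function \<open>s = F / G\<close> equals
    \<open>?h * ?f\<close>. Since \<open>?f\<close> vanishes at \<open>x\<close>, only the value of
    \<open>?h\<close> at \<open>x\<close> matters modulo the square.\<close>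
  let ?f = "\<lambda>z. F ((1 / z $ b) *s z)" and ?h = "\<lambda>z. z $ b ^ e / G z"
  have F: "?f z = F z / z $ b ^ e" for z
    using hom_homogeneous[OF *(1), of "1 / z $ b" z] by (simp add: power_one_over)
  have "s x = 0" using s by (simp add: max_ideal_def)
  then have "F x = 0" using *(3,4) x by auto
  then have Fx: "?f x = 0" by (simp add: F)
  obtain c where c: "(\<lambda>z. ?f z - ?f x - (\<Sum>i\<in>UNIV. c i * coord_diff b x i z)) \<in> max_square X x"
    and fst: "?f \<in> stalk X x 0"
    using stalk_pol_linear[OF hom_imp_pol[OF *(1)] xb, of X] by blast
  have h: "?h \<in> stalk X x 0"
    using stalk_quotient[where F = "\<lambda>z. z $ b ^ e", OF _ *(2,3)] hom_power[OF hom_nth[of b], of e] by simp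
  have "(\<lambda>z. ?h x * (?f z - ?f x - (\<Sum>i\<in>UNIV. c i * coord_diff b x i z)) + (?h z - ?h x) * (?f z - ?f x))
      \<in> max_square X x"
    by (intro max_square_add max_square_scale c max_squareI max_ideal_minus_value fst h)
  moreover have "?h x * (?f z - ?f x - (\<Sum>i\<in>UNIV. c i * coord_diff b x i z)) + (?h z - ?h x) * (?f z - ?f x)
      = ?h z * ?f z - (\<Sum>i\<in>UNIV. (?h x * c i) * coord_diff b x i z)" for z
    unfolding Fx by (simp add: algebra_simps sum_distrib_left)
  ultimately have 1: "(\<lambda>z. ?h z * ?f z - (\<Sum>i\<in>UNIV. (?h x * c i) * coord_diff b x i z)) \<in> max_square X x"
    by simp
  have hom: "(\<lambda>z. z $ b * G z) \<in> hom_poly_funs (1 + e)" by (intro hom_mult hom_nth *)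
  have "(\<lambda>z. s z - (\<Sum>i\<in>UNIV. (?h x * c i) * coord_diff b x i z)) \<in> max_square X x"
    by (rule max_square_germ[OF 1 x hom]) (use * xb in \<open>auto simp: F\<close>)
  then show ?thesis by (intro exI[of _ "\<lambda>i. ?h x * c i"])
qed

text \<open>To first order \<open>(1 + f) ^ p\<close> is \<open>1 + p f\<close>, so a monomial in
  functions of value 1 becomes a sum: multiplicative relations turn into linear ones.\<close>

lemma prod_one_plus_linear:
  assumes "finite A" "\<And>i. i \<in> A \<Longrightarrow> f i \<in> max_ideal X x"
  shows "(\<lambda>z. (\<Prod>i\<in>A. (1 + f i z) ^ p i) - 1 - (\<Sum>i\<in>A. of_nat (p i) * f i z)) \<in> max_square X x"
proof -
  have step: "(\<lambda>z. g z * h z - 1 - (l z + m z)) \<in> max_square X x"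
    if g: "(\<lambda>z. g z - 1 - l z) \<in> max_square X x" and h: "(\<lambda>z. h z - 1 - m z) \<in> max_square X x"
      and l: "l \<in> max_ideal X x" and m: "m \<in> max_ideal X x" for g h l m
  proof -
    have st: "(\<lambda>z. 1 + m z + (h z - 1 - m z)) \<in> stalk X x 0" "(\<lambda>z. 1 + l z) \<in> stalk X x 0"
      by (intro stalk_add stalk_const max_ideal_stalk[OF l] max_ideal_stalk[OF m]
          max_ideal_stalk[OF max_square_ideal[OF h]])+
    have "(\<lambda>z. l z * m z + ((1 + m z + (h z - 1 - m z)) * (g z - 1 - l z) + (1 + l z) * (h z - 1 - m z)))
        \<in> max_square X x"
      by (intro max_square_add max_squareI l m max_square_mult st g h)
    then show ?thesis by (simp add: algebra_simps)
  qed
  have pw: "(\<lambda>z. (1 + l z) ^ n - 1 - of_nat n * l z) \<in> max_square X x" if l: "l \<in> max_ideal X x" for l n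
  proof (induction n)
    case 0
    then show ?case by (simp add: max_square_zero)
  next
    case (Suc n)
    have "(\<lambda>z. (1 + l z) - 1 - l z) \<in> max_square X x" by (simp add: max_square_zero)
    from step[OF this Suc l max_ideal_scale[OF l]] show ?case by (simp add: algebra_simps)
  qed
  show ?thesis using assms
  proof (induction A rule: finite_induct)
    case empty
    then show ?case by (simp add: max_square_zero)
  next
    case (insert i A)
    have "(\<lambda>z. (1 + f i z) ^ p i * (\<Prod>i\<in>A. (1 + f i z) ^ p i) - 1 -
        (of_nat (p i) * f i z + (\<Sum>i\<in>A. of_nat (p i) * f i z))) \<in> max_square X x"
      using insert by (intro step pw max_ideal_scale max_ideal_sum) auto
    then show ?case using insert by simp
  qed
qed

lemma torus_pt_monomial:
  assumes "torus_inv t"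
  shows "(\<Prod>i\<in>UNIV. torus_pt a t $ i ^ p i) = (\<Prod>j\<in>UNIV. t $ j powi (\<Sum>i\<in>UNIV. int (p i) * a i $ j))"
proof -
  have "(\<Prod>i\<in>UNIV. torus_pt a t $ i ^ p i) = (\<Prod>i\<in>UNIV. \<Prod>j\<in>UNIV. t $ j powi (int (p i) * a i $ j))"
  proof (intro prod.cong refl)
    fix i
    have "(t $ j powi (a i $ j)) ^ p i = t $ j powi (int (p i) * a i $ j)" for j
      using power_int_mult[of "t $ j" "a i $ j" "int (p i)"] by (simp add: mult.commute)
    then show "torus_pt a t $ i ^ p i = (\<Prod>j\<in>UNIV. t $ j powi (int (p i) * a i $ j))"
      by (simp add: torus_pt_def prod_power_distrib)
  qed
  also have "\<dots> = (\<Prod>j\<in>UNIV. \<Prod>i\<in>UNIV. t $ j powi (int (p i) * a i $ j))"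
    by (rule prod.swap)
  also have "\<dots> = (\<Prod>j\<in>UNIV. t $ j powi (\<Sum>i\<in>UNIV. int (p i) * a i $ j))"
    using assms by (simp add: power_int_sum torus_inv_def)
  finally show ?thesis .
qed

text \<open>Both monomials restrict to the same character of the torus and have the same degree, so
  their difference is a form vanishing on the orbit.\<close>

lemma toric_binomial:
  fixes z :: "'a::field ^ 'm::finite"
  assumes z: "z \<in> toric_variety a" and deg: "(\<Sum>i\<in>UNIV. p i) = (\<Sum>i\<in>UNIV. q i :: nat)"
    and rel: "\<And>j. (\<Sum>i\<in>UNIV. int (p i) * a i $ j) = (\<Sum>i\<in>UNIV. int (q i) * a i $ j)"
  shows "(\<Prod>i\<in>UNIV. z $ i ^ p i) = (\<Prod>i\<in>UNIV. z $ i ^ q i)"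
proof -
  have "(\<lambda>z. (\<Prod>i\<in>UNIV. z $ i ^ p i) - (\<Prod>i\<in>UNIV. z $ i ^ q i)) \<in> hom_poly_funs (\<Sum>i\<in>UNIV. p i)"
    by (intro hom_diff hom_monom) (simp_all add: deg)
  from toric_vanish[OF z this] have "(\<Prod>i\<in>UNIV. z $ i ^ p i) - (\<Prod>i\<in>UNIV. z $ i ^ q i) = 0"
    by (simp add: torus_pt_monomial rel)
  then show ?thesis by simp
qed

text \<open>The Laurent monomial with exponent vector \<open>u j\<close> in the homogeneous coordinates restricts to
  \<open>t\<^sub>j\<^bsup>\<delta>\<^esup>\<close> on the torus; up to isogeny it replaces the \<open>j\<close>-th torus coordinate.\<close>

locale toric_relations =
  fixes a :: "'m::finite \<Rightarrow> int ^ 'n::finite" and u :: "'n \<Rightarrow> 'm \<Rightarrow> int" and \<delta> :: nat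
    and X :: "('a::field_char_0 ^ 'm) set"
  defines X_def: "X \<equiv> toric_variety a"
  assumes \<delta>: "\<delta> > 0"
    and u_sum: "\<And>j. (\<Sum>l\<in>UNIV. u j l) = 0"
    and u_dual: "\<And>j j'. (\<Sum>l\<in>UNIV. u j l * a l $ j') = (if j = j' then int \<delta> else 0)"
begin

text \<open>For nonzero coordinates of \<open>y\<close> this is
  \<open>(z $ i / z $ b) / (y $ i / y $ b) - 1\<close>, to first order the logarithm of the affine
  coordinate normalized at \<open>y\<close>.\<close>

definition log_coord :: "'m \<Rightarrow> 'a ^ 'm \<Rightarrow> 'm \<Rightarrow> 'a ^ 'm \<Rightarrow> 'a" where
  "log_coord b y i z = y $ b / y $ i * coord_diff b y i z"

lemma log_coord_max_ideal: "y $ b \<noteq> 0 \<Longrightarrow> log_coord b y i \<in> max_ideal X y"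
  unfolding log_coord_def by (intro max_ideal_scale coord_diff_max_ideal)

text \<open>The relation \<open>r\<close> among the vectors \<open>(1, a i)\<close> splits into its
  positive part \<open>p\<close> and its negative part \<open>q\<close>. The binomial equation they
  define, divided by its value at \<open>y\<close>, equates two products of powers of
  \<open>1 + log_coord\<close>; its first-order part is the sum in question.\<close>

lemma log_coord_relation:
  assumes y: "y \<in> X" and nz: "\<And>i. y $ i \<noteq> 0"
    and r: "(\<Sum>i\<in>UNIV. r i) = 0" "\<And>j. (\<Sum>i\<in>UNIV. r i * a i $ j) = 0"
  shows "(\<lambda>z. \<Sum>i\<in>UNIV. of_int (r i) * log_coord b y i z) \<in> max_square X y"
proof -
  let ?f = "log_coord b y"
  define p q where "p i = nat (r i)" and "q i = nat (- r i)" for i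
  have pq: "r i = int (p i) - int (q i)" for i unfolding p_def q_def by simp
  have deg: "(\<Sum>i\<in>UNIV. p i) = (\<Sum>i\<in>UNIV. q i)"
  proof -
    have "int (\<Sum>i\<in>UNIV. p i) = int (\<Sum>i\<in>UNIV. q i)"
      using r(1) unfolding pq by (simp add: sum_subtractf)
    then show ?thesis by (simp only: of_nat_eq_iff)
  qed
  have rel: "(\<Sum>i\<in>UNIV. int (p i) * a i $ j) = (\<Sum>i\<in>UNIV. int (q i) * a i $ j)" for j
    using r(2)[of j] unfolding pq by (simp add: left_diff_distrib sum_subtractf)
  have prod_eq: "(\<Prod>i\<in>UNIV. (1 + ?f i z) ^ p i) = (\<Prod>i\<in>UNIV. (1 + ?f i z) ^ q i)"
    if z: "z \<in> X" "z $ b \<noteq> 0" for z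
  proof -
    have *: "(\<Prod>i\<in>UNIV. (1 + ?f i z) ^ p i) =
        (\<Prod>i\<in>UNIV. z $ i ^ p i) / (\<Prod>i\<in>UNIV. y $ i ^ p i) * (y $ b / z $ b) ^ (\<Sum>i\<in>UNIV. p i)" for p
    proof -
      have "1 + ?f i z = z $ i / y $ i * (y $ b / z $ b)" for i
        using nz[of i] nz[of b] z by (simp add: log_coord_def coord_diff_def field_simps)
      then show ?thesis
        by (simp add: power_mult_distrib power_divide prod.distrib prod_dividef power_sum)
    qed
    show ?thesis unfolding *
      using toric_binomial[OF z(1)[unfolded X_def] deg rel] toric_binomial[OF y[unfolded X_def] deg rel]
      by (simp add: deg)
  qed
  have m: "?f i \<in> max_ideal X y" for i using nz by (rule log_coord_max_ideal)
  have "(\<lambda>z. ((\<Prod>i\<in>UNIV. (1 + ?f i z) ^ q i) - 1 - (\<Sum>i\<in>UNIV. of_nat (q i) * ?f i z)) -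
      ((\<Prod>i\<in>UNIV. (1 + ?f i z) ^ p i) - 1 - (\<Sum>i\<in>UNIV. of_nat (p i) * ?f i z))) \<in> max_square X y"
    using m by (intro max_square_diff prod_one_plus_linear) auto
  then show ?thesis
    by (rule max_square_germ[OF _ y hom_nth[of b] nz])
      (use prod_eq in \<open>simp add: pq left_diff_distrib sum_subtractf\<close>)
qed

text \<open>The logarithmic differential at \<open>y\<close> of the Laurent monomial with exponent
  vector \<open>u j\<close>.\<close>

definition cotangent :: "'m \<Rightarrow> 'a ^ 'm \<Rightarrow> 'n \<Rightarrow> 'a ^ 'm \<Rightarrow> 'a" where
  "cotangent b y j z = (\<Sum>l\<in>UNIV. of_int (u j l) * log_coord b y l z)"

lemma cotangent_max_ideal: "y $ b \<noteq> 0 \<Longrightarrow> cotangent b y j \<in> max_ideal X y"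
  using max_ideal_sum[of UNIV "\<lambda>l z. of_int (u j l) * log_coord b y l z" X y]
  unfolding cotangent_def by (simp add: max_ideal_scale log_coord_max_ideal)

lemma sum_delta_diff:
  fixes f :: "'m \<Rightarrow> 'c::comm_ring_1"
  shows "(\<Sum>l\<in>UNIV. ((if l = i then d else 0) - (if l = b then d else 0)) * f l) = d * f i - d * f b"
proof -
  have "(\<Sum>l\<in>UNIV. ((if l = i then d else 0) - (if l = b then d else 0)) * f l) =
      (\<Sum>l\<in>UNIV. (if l = i then d * f l else 0) - (if l = b then d * f l else 0))"
    by (rule sum.cong) auto
  then show ?thesis by (simp add: sum_subtractf)
qed

lemma log_coord_span:
  assumes y: "y \<in> X" and nz: "\<And>i. y $ i \<noteq> 0"
  shows "\<exists>l. (\<lambda>z. log_coord b y i z - (\<Sum>j\<in>UNIV. l j * cotangent b y j z)) \<in> max_square X y"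
proof -
  let ?c = "\<lambda>j. a i $ j - a b $ j"
  \<comment> \<open>From \<open>\<delta>\<close> times the difference of the unit vectors at
    \<open>i\<close> and \<open>b\<close> the combination of the \<open>u j\<close> with the same
    pairings against \<open>a\<close> is subtracted, so \<open>r\<close> is a relation among the
    \<open>(1, a l)\<close>. The term at \<open>b\<close> drops out because
    \<open>log_coord b y b\<close> vanishes where \<open>z $ b\<close> is nonzero.\<close>
  define r where "r l = ((if l = i then int \<delta> else 0) - (if l = b then int \<delta> else 0)) -
      (\<Sum>j\<in>UNIV. ?c j * u j l)" for l
  have r_sum: "(\<Sum>l\<in>UNIV. of_int (r l) * f l) = of_nat \<delta> * f i - of_nat \<delta> * f b -
      (\<Sum>j\<in>UNIV. of_int (?c j) * (\<Sum>l\<in>UNIV. of_int (u j l) * f l))" for f :: "'m \<Rightarrow> 'c::comm_ring_1"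
  proof -
    have "of_int (r l) * f l = ((if l = i then of_nat \<delta> else 0) - (if l = b then of_nat \<delta> else 0)) * f l -
      (\<Sum>j\<in>UNIV. of_int (?c j) * (of_int (u j l) * f l))" for l
      by (simp add: r_def left_diff_distrib sum_distrib_right mult.assoc)
    then have "(\<Sum>l\<in>UNIV. of_int (r l) * f l) = (of_nat \<delta> * f i - of_nat \<delta> * f b) -
      (\<Sum>l\<in>UNIV. \<Sum>j\<in>UNIV. of_int (?c j) * (of_int (u j l) * f l))"
      by (simp add: sum_subtractf sum_delta_diff)
    then show ?thesis by (subst (asm) sum.swap) (simp add: sum_distrib_left)
  qed
  have "(\<Sum>l\<in>UNIV. r l) = 0"
    using r_sum[of "\<lambda>_. 1 :: int"] u_sum by simp
  moreover have "(\<Sum>l\<in>UNIV. r l * a l $ j') = 0" for j'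
    using r_sum[of "\<lambda>l. a l $ j'"] by (simp add: u_dual if_distrib[of "\<lambda>x. _ * x"] algebra_simps sum_subtractf cong: if_cong)
  ultimately have "(\<lambda>z. \<Sum>l\<in>UNIV. of_int (r l) * log_coord b y l z) \<in> max_square X y"
    by (intro log_coord_relation y nz)
  then have "(\<lambda>z. (1 / of_nat \<delta>) * (of_nat \<delta> * log_coord b y i z - of_nat \<delta> * log_coord b y b z -
      (\<Sum>j\<in>UNIV. of_int (?c j) * cotangent b y j z))) \<in> max_square X y"
    unfolding r_sum cotangent_def by (rule max_square_scale)
  then have "(\<lambda>z. log_coord b y i z - (\<Sum>j\<in>UNIV. of_int (?c j) / of_nat \<delta> * cotangent b y j z)) \<in> max_square X y"
    by (rule max_square_germ[OF _ y hom_nth[of b] nz])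
      (use \<delta> nz[of b] in \<open>simp add: log_coord_def[of _ _ b] coord_diff_def[of _ _ b] right_diff_distrib sum_distrib_left\<close>)
  then show ?thesis by (intro exI[of _ "\<lambda>j. of_int (?c j) / of_nat \<delta>"])
qed

lemma cotangent_span:
  assumes y: "y \<in> X" and nz: "\<And>i. y $ i \<noteq> 0" and s: "s \<in> max_ideal X y"
  shows "\<exists>l. (\<lambda>z. s z - (\<Sum>j\<in>UNIV. l j * cotangent b y j z)) \<in> max_square X y"
proof -
  obtain c where c: "(\<lambda>z. s z - (\<Sum>i\<in>UNIV. c i * coord_diff b y i z)) \<in> max_square X y"
    using max_ideal_linear[OF s y nz] by blast
  have "\<forall>i. \<exists>l. (\<lambda>z. log_coord b y i z - (\<Sum>j\<in>UNIV. l j * cotangent b y j z)) \<in> max_square X y"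
    by (intro allI log_coord_span y nz)
  from choice[OF this] obtain l where
    l: "\<And>i. (\<lambda>z. log_coord b y i z - (\<Sum>j\<in>UNIV. l i j * cotangent b y j z)) \<in> max_square X y"
    by blast
  let ?d = "\<lambda>i. c i * (y $ i / y $ b)"
  have "(\<lambda>z. (s z - (\<Sum>i\<in>UNIV. c i * coord_diff b y i z)) +
      (\<Sum>i\<in>UNIV. ?d i * (log_coord b y i z - (\<Sum>j\<in>UNIV. l i j * cotangent b y j z)))) \<in> max_square X y"
    by (intro max_square_add c max_square_sum max_square_scale l)
  moreover have "(s z - (\<Sum>i\<in>UNIV. c i * coord_diff b y i z)) +
      (\<Sum>i\<in>UNIV. ?d i * (log_coord b y i z - (\<Sum>j\<in>UNIV. l i j * cotangent b y j z))) =
      s z - (\<Sum>j\<in>UNIV. (\<Sum>i\<in>UNIV. ?d i * l i j) * cotangent b y j z)" for z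
  proof -
    have "?d i * log_coord b y i z = c i * coord_diff b y i z" for i
      using nz[of i] nz[of b] by (simp add: log_coord_def)
    moreover have "(\<Sum>i\<in>UNIV. ?d i * (\<Sum>j\<in>UNIV. l i j * cotangent b y j z)) =
        (\<Sum>j\<in>UNIV. (\<Sum>i\<in>UNIV. ?d i * l i j) * cotangent b y j z)"
      unfolding sum_distrib_left sum_distrib_right by (subst sum.swap) (simp add: mult.assoc)
    ultimately show ?thesis by (simp only: right_diff_distrib sum_subtractf) simp
  qed
  ultimately show ?thesis by (intro exI[of _ "\<lambda>j. \<Sum>i\<in>UNIV. ?d i * l i j"]) (simp only:)
qed

text \<open>A relation modulo the square, multiplied by \<open>z $ b\<close>, agrees near
  \<open>y\<close> with a linear form \<open>c'\<close> vanishing there to order two. Its moment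
  against the \<open>j0\<close>-th coordinate is therefore zero, and by the duality of
  \<open>u\<close> and \<open>a\<close> this moment is
  \<open>c j0 * y $ b * \<delta>\<close>.\<close>

lemma cotangent_indep:
  assumes y: "y \<in> X" and nz: "\<And>i. y $ i \<noteq> 0"
  shows "family_indep (max_square X y) UNIV (cotangent b y)"
  unfolding family_indep_def
proof (intro allI impI ballI)
  fix c j0 assume c: "(\<lambda>z. \<Sum>j\<in>UNIV. c j * cotangent b y j z) \<in> max_square X y"
  define c' where "c' = (\<chi> l. \<Sum>j\<in>UNIV. c j * of_int (u j l) * (y $ b / y $ l))"
  have "(\<lambda>z. z $ b * (\<Sum>j\<in>UNIV. c j * cotangent b y j z)) \<in> max_power X y (Suc 1)"
    using hom_mult_max_square[OF c hom_nth] by (simp add: numeral_2_eq_2)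
  moreover have "lin_form c' z = z $ b * (\<Sum>j\<in>UNIV. c j * cotangent b y j z)" if "z $ b \<noteq> 0" for z
  proof -
    have log: "z $ b * log_coord b y l z = y $ b / y $ l * z $ l - z $ b" for l
      using nz[of l] nz[of b] that by (simp add: log_coord_def coord_diff_def field_simps)
    have cot: "z $ b * cotangent b y j z = (\<Sum>l\<in>UNIV. of_int (u j l) * (y $ b / y $ l) * z $ l)" for j
    proof -
      have "z $ b * cotangent b y j z = (\<Sum>l\<in>UNIV. of_int (u j l) * (z $ b * log_coord b y l z))"
        unfolding cotangent_def sum_distrib_left by (simp add: ac_simps)
      also have "\<dots> = (\<Sum>l\<in>UNIV. of_int (u j l) * (y $ b / y $ l) * z $ l) - of_int (\<Sum>l\<in>UNIV. u j l) * z $ b"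
        unfolding log by (simp add: right_diff_distrib sum_subtractf sum_distrib_right mult.assoc)
      finally show ?thesis by (simp add: u_sum)
    qed
    have "z $ b * (\<Sum>j\<in>UNIV. c j * cotangent b y j z) = (\<Sum>j\<in>UNIV. c j * (z $ b * cotangent b y j z))"
      unfolding sum_distrib_left by (simp add: ac_simps)
    also have "\<dots> = lin_form c' z"
      unfolding cot sum_distrib_left lin_form_def c'_def
      by (subst sum.swap) (simp add: sum_distrib_right sum_distrib_left mult.assoc)
    finally show ?thesis ..
  qed
  ultimately have "lin_form c' \<in> max_power X y (Suc 1)"
    by (rule max_power_germ[OF _ y hom_nth[of b] nz])
  then have "(\<Sum>i\<in>UNIV. c' $ i * y $ i * of_int (a i $ j0) ^ 1) = 0"
    using jet_moment[OF _ affine_fun_coord, of y a c' 1 1 j0] y unfolding X_def by simp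
  moreover have "(\<Sum>i\<in>UNIV. c' $ i * y $ i * of_int (a i $ j0) ^ 1) =
      (\<Sum>j\<in>UNIV. c j * y $ b * of_int (\<Sum>l\<in>UNIV. u j l * a l $ j0))"
  proof -
    have "c' $ i * y $ i * of_int (a i $ j0) ^ 1 = (\<Sum>j\<in>UNIV. c j * y $ b * of_int (u j i * a i $ j0))" for i
      unfolding c'_def vec_lambda_beta sum_distrib_right using nz[of i] by (intro sum.cong) simp_all
    then show ?thesis by (simp only: of_int_sum sum_distrib_left) (rule sum.swap)
  qed
  ultimately have "c j0 * y $ b * of_nat \<delta> = 0"
    by (simp add: u_dual if_distrib[of "\<lambda>x. _ * x"] if_distrib[of of_int] cong: if_cong)
  then show "c j0 = 0" using \<delta> nz[of b] by simp
qed

lemma dim_cotangent: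
  assumes y: "y \<in> X" and nz: "\<And>i. y $ i \<noteq> 0"
  shows "dim_mod (max_square X y) (max_ideal X y) = enat CARD('n)"
proof (rule antisym)
  fix b :: 'm
  show "dim_mod (max_square X y) (max_ideal X y) \<le> enat CARD('n)"
    by (intro dim_mod_le[where g = "cotangent b y"] fun_subspace_max_square cotangent_span y nz) auto
  show "enat CARD('n) \<le> dim_mod (max_square X y) (max_ideal X y)"
    by (rule dim_mod_ge[OF _ _ _ cotangent_indep[OF y nz, of b]])
      (auto intro!: fun_subspace_max_square cotangent_max_ideal nz)
qed

end

section \<open>The dimension of a toric variety\<close>

lemma closedin_subtopology_zariski:
  assumes "closedin zariski_proj X" "closedin (subtopology zariski_proj X) A"
  shows "closedin zariski_proj A"
  using assms closedin_closed_subtopology by blast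

text \<open>The zero sets of \<open>f\<close> and \<open>g\<close> in \<open>X\<close> are closed
  and cover \<open>Z\<close>. Forms on an irreducible set thus have no zero divisors, which the
  count of forms below relies on.\<close>

lemma irreducible_product:
  fixes Z :: "('a::field ^ 'm::finite) set"
  assumes Z: "irreducible_in (subtopology zariski_proj X) Z"
    and f: "f \<in> hom_poly_funs d" and g: "g \<in> hom_poly_funs e" and fg: "\<And>z. z \<in> Z \<Longrightarrow> f z * g z = 0"
  shows "(\<forall>z\<in>Z. f z = 0) \<or> (\<forall>z\<in>Z. g z = 0)"
proof -
  let ?V = "\<lambda>h. {x :: 'a ^ 'm. x \<noteq> 0 \<and> h x = 0} \<inter> X"
  have cl: "closedin (subtopology zariski_proj X) (?V h)" if "h \<in> hom_poly_funs d" for h d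
    unfolding closedin_subtopology using closedin_zariski_proj_vanishing[OF that] by blast
  have sub: "Z \<subseteq> X" "\<And>z. z \<in> Z \<Longrightarrow> z \<noteq> 0"
    using Z by (auto simp: irreducible_in_def topspace_zariski_proj)
  have "Z \<subseteq> ?V f \<union> ?V g" using sub fg by auto
  then have "Z \<subseteq> ?V f \<or> Z \<subseteq> ?V g"
    using Z cl[OF f] cl[OF g] unfolding irreducible_in_def by blast
  then show ?thesis by blast
qed

section \<open>Hilbert functions and chains of irreducible closed sets\<close>

definition indep_on :: "'b set \<Rightarrow> nat \<Rightarrow> (nat \<Rightarrow> 'b \<Rightarrow> 'a::field) \<Rightarrow> bool" where
  "indep_on Z N g \<longleftrightarrow> (\<forall>c. (\<forall>z\<in>Z. (\<Sum>i<N. c i * g i z) = 0) \<longrightarrow> (\<forall>i<N. c i = 0))"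

text \<open>The Hilbert function of \<open>Z\<close> takes a value at least \<open>N\<close> in degree \<open>q\<close>.\<close>

definition hilbert_ge :: "('a::field ^ 'm::finite) set \<Rightarrow> nat \<Rightarrow> nat \<Rightarrow> bool" where
  "hilbert_ge Z q N \<longleftrightarrow> (\<exists>g. (\<forall>i<N. g i \<in> hom_poly_funs q) \<and> indep_on Z N g)"

lemma hilbert_ge_one:
  assumes "z \<in> Z" "z $ i \<noteq> 0"
  shows "hilbert_ge Z q 1"
  unfolding hilbert_ge_def indep_on_def
proof (intro exI[of _ "\<lambda>_ z. z $ i ^ q"] conjI allI impI)
  show "(\<lambda>z. z $ i ^ q) \<in> hom_poly_funs q" using hom_power[OF hom_nth[of i], of q] by simp
  fix c :: "nat \<Rightarrow> 'a" and l
  assume c: "\<forall>z\<in>Z. (\<Sum>n<1. c n * z $ i ^ q) = 0" "l < (1 :: nat)"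
  have "(\<Sum>n<1. c n * z $ i ^ q) = 0" using c(1) assms(1) by blast
  then show "c l = 0" using assms c(2) by simp
qed

lemma hilbert_ge_mono:
  assumes "hilbert_ge Z q N" "Z \<subseteq> Z'"
  shows "hilbert_ge Z' q N"
proof -
  obtain g where g: "\<forall>i<N. g i \<in> hom_poly_funs q" "indep_on Z N g"
    using assms(1) unfolding hilbert_ge_def by blast
  have "indep_on Z' N g" unfolding indep_on_def
  proof (intro allI impI)
    fix c i assume c: "\<forall>z\<in>Z'. (\<Sum>i<N. c i * g i z) = 0" and i: "i < N"
    have "\<forall>z\<in>Z. (\<Sum>i<N. c i * g i z) = 0" using c assms(2) by (auto dest!: subsetD)
    then show "c i = 0" using g(2) i by (simp add: indep_on_def)
  qed
  then show ?thesis using g(1) unfolding hilbert_ge_def by (intro exI[of _ g] conjI)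
qed

text \<open>Multiples of \<open>f\<close> vanish on \<open>Z\<close>, so they do not interfere with
  forms independent there; among themselves the products of \<open>f\<close> with independent forms
  stay independent on \<open>Z'\<close>, because irreducibility allows \<open>f\<close> to be
  cancelled.\<close>

lemma hilbert_ge_step:
  fixes Z Z' :: "('a::field ^ 'm::finite) set"
  assumes h: "hilbert_ge Z (D + q) N" and h': "hilbert_ge Z' q N'" and sub: "Z \<subseteq> Z'"
    and f: "f \<in> hom_poly_funs D" "\<And>z. z \<in> Z \<Longrightarrow> f z = 0" "x \<in> Z'" "f x \<noteq> 0"
    and irr: "irreducible_in (subtopology zariski_proj X) Z'"
  shows "hilbert_ge Z' (D + q) (N + N')"
proof -
  obtain g where g: "\<And>i. i < N \<Longrightarrow> g i \<in> hom_poly_funs (D + q)" "indep_on Z N g"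
    using h unfolding hilbert_ge_def by blast
  obtain g' where g': "\<And>i. i < N' \<Longrightarrow> g' i \<in> hom_poly_funs q" "indep_on Z' N' g'"
    using h' unfolding hilbert_ge_def by blast
  define G where "G i = (if i < N then g i else (\<lambda>z. f z * g' (i - N) z))" for i
  have "G i \<in> hom_poly_funs (D + q)" if "i < N + N'" for i
    using that g(1) g'(1) by (auto simp: G_def intro!: hom_mult f(1))
  moreover have "indep_on Z' (N + N') G"
    unfolding indep_on_def
  proof (intro allI impI)
    fix c i assume c: "\<forall>z\<in>Z'. (\<Sum>i<N + N'. c i * G i z) = 0" and i: "i < N + N'"
    have split: "(\<Sum>i<N + N'. c i * G i z) =
        (\<Sum>i<N. c i * g i z) + f z * (\<Sum>i<N'. c (N + i) * g' i z)" for z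
      by (simp add: sum_lessThan_add G_def sum_distrib_left ac_simps)
    have c1: "(\<Sum>i<N. c i * g i z) = 0" if "z \<in> Z" for z
    proof -
      have "z \<in> Z'" using sub that by blast
      then show ?thesis using c split[of z] f(2)[OF that] by simp
    qed
    then have z1: "\<forall>i<N. c i = 0" using g(2) unfolding indep_on_def by blast
    have "f z * (\<Sum>i<N'. c (N + i) * g' i z) = 0" if "z \<in> Z'" for z
      using c that split[of z] z1 by simp
    then have "(\<forall>z\<in>Z'. f z = 0) \<or> (\<forall>z\<in>Z'. (\<Sum>i<N'. c (N + i) * g' i z) = 0)"
      by (intro irreducible_product[OF irr f(1), of _ q] hom_sum hom_scale g'(1)) auto
    then have "\<forall>z\<in>Z'. (\<Sum>i<N'. c (N + i) * g' i z) = 0" using f(3,4) by blast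
    then have "\<forall>i<N'. c (N + i) = 0"
      using g'(2)[unfolded indep_on_def, rule_format, of "\<lambda>i. c (N + i)"] by blast
    then have "c (N + (i - N)) = 0" if "\<not> i < N" using i that by (metis add_diff_inverse_nat nat_add_left_cancel_less)
    then show "c i = 0" using z1 by (cases "i < N") auto
  qed
  ultimately show ?thesis unfolding hilbert_ge_def by blast
qed

text \<open>Iterating \<open>hilbert_ge_step\<close> reproduces Pascal's recursion in
  \<open>p\<close> and \<open>j\<close>, which is why the separating forms are required to share one
  degree \<open>D\<close>.\<close>

lemma hilbert_ge_chain:
  fixes Z :: "nat \<Rightarrow> ('a::field ^ 'm::finite) set"
  assumes irr: "\<And>i. i \<le> d \<Longrightarrow> irreducible_in (subtopology zariski_proj X) (Z i)"
    and f: "\<And>i. i < d \<Longrightarrow> f i \<in> hom_poly_funs D" "\<And>i z. i < d \<Longrightarrow> z \<in> Z i \<Longrightarrow> f i z = 0"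
      "\<And>i. i < d \<Longrightarrow> x i \<in> Z (Suc i)" "\<And>i. i < d \<Longrightarrow> f i (x i) \<noteq> 0"
    and sub: "\<And>i. i < d \<Longrightarrow> Z i \<subseteq> Z (Suc i)"
  shows "j \<le> d \<Longrightarrow> hilbert_ge (Z j) (p * D) ((p + j) choose j)"
proof (induction j arbitrary: p)
  case 0
  have "Z 0 \<noteq> {}" "Z 0 \<subseteq> topspace (subtopology zariski_proj X)"
    using irr[of 0] by (auto simp: irreducible_in_def)
  then obtain z where "z \<in> Z 0" "z \<noteq> 0" by (auto simp: topspace_zariski_proj)
  then obtain i where "z $ i \<noteq> 0" by (auto simp: vec_eq_iff)
  from hilbert_ge_one[OF \<open>z \<in> Z 0\<close> this] show ?case by simp
next
  case (Suc j)
  note IH = Suc.IH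
  show ?case
  proof (induction p)
    case 0
    have "Z (Suc j) \<noteq> {}" "Z (Suc j) \<subseteq> topspace (subtopology zariski_proj X)"
      using irr[OF Suc.prems] by (auto simp: irreducible_in_def)
    then obtain z where "z \<in> Z (Suc j)" "z \<noteq> 0" by (auto simp: topspace_zariski_proj)
    then obtain i where "z $ i \<noteq> 0" by (auto simp: vec_eq_iff)
    from hilbert_ge_one[OF \<open>z \<in> Z (Suc j)\<close> this] show ?case by simp
  next
    case (Suc p)
    have j: "j < d" using \<open>Suc j \<le> d\<close> by simp
    have "hilbert_ge (Z j) (D + p * D) ((Suc p + j) choose j)"
      using j IH[of "Suc p"] by simp
    from hilbert_ge_step[OF this Suc.IH sub[OF j] f(1)[OF j] f(2)[OF j] f(3)[OF j] f(4)[OF j] irr]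
    show ?case using j by simp
  qed
qed

section \<open>Polynomial parametrization of the orbit and the dimension of its closure\<close>

definition mono_pt :: "('m::finite \<Rightarrow> 'n::finite \<Rightarrow> nat) \<Rightarrow> 'a::field ^ 'n \<Rightarrow> 'a ^ 'm" where
  "mono_pt b t = (\<chi> i. \<Prod>j\<in>UNIV. t $ j ^ b i j)"

text \<open>A power of the product of all \<open>t $ j\<close> as a common factor makes the
  exponents nonnegative and does not move the projective point.\<close>

lemma torus_pt_shift:
  fixes a :: "'m::finite \<Rightarrow> int ^ 'n::finite"
  obtains b :: "'m \<Rightarrow> 'n \<Rightarrow> nat" where
    "\<And>t :: 'a::field ^ 'n. torus_inv t \<Longrightarrow> \<exists>c. c \<noteq> 0 \<and> mono_pt b t = c *s torus_pt a t"
proof -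
  define M where "M = (\<Sum>i\<in>UNIV. \<Sum>j\<in>UNIV. \<bar>a i $ j\<bar>)"
  have "\<bar>a i $ j\<bar> \<le> M" for i j
  proof -
    have "\<bar>a i $ j\<bar> \<le> (\<Sum>j\<in>UNIV. \<bar>a i $ j\<bar>)"
      by (rule member_le_sum) auto
    also have "\<dots> \<le> M" unfolding M_def
      by (rule member_le_sum[of i UNIV "\<lambda>i. \<Sum>j\<in>UNIV. \<bar>a i $ j\<bar>"]) (auto intro: sum_nonneg)
    finally show ?thesis .
  qed
  then have nn: "0 \<le> a i $ j + M" for i j by (smt (verit))
  define b where "b i j = nat (a i $ j + M)" for i j
  have "\<exists>c. c \<noteq> 0 \<and> mono_pt b t = c *s torus_pt a t" if t: "torus_inv t" for t :: "'a ^ 'n"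
  proof (intro exI conjI)
    show "(\<Prod>j\<in>UNIV. t $ j powi M) \<noteq> 0" using t by (simp add: torus_inv_def)
    have "t $ j ^ b i j = t $ j powi M * t $ j powi (a i $ j)" for i j
    proof -
      have "t $ j ^ b i j = t $ j powi int (b i j)" by simp
      also have "int (b i j) = M + a i $ j" using nn[of i j] by (simp add: b_def)
      finally show ?thesis using t by (simp add: power_int_add torus_inv_def)
    qed
    then show "mono_pt b t = (\<Prod>j\<in>UNIV. t $ j powi M) *s torus_pt a t"
      by (simp add: vec_eq_iff mono_pt_def torus_pt_def prod.distrib)
  qed
  then show ?thesis using that by blast
qed

lemma hom_mono_pt:
  fixes f :: "'a::field ^ 'm::finite \<Rightarrow> 'a" and b :: "'m \<Rightarrow> 'n::finite \<Rightarrow> nat"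
  assumes "f \<in> hom_poly_funs q" "\<And>i j. b i j \<le> B"
  shows "(\<lambda>t. f (mono_pt b t)) \<in> poly_funs {e. \<forall>j. e j \<le> q * B}"
proof -
  obtain E c where E: "finite E" "\<And>e. e \<in> E \<Longrightarrow> (\<Sum>i\<in>UNIV. e i) = q"
    "\<And>x. f x = (\<Sum>e\<in>E. c e * (\<Prod>i\<in>UNIV. x $ i ^ e i))"
    using hom_polyE[OF assms(1)] by metis
  have "(\<Prod>i\<in>UNIV. mono_pt b t $ i ^ e i) = (\<Prod>j\<in>UNIV. t $ j ^ (\<Sum>i\<in>UNIV. e i * b i j))"
    for t :: "'a ^ 'n" and e
    unfolding mono_pt_def by (simp add: prod_power_distrib power_mult[symmetric] power_sum mult.commute)
      (rule prod.swap)
  then have "(\<lambda>t. f (mono_pt b t)) = (\<lambda>t. \<Sum>e\<in>E. c e * (\<Prod>j\<in>UNIV. t $ j ^ (\<Sum>i\<in>UNIV. e i * b i j)))"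
    by (simp add: E(3))
  also have "\<dots> \<in> poly_funs {e. \<forall>j. e j \<le> q * B}"
  proof (rule poly_funs_sumI[OF E(1)], intro CollectI allI)
    fix e j assume "e \<in> E"
    have "(\<Sum>i\<in>UNIV. e i * b i j) \<le> (\<Sum>i\<in>UNIV. e i * B)" by (intro sum_mono mult_left_mono assms) auto
    also have "\<dots> = q * B" using E(2)[OF \<open>e \<in> E\<close>] by (simp add: sum_distrib_right[symmetric])
    finally show "(\<Sum>i\<in>UNIV. e i * b i j) \<le> q * B" .
  qed
  finally show ?thesis .
qed

lemma poly_funs_finite_rep:
  assumes "f \<in> poly_funs M" "finite M"
  shows "\<exists>c. \<forall>x. f x = (\<Sum>e\<in>M. c e * (\<Prod>i\<in>UNIV. x $ i ^ e i))"
proof -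
  obtain E c where E: "finite E" "E \<subseteq> M" "\<And>x. f x = (\<Sum>e\<in>E. c e * (\<Prod>i\<in>UNIV. x $ i ^ e i))"
    using poly_funsE[OF assms(1)] by metis
  have "f x = (\<Sum>e\<in>M. (if e \<in> E then c e else 0) * (\<Prod>i\<in>UNIV. x $ i ^ e i))" for x
    unfolding E(3) by (rule sum.mono_neutral_cong_left) (use E assms in auto)
  then show ?thesis by (intro exI[of _ "\<lambda>e. if e \<in> E then c e else 0"] allI)
qed

lemma card_bounded_exponents:
  "finite {e :: 'n::finite \<Rightarrow> nat. \<forall>j. e j \<le> K} \<and> card {e :: 'n \<Rightarrow> nat. \<forall>j. e j \<le> K} = Suc K ^ CARD('n)"
proof -
  have "{e :: 'n \<Rightarrow> nat. \<forall>j. e j \<le> K} = PiE UNIV (\<lambda>_. {..K})"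
    by (auto simp: PiE_def extensional_def)
  then show ?thesis by (simp add: card_PiE finite_PiE)
qed

text \<open>In the torus parameters a form of degree \<open>q\<close> involves only exponents up to
  \<open>q * B\<close>. More forms than there are such monomials are linearly dependent on the
  orbit, hence on its closure.\<close>

lemma hilbert_toric_le:
  fixes a :: "'m::finite \<Rightarrow> int ^ 'n::finite"
  obtains B where "\<And>q N. hilbert_ge (toric_variety a :: ('a::field ^ 'm) set) q N \<Longrightarrow> N \<le> Suc (q * B) ^ CARD('n)"
    "B > 0"
proof -
  obtain b :: "'m \<Rightarrow> 'n \<Rightarrow> nat" where
    b: "\<And>t :: 'a ^ 'n. torus_inv t \<Longrightarrow> \<exists>c. c \<noteq> 0 \<and> mono_pt b t = c *s torus_pt a t"
    using torus_pt_shift[of a] by blast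
  define B where "B = Suc (Max (range (\<lambda>(i, j). b i j)))"
  have B: "b i j \<le> B" for i j
  proof -
    have "b i j \<le> Max (range (\<lambda>(i, j). b i j))" by (rule Max_ge) (auto intro!: image_eqI[of _ _ "(i, j)"])
    then show ?thesis by (simp add: B_def)
  qed
  have "N \<le> Suc (q * B) ^ CARD('n)" if h: "hilbert_ge (toric_variety a :: ('a ^ 'm) set) q N" for q N
  proof (rule ccontr)
    let ?M = "{e :: 'n \<Rightarrow> nat. \<forall>j. e j \<le> q * B}"
    assume "\<not> N \<le> Suc (q * B) ^ CARD('n)"
    then have card: "card ?M < card {..<N}" using card_bounded_exponents[where 'n = 'n, of "q * B"] by simp
    obtain g where g: "\<And>i. i < N \<Longrightarrow> g i \<in> hom_poly_funs q" "indep_on (toric_variety a :: ('a ^ 'm) set) N g"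
      using h unfolding hilbert_ge_def by blast
    have rep: "\<exists>c. \<forall>t. g i (mono_pt b t) = (\<Sum>e\<in>?M. c e * (\<Prod>i\<in>UNIV. t $ i ^ e i))" if "i < N" for i
      using poly_funs_finite_rep[OF hom_mono_pt[where b = b and B = B, OF g(1)[OF that] B]]
        card_bounded_exponents[where 'n = 'n, of "q * B"] by simp
    have "\<forall>i. \<exists>c. i < N \<longrightarrow> (\<forall>t. g i (mono_pt b t) = (\<Sum>e\<in>?M. c e * (\<Prod>i\<in>UNIV. t $ i ^ e i)))"
      using rep by blast
    from choice[OF this] obtain C where
      C: "\<And>i t. i < N \<Longrightarrow> g i (mono_pt b t) = (\<Sum>e\<in>?M. C i e * (\<Prod>i\<in>UNIV. t $ i ^ e i))"
      by blast
    obtain c where c: "\<And>e. e \<in> ?M \<Longrightarrow> (\<Sum>i<N. c i * C i e) = 0" "\<exists>i\<in>{..<N}. c i \<noteq> 0"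
      using ex_nonzero_solution[OF _ _ card, of "\<lambda>e i. C i e"] card_bounded_exponents[of "q * B"] by auto
    have van: "(\<Sum>i<N. c i * g i (mono_pt b t)) = 0" for t
    proof -
      have "(\<Sum>i<N. c i * g i (mono_pt b t)) = (\<Sum>e\<in>?M. (\<Sum>i<N. c i * C i e) * (\<Prod>i\<in>UNIV. t $ i ^ e i))"
        by (simp add: C sum_distrib_left sum_distrib_right mult.assoc) (rule sum.swap)
      also have "\<dots> = 0" using c(1) by (intro sum.neutral) auto
      finally show ?thesis .
    qed
    have hom: "(\<lambda>z. \<Sum>i<N. c i * g i z) \<in> hom_poly_funs q" by (intro hom_sum hom_scale g) auto
    have "(\<Sum>i<N. c i * g i z) = 0" if "z \<in> toric_variety a" for z
    proof (rule toric_vanish[OF that hom])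
      fix t :: "'a ^ 'n" assume "torus_inv t"
      then obtain s where "s \<noteq> 0" "mono_pt b t = s *s torus_pt a t" using b by blast
      then show "(\<Sum>i<N. c i * g i (torus_pt a t)) = 0"
        using van[of t] hom_homogeneous[OF hom, of s "torus_pt a t"] by simp
    qed
    then show False using g(2) c(2) unfolding indep_on_def by blast
  qed
  then show ?thesis using that[of B] by (simp add: B_def)
qed

lemma power_le_fact_choose: "(p + 1) ^ r \<le> fact r * ((p + r) choose r :: nat)"
proof (induction r)
  case (Suc r)
  have "fact (Suc r) * ((p + Suc r) choose Suc r) = fact r * (Suc r * (Suc (p + r) choose Suc r))"
    by (simp add: algebra_simps)
  also have "\<dots> = Suc (p + r) * (fact r * ((p + r) choose r))"
    by (simp only: Suc_times_binomial) (simp add: algebra_simps)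
  also have "\<dots> \<ge> Suc (p + r) * (p + 1) ^ r" using Suc.IH by (rule mult_left_mono) simp
  finally have "Suc (p + r) * (p + 1) ^ r \<le> fact (Suc r) * ((p + Suc r) choose Suc r)" .
  moreover have "(p + 1) ^ Suc r \<le> Suc (p + r) * (p + 1) ^ r" by simp
  ultimately show ?case by linarith
qed simp

text \<open>A chain of length \<open>n + 1\<close>, where \<open>n = CARD('n)\<close>, would force
  growth of order \<open>p ^ (n + 1)\<close> on the Hilbert function in degrees
  \<open>p * D\<close>, while the monomial count allows only order \<open>p ^ n\<close>.\<close>

lemma toric_chain_length:
  fixes Z :: "nat \<Rightarrow> ('a::field ^ 'm::finite) set" and a :: "'m \<Rightarrow> int ^ 'n::finite"
  assumes cl: "\<And>i. i \<le> d \<Longrightarrow> closedin (subtopology zariski_proj (toric_variety a)) (Z i)"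
    and irr: "\<And>i. i \<le> d \<Longrightarrow> irreducible_in (subtopology zariski_proj (toric_variety a)) (Z i)"
    and sub: "\<And>i. i < d \<Longrightarrow> Z i \<subset> Z (Suc i)"
  shows "d \<le> CARD('n)"
proof (rule ccontr)
  let ?n = "CARD('n)"
  let ?X = "toric_variety a :: ('a ^ 'm) set"
  assume "\<not> d \<le> ?n"
  then have d: "Suc ?n \<le> d" by simp
  have "\<forall>i. \<exists>w. i < d \<longrightarrow> (case w of (e, g, x, k) \<Rightarrow>
    g \<in> hom_poly_funs e \<and> (\<forall>y\<in>Z i. g y = 0) \<and> x \<in> Z (Suc i) \<and> g x \<noteq> 0 \<and> x $ k \<noteq> 0)"
    (is "\<forall>i. \<exists>w. i < d \<longrightarrow> ?P i w")
  proof (intro allI)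
    fix i
    show "\<exists>w. i < d \<longrightarrow> ?P i w"
    proof (cases "i < d")
      case i: True
    obtain x where x: "x \<in> Z (Suc i)" "x \<notin> Z i" using sub[OF i] by blast
    have "x \<noteq> 0" using x(1) irr[of "Suc i"] i by (auto simp: irreducible_in_def topspace_zariski_proj)
    moreover have "closedin zariski_proj (Z i)"
      using closedin_subtopology_zariski[OF closedin_toric cl] i by simp
    ultimately obtain e g where "g \<in> hom_poly_funs e" "\<And>y. y \<in> Z i \<Longrightarrow> g y = 0" "g x \<noteq> 0"
      using closedin_separate x(2) by metis
    moreover obtain k where "x $ k \<noteq> 0" using \<open>x \<noteq> 0\<close> by (auto simp: vec_eq_iff)
    ultimately have "?P i (e, g, x, k)" using x(1) by simp
    then show ?thesis by blast
    qed simp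
  qed
  from choice[OF this] obtain w where w: "\<And>i. i < d \<Longrightarrow> ?P i (w i)" by blast
  define e g x k where "e i = fst (w i)" and "g i = fst (snd (w i))" and "x i = fst (snd (snd (w i)))"
    and "k i = snd (snd (snd (w i)))" for i
  have g: "g i \<in> hom_poly_funs (e i)" "\<And>y. y \<in> Z i \<Longrightarrow> g i y = 0" "x i \<in> Z (Suc i)"
    "g i (x i) \<noteq> 0" "x i $ k i \<noteq> 0" if "i < d" for i
    using w[OF that] by (auto simp: e_def g_def x_def k_def split: prod.splits)
  \<comment> \<open>A common degree for the separating forms; the successor keeps it positive, as
    the estimate \<open>Suc (p * D * B) \<le> D * B * (p + 1)\<close> requires.\<close>
  define D where "D = Suc (\<Sum>i<d. e i)"
  have eD: "e i \<le> D" if "i < d" for i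
    using member_le_sum[of i "{..<d}" e] that by (auto simp: D_def)
  \<comment> \<open>A power of a coordinate that is nonzero at \<open>x i\<close> raises the degree
    to \<open>D\<close> without creating a zero at \<open>x i\<close>.\<close>
  define f where "f i z = z $ k i ^ (D - e i) * g i z" for i and z :: "'a ^ 'm"
  have f: "f i \<in> hom_poly_funs D" if "i < d" for i
    using hom_mult[OF hom_power[OF hom_nth[of "k i"], of "D - e i"] g(1)[OF that]] eD[OF that]
    unfolding f_def by simp
  have hil: "hilbert_ge (Z (Suc ?n)) (p * D) ((p + Suc ?n) choose Suc ?n)" for p
    by (rule hilbert_ge_chain[where f = f and x = x and X = ?X, OF irr f])
      (use d g psubset_imp_subset[OF sub] in \<open>auto simp: f_def\<close>)
  have ZX: "Z (Suc ?n) \<subseteq> ?X"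
    using irr[OF d] by (auto simp: irreducible_in_def)
  obtain B where B: "\<And>q N. hilbert_ge ?X q N \<Longrightarrow> N \<le> Suc (q * B) ^ ?n" "B > 0"
    using hilbert_toric_le[of a] by blast
  have bound: "(p + Suc ?n) choose Suc ?n \<le> Suc (p * D * B) ^ ?n" for p
  proof (rule B(1))
    show "hilbert_ge ?X (p * D) ((p + Suc ?n) choose Suc ?n)"
      by (rule hilbert_ge_mono[OF hil ZX])
  qed
  have "p + 1 \<le> fact (Suc ?n) * (D * B) ^ ?n" for p
  proof -
    have "Suc (p * D * B) \<le> D * B * (p + 1)"
      using B(2) by (simp add: D_def algebra_simps)
    then have "Suc (p * D * B) ^ ?n \<le> (D * B * (p + 1)) ^ ?n" by (rule power_mono) simp
    then have "(p + 1) ^ Suc ?n \<le> fact (Suc ?n) * ((D * B * (p + 1)) ^ ?n)"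
      using power_le_fact_choose[of p "Suc ?n"] bound[of p]
      by (meson le_trans mult_le_mono2)
    then have "(p + 1) * (p + 1) ^ ?n \<le> fact (Suc ?n) * (D * B) ^ ?n * (p + 1) ^ ?n"
      by (simp only: power_mult_distrib[of "D * B" "p + 1"] power_Suc mult.assoc[of "fact (Suc CARD('n))"])
    then show ?thesis by (rule mult_right_le_imp_le) simp
  qed
  from this[of "fact (Suc ?n) * (D * B) ^ ?n"] show False by simp
qed

text \<open>Two nonvanishing conditions, met at \<open>t1\<close> and at \<open>t2\<close>, are
  restricted to the line through these points, which stays in \<open>T\<close>. They become nonzero
  polynomials in one variable, so some parameter satisfies both and also avoids the zeros of the
  torus coordinates.\<close>

lemma irreducible_torus_closure:
  fixes T :: "('a::field_char_0 ^ 'n::finite) set" and a :: "'m::finite \<Rightarrow> int ^ 'n"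
  assumes T: "t0 \<in> T" "torus_inv t0"
    and line: "\<And>t t' s. t \<in> T \<Longrightarrow> t' \<in> T \<Longrightarrow> (\<chi> j. t $ j + s * (t' $ j - t $ j)) \<in> T"
  shows "irreducible_in (subtopology zariski_proj (toric_variety a))
    (zariski_proj closure_of {torus_pt a t | t. torus_inv t \<and> t \<in> T})"
proof -
  let ?S = "{torus_pt a t | t. torus_inv t \<and> t \<in> T}"
  let ?Z = "zariski_proj closure_of ?S"
  have ZX: "?Z \<subseteq> toric_variety a"
    unfolding toric_variety_eq by (rule closure_of_mono) auto
  have SZ: "?S \<subseteq> ?Z"
    by (rule closure_of_subset) (auto simp: topspace_zariski_proj torus_pt_nonzero)
  have clo: "\<exists>t\<in>T. torus_inv t \<and> f (torus_pt a t) \<noteq> 0"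
    if "f \<in> hom_poly_funs d" "f p \<noteq> 0" "p \<in> ?Z" for f p d
    using that unfolding closure_zariski_proj by blast
  obtain b :: "'m \<Rightarrow> 'n \<Rightarrow> nat" where
    b: "\<And>t :: 'a ^ 'n. torus_inv t \<Longrightarrow> \<exists>c. c \<noteq> 0 \<and> mono_pt b t = c *s torus_pt a t"
    using torus_pt_shift[of a] by blast
  have nz: "f (mono_pt b t) = 0 \<longleftrightarrow> f (torus_pt a t) = 0" if t: "torus_inv t" and f: "f \<in> hom_poly_funs d"
    for f and t :: "'a ^ 'n" and d
  proof -
    obtain c where "c \<noteq> 0" "mono_pt b t = c *s torus_pt a t" using b[OF t] by blast
    then show ?thesis by (simp add: hom_homogeneous[OF f])
  qed
  have "?Z \<subseteq> A \<or> ?Z \<subseteq> B"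
    if A: "closedin (subtopology zariski_proj (toric_variety a)) A"
      and B: "closedin (subtopology zariski_proj (toric_variety a)) B" and AB: "?Z \<subseteq> A \<union> B" for A B
  proof (rule ccontr)
    assume "\<not> (?Z \<subseteq> A \<or> ?Z \<subseteq> B)"
    then obtain p q where p: "p \<in> ?Z" "p \<notin> A" and q: "q \<in> ?Z" "q \<notin> B" by blast
    have "p \<noteq> 0" "q \<noteq> 0" using p q toric_nonzero ZX by blast+
    then obtain d f where f: "f \<in> hom_poly_funs d" "\<And>y. y \<in> A \<Longrightarrow> f y = 0" "f p \<noteq> 0"
      using closedin_separate[OF closedin_subtopology_zariski[OF closedin_toric A]] p(2) by metis
    obtain e g where g: "g \<in> hom_poly_funs e" "\<And>y. y \<in> B \<Longrightarrow> g y = 0" "g q \<noteq> 0"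
      using closedin_separate[OF closedin_subtopology_zariski[OF closedin_toric B]] q(2) \<open>q \<noteq> 0\<close> by metis
    obtain t1 where t1: "t1 \<in> T" "torus_inv t1" "f (torus_pt a t1) \<noteq> 0" using clo[OF f(1,3) p(1)] by blast
    obtain t2 where t2: "t2 \<in> T" "torus_inv t2" "g (torus_pt a t2) \<noteq> 0" using clo[OF g(1,3) q(1)] by blast
    define r where "r j = [:t1 $ j, t2 $ j - t1 $ j:]" for j
    let ?t = "\<lambda>s. \<chi> j. poly (r j) s"
    have mono: "mono_pt b (?t s) = (\<chi> i. poly (\<Prod>j\<in>UNIV. r j ^ b i j) s)" for s
      by (simp add: mono_pt_def vec_eq_iff poly_prod)
    obtain P where P: "\<And>s. poly P s = f (mono_pt b (?t s))"
      using hom_along_curve[OF f(1)] unfolding mono by metis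
    obtain Q where Q: "\<And>s. poly Q s = g (mono_pt b (?t s))"
      using hom_along_curve[OF g(1)] unfolding mono by metis
    have "?t 0 = t1" "?t 1 = t2" by (simp_all add: r_def vec_eq_iff)
    then have "poly P 0 \<noteq> 0" "poly Q 1 \<noteq> 0" using P Q t1 t2 nz f(1) g(1) by metis+
    moreover have "poly (r j) 0 \<noteq> 0" for j using t1(2) by (simp add: r_def torus_inv_def)
    ultimately have "P \<noteq> 0" "Q \<noteq> 0" "\<And>j. r j \<noteq> 0" by (metis poly_0)+
    then have "P * Q * (\<Prod>j\<in>UNIV. r j) \<noteq> 0" by simp
    then obtain s where s: "poly (P * Q * (\<Prod>j\<in>UNIV. r j)) s \<noteq> 0" using poly_all_0_iff_0 by blast
    then have inv: "torus_inv (?t s)" by (simp add: torus_inv_def poly_prod)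
    moreover have "?t s \<in> T" using line[OF t1(1) t2(1), of s] by (simp add: r_def)
    ultimately have "torus_pt a (?t s) \<in> ?S" by blast
    then have "torus_pt a (?t s) \<in> A \<union> B" using SZ AB by blast
    then have "f (torus_pt a (?t s)) = 0 \<or> g (torus_pt a (?t s)) = 0" using f(2) g(2) by blast
    then have "poly P s = 0 \<or> poly Q s = 0" using P Q nz[OF inv f(1)] nz[OF inv g(1)] by simp
    then show False using s by auto
  qed
  moreover have "?Z \<subseteq> topspace (subtopology zariski_proj (toric_variety a))"
    using ZX toric_nonzero by (auto simp: topspace_zariski_proj)
  moreover have "?Z \<noteq> {}" using SZ T by blast
  ultimately show ?thesis unfolding irreducible_in_def by blast
qed

context toric_relations
begin

lemma krull_dim_toric: "krull_dim (subtopology zariski_proj X) = enat CARD('n)"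
proof (rule antisym)
  show "krull_dim (subtopology zariski_proj X) \<le> enat CARD('n)"
    unfolding krull_dim_def X_def
  proof (rule SUP_least)
    fix d assume "d \<in> {d. \<exists>Z. (\<forall>i\<le>d. closedin (subtopology zariski_proj (toric_variety a :: ('a ^ 'm) set)) (Z i) \<and>
      irreducible_in (subtopology zariski_proj (toric_variety a)) (Z i)) \<and> (\<forall>i<d. Z i \<subset> Z (Suc i))}"
    then obtain Z where Z: "\<And>i. i \<le> d \<Longrightarrow> closedin (subtopology zariski_proj (toric_variety a :: ('a ^ 'm) set)) (Z i)"
      "\<And>i. i \<le> d \<Longrightarrow> irreducible_in (subtopology zariski_proj (toric_variety a)) (Z i)"
      "\<And>i. i < d \<Longrightarrow> Z i \<subset> Z (Suc i)" by blast
    show "enat d \<le> enat CARD('n)" using toric_chain_length[where Z = Z and d = d, OF Z] by simp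
  qed
  obtain e where e: "bij_betw e {0..<CARD('n)} (UNIV :: 'n set)"
    using ex_bij_betw_nat_finite[of "UNIV :: 'n set"] by auto
  \<comment> \<open>Only the first \<open>i\<close> torus coordinates are free; the closures of
    these subtori form a chain of length \<open>CARD('n)\<close>.\<close>
  define T where "T i = {t :: 'a ^ 'n. \<forall>l. i \<le> l \<longrightarrow> l < CARD('n) \<longrightarrow> t $ e l = 1}" for i
  define Z where "Z i = zariski_proj closure_of {torus_pt a t :: 'a ^ 'm | t. torus_inv t \<and> t \<in> T i}" for i
  have "closedin (subtopology zariski_proj X) (Z i)" for i
  proof -
    have "Z i \<subseteq> X" unfolding Z_def X_def toric_variety_eq by (rule closure_of_mono) auto
    moreover have "closedin zariski_proj (Z i)" unfolding Z_def by (rule closedin_closure_of)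
    ultimately show ?thesis unfolding closedin_subtopology by (intro exI[of _ "Z i"]) auto
  qed
  moreover have "irreducible_in (subtopology zariski_proj X) (Z i)" for i
    unfolding Z_def X_def
    by (rule irreducible_torus_closure[of "\<chi> j. 1"]) (auto simp: T_def torus_inv_def)
  moreover have "Z i \<subset> Z (Suc i)" if i: "i < CARD('n)" for i
  proof
    show "Z i \<subseteq> Z (Suc i)" unfolding Z_def by (rule closure_of_mono) (auto simp: T_def)
    define p q where "p l = nat (u (e i) l)" and "q l = nat (- u (e i) l)" for l
    have pq: "u (e i) l = int (p l) - int (q l)" for l unfolding p_def q_def by simp
    have deg: "(\<Sum>l\<in>UNIV. p l) = (\<Sum>l\<in>UNIV. q l)"
    proof -
      have "int (\<Sum>l\<in>UNIV. p l) = int (\<Sum>l\<in>UNIV. q l)"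
        using u_sum[of "e i"] unfolding pq by (simp add: sum_subtractf)
      then show ?thesis by (simp only: of_nat_eq_iff)
    qed
    have rel: "(\<Sum>l\<in>UNIV. int (p l) * a l $ j) =
        (\<Sum>l\<in>UNIV. int (q l) * a l $ j) + (if j = e i then int \<delta> else 0)" for j
      using u_dual[of "e i" j] unfolding pq by (simp add: left_diff_distrib sum_subtractf split: if_splits)
    \<comment> \<open>On the torus this binomial is a unit times
      \<open>t $ e i ^ \<delta> - 1\<close>. It vanishes on the subtorus \<open>T i\<close>, but not
      where the coordinate is 2, because \<open>2 ^ \<delta>\<close> differs from 1 in
      characteristic zero.\<close>
    define f where "f z = (\<Prod>l\<in>UNIV. z $ l ^ p l) - (\<Prod>l\<in>UNIV. z $ l ^ q l)" for z :: "'a ^ 'm"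
    have hom: "f \<in> hom_poly_funs (\<Sum>l\<in>UNIV. p l)"
      unfolding f_def by (intro hom_diff hom_monom) (simp_all add: deg)
    have f: "f (torus_pt a t) = (\<Prod>j\<in>UNIV. t $ j powi (\<Sum>l\<in>UNIV. int (q l) * a l $ j)) * (t $ e i ^ \<delta> - 1)"
      if t: "torus_inv t" for t
    proof -
      have "(\<Prod>j\<in>UNIV. t $ j powi (if j = e i then int \<delta> else 0)) = (\<Prod>j\<in>UNIV. if j = e i then t $ j ^ \<delta> else 1)"
        by (rule prod.cong) auto
      then show ?thesis using t
        by (simp add: f_def torus_pt_monomial rel power_int_add torus_inv_def prod.distrib right_diff_distrib)
    qed
    define t where "t = (\<chi> j. if j = e i then 2 else (1 :: 'a))"
    have t: "torus_inv t" by (simp add: torus_inv_def t_def)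
    have inj: "e l = e i \<longleftrightarrow> l = i" if "l < CARD('n)" for l
      using e i that by (auto simp: bij_betw_def inj_on_def)
    have "t \<in> T (Suc i)" by (auto simp: T_def t_def inj)
    then have "torus_pt a t \<in> Z (Suc i)"
      using t torus_pt_nonzero[OF t] unfolding Z_def closure_zariski_proj by blast
    moreover have "torus_pt a t \<notin> Z i"
    proof
      assume "torus_pt a t \<in> Z i"
      moreover have "f y = 0" if "y \<in> {torus_pt a t :: 'a ^ 'm | t. torus_inv t \<and> t \<in> T i}" for y
        using that i by (auto simp: f T_def)
      ultimately have "f (torus_pt a t) = 0"
        using hom unfolding Z_def closure_zariski_proj by blast
      moreover have "(2 :: 'a) ^ \<delta> \<noteq> 1"
      proof -
        have "(2 :: nat) ^ \<delta> \<noteq> 1" using \<delta> by simp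
        then have "of_nat (2 ^ \<delta>) \<noteq> (of_nat 1 :: 'a)" by (simp only: of_nat_eq_iff not_False_eq_True)
        then show ?thesis by simp
      qed
      moreover have "t $ e i = 2" by (simp add: t_def)
      ultimately show False using f[OF t] t by (simp add: torus_inv_def)
    qed
    ultimately show "Z i \<noteq> Z (Suc i)" by blast
  qed
  ultimately show "enat CARD('n) \<le> krull_dim (subtopology zariski_proj X)"
    unfolding krull_dim_def by (intro SUP_upper) auto
qed

end

section \<open>Powers of the ideal of the diagonal\<close>

inductive pol2 :: "('a::field ^ 'm::finite \<Rightarrow> 'a ^ 'm \<Rightarrow> 'a) \<Rightarrow> bool" where
  left: "pol f \<Longrightarrow> pol2 (\<lambda>y z. f y)"
| right: "pol f \<Longrightarrow> pol2 (\<lambda>y z. f z)"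
| add: "pol2 f \<Longrightarrow> pol2 g \<Longrightarrow> pol2 (\<lambda>y z. f y z + g y z)"
| mult: "pol2 f \<Longrightarrow> pol2 g \<Longrightarrow> pol2 (\<lambda>y z. f y z * g y z)"

text \<open>The \<open>r\<close>-th power of the ideal of the diagonal, in the ring of polynomials in \<open>y\<close> and \<open>z\<close>.\<close>

inductive diag_power :: "nat \<Rightarrow> ('a::field ^ 'm::finite \<Rightarrow> 'a ^ 'm \<Rightarrow> 'a) \<Rightarrow> bool" where
  base: "pol2 f \<Longrightarrow> diag_power 0 f"
| add: "diag_power r f \<Longrightarrow> diag_power r g \<Longrightarrow> diag_power r (\<lambda>y z. f y z + g y z)"
| step: "diag_power r f \<Longrightarrow> diag_power (Suc r) (\<lambda>y z. f y z * (z $ l - y $ l))"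

lemma pol2_const: "pol2 (\<lambda>_ _. c)"
  by (rule pol2.left) (rule pol_const)

lemma pol2_diff_coord: "pol2 (\<lambda>y z. z $ l - y $ l)"
  using pol2.add[OF pol2.right[OF pol_nth[of l]] pol2.left[OF pol_minus[OF pol_nth[of l]]]] by simp

lemma pol2_diag: "pol2 f \<Longrightarrow> pol (\<lambda>y. f y y)"
  by (induction rule: pol2.induct) (auto intro: pol_add pol_mult)

lemma pol2_right: "pol2 f \<Longrightarrow> pol (f y)"
  by (induction rule: pol2.induct) (auto intro: pol_add pol_mult pol_const)

lemma diag_power_pol2_mult: "diag_power r f \<Longrightarrow> pol2 p \<Longrightarrow> diag_power r (\<lambda>y z. p y z * f y z)"
proof (induction rule: diag_power.induct)
  case (base f)
  then show ?case by (intro diag_power.base pol2.mult)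
next
  case (add r f g)
  then show ?case using diag_power.add[of r "\<lambda>y z. p y z * f y z" "\<lambda>y z. p y z * g y z"]
    by (simp add: distrib_left)
next
  case (step r f l)
  then show ?case using diag_power.step[of r "\<lambda>y z. p y z * f y z" l] by (simp add: mult.assoc)
qed

lemma diag_power_left_mult: "diag_power r f \<Longrightarrow> pol p \<Longrightarrow> diag_power r (\<lambda>y z. p y * f y z)"
  by (rule diag_power_pol2_mult) (auto intro: pol2.left)

lemma diag_power_scale: "diag_power r f \<Longrightarrow> diag_power r (\<lambda>y z. c * f y z)"
  by (rule diag_power_pol2_mult) (auto intro: pol2_const)

lemma diag_power_mult:
  "diag_power r f \<Longrightarrow> diag_power s g \<Longrightarrow> diag_power (r + s) (\<lambda>y z. f y z * g y z)"
proof (induction rule: diag_power.induct)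
  case (base f)
  then show ?case by (simp add: diag_power_pol2_mult)
next
  case (add r f h)
  then show ?case using diag_power.add[of "r + s" "\<lambda>y z. f y z * g y z" "\<lambda>y z. h y z * g y z"]
    by (simp add: distrib_right)
next
  case (step r f l)
  then show ?case using diag_power.step[of "r + s" "\<lambda>y z. f y z * g y z" l] by (simp add: ac_simps)
qed

lemma diag_power_mono: "diag_power n f \<Longrightarrow> r \<le> n \<Longrightarrow> diag_power r f"
proof (induction arbitrary: r rule: diag_power.induct)
  case (base f)
  then show ?case by (simp add: diag_power.base)
next
  case (add n f g)
  then show ?case by (intro diag_power.add)
next
  case (step n f l)
  show ?case
  proof (cases "r = Suc n")
    case True
    then show ?thesis using diag_power.step[OF step.hyps] by simp
  next
    case False
    then show ?thesis
      using diag_power_pol2_mult[OF step.IH[of r] pol2_diff_coord[of l]] step.prems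
      by (simp add: mult.commute)
  qed
qed

lemma diag_power_zero: "diag_power r (\<lambda>_ _. 0)"
proof (induction r)
  case (Suc r)
  then show ?case using diag_power.step[of r "\<lambda>_ _. 0"] by simp
qed (auto intro: diag_power.base pol2_const)

lemma diag_power_sum:
  "(\<And>i. i \<in> A \<Longrightarrow> diag_power r (f i)) \<Longrightarrow> diag_power r (\<lambda>y z. \<Sum>i\<in>A. f i y z)"
  by (induction A rule: infinite_finite_induct) (auto intro: diag_power_zero diag_power.add)

lemma diag_power_diff_coord: "diag_power 1 (\<lambda>y z. z $ l - y $ l)"
  using diag_power.step[OF diag_power.base[OF pol2_const[of 1]], of l] by simp

text \<open>Partial derivatives are characterized by Taylor's formula modulo the square of the ideal
  of the diagonal, which keeps both the base point \<open>y\<close> and the moving point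
  \<open>z\<close> variable.\<close>

definition gradient :: "('a::field ^ 'm::finite \<Rightarrow> 'a) \<Rightarrow> ('m \<Rightarrow> 'a ^ 'm \<Rightarrow> 'a) \<Rightarrow> bool" where
  "gradient f g \<longleftrightarrow> (\<forall>l. pol (g l)) \<and>
    diag_power 2 (\<lambda>y z. f z - f y - (\<Sum>l\<in>UNIV. g l y * (z $ l - y $ l)))"

lemma gradient_diff: "gradient f g \<Longrightarrow> diag_power 1 (\<lambda>y z. f z - f y)"
proof -
  assume g: "gradient f g"
  have "diag_power 1 (\<lambda>y z. (f z - f y - (\<Sum>l\<in>UNIV. g l y * (z $ l - y $ l))) +
      (\<Sum>l\<in>UNIV. g l y * (z $ l - y $ l)))"
    using g unfolding gradient_def
    by (intro diag_power.add diag_power_sum diag_power_left_mult diag_power_diff_coord)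
      (auto intro: diag_power_mono)
  then show ?thesis by simp
qed

lemma gradient_const: "gradient (\<lambda>_. c) (\<lambda>_ _. 0)"
  unfolding gradient_def by (auto intro: pol_const diag_power_zero)

lemma gradient_nth: "gradient (\<lambda>z. z $ i) (\<lambda>l _. if l = i then 1 else 0)"
  unfolding gradient_def sum_indicator by (auto intro: pol_const diag_power_zero)

lemma gradient_add:
  assumes "gradient f g" "gradient f' g'"
  shows "gradient (\<lambda>z. f z + f' z) (\<lambda>l y. g l y + g' l y)"
proof -
  have "diag_power 2 (\<lambda>y z. (f z - f y - (\<Sum>l\<in>UNIV. g l y * (z $ l - y $ l))) +
      (f' z - f' y - (\<Sum>l\<in>UNIV. g' l y * (z $ l - y $ l))))"
    using assms unfolding gradient_def by (intro diag_power.add) auto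
  moreover have "(f z - f y - (\<Sum>l\<in>UNIV. g l y * (z $ l - y $ l))) +
      (f' z - f' y - (\<Sum>l\<in>UNIV. g' l y * (z $ l - y $ l))) =
      f z + f' z - (f y + f' y) - (\<Sum>l\<in>UNIV. (g l y + g' l y) * (z $ l - y $ l))" for y z
    by (simp add: distrib_right sum.distrib)
  ultimately show ?thesis using assms unfolding gradient_def by (auto intro: pol_add)
qed

lemma gradient_mult:
  assumes "gradient f g" "gradient f' g'" "pol f" "pol f'"
  shows "gradient (\<lambda>z. f z * f' z) (\<lambda>l y. f y * g' l y + f' y * g l y)"
proof -
  let ?T = "\<lambda>y z. f z - f y - (\<Sum>l\<in>UNIV. g l y * (z $ l - y $ l))"
  let ?T' = "\<lambda>y z. f' z - f' y - (\<Sum>l\<in>UNIV. g' l y * (z $ l - y $ l))"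
  have "diag_power 2 (\<lambda>y z. f y * ?T' y z + (f' y * ?T y z + (f z - f y) * (f' z - f' y)))"
    using assms diag_power_mult[OF gradient_diff[OF assms(1)] gradient_diff[OF assms(2)]]
    unfolding gradient_def
    by (intro diag_power.add diag_power_left_mult) (simp_all add: numeral_2_eq_2)
  moreover have "f y * ?T' y z + (f' y * ?T y z + (f z - f y) * (f' z - f' y)) =
      f z * f' z - f y * f' y - (\<Sum>l\<in>UNIV. (f y * g' l y + f' y * g l y) * (z $ l - y $ l))" for y z
  proof -
    have "(\<Sum>l\<in>UNIV. (f y * g' l y + f' y * g l y) * (z $ l - y $ l)) =
        f y * (\<Sum>l\<in>UNIV. g' l y * (z $ l - y $ l)) + f' y * (\<Sum>l\<in>UNIV. g l y * (z $ l - y $ l))"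
      by (simp add: distrib_right sum.distrib sum_distrib_left mult.assoc)
    then show ?thesis by (simp add: algebra_simps)
  qed
  ultimately show ?thesis
    using assms unfolding gradient_def by (auto intro!: pol_add pol_mult)
qed

lemma gradient_exists: "pol f \<Longrightarrow> \<exists>g. gradient f g"
proof (induction rule: pol_induct)
  case (const c)
  show ?case using gradient_const by blast
next
  case (nth i)
  show ?case using gradient_nth by blast
next
  case (add f g)
  then show ?case using gradient_add by blast
next
  case (mult f g)
  then show ?case using gradient_mult by blast
qed

lemma pol_diff_diag: "pol f \<Longrightarrow> diag_power 1 (\<lambda>y z. f z - f y)"
  using gradient_exists gradient_diff by blast

lemma pol2_minus_diag: "pol2 f \<Longrightarrow> diag_power 1 (\<lambda>y z. f y z - f y y)"
proof (induction rule: pol2.induct)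
  case (left f)
  then show ?case by (simp add: diag_power_zero)
next
  case (right f)
  then show ?case by (rule pol_diff_diag)
next
  case (add f g)
  then show ?case using diag_power.add[OF add.IH] by (simp add: algebra_simps)
next
  case (mult f g)
  have "diag_power 1 (\<lambda>y z. g y z * (f y z - f y y) + f y y * (g y z - g y y))"
    by (intro diag_power.add diag_power_pol2_mult diag_power_left_mult mult pol2_diag)
  then show ?case by (simp add: algebra_simps)
qed

text \<open>This plays the part of membership in the square of the ideal of \<open>x\<close> in the
  polynomial ring, in a form that combines with Taylor's formula.\<close>

definition singular_at :: "'a::field ^ 'm::finite \<Rightarrow> ('a ^ 'm \<Rightarrow> 'a) \<Rightarrow> bool" where
  "singular_at x P \<longleftrightarrow> pol P \<and> P x = 0 \<and> (\<exists>g. gradient P g \<and> (\<forall>l. g l x = 0))"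

lemma singular_zero: "singular_at x (\<lambda>_. 0)"
  unfolding singular_at_def using gradient_const[of 0] by (auto intro: pol_const)

lemma singular_add: "singular_at x P \<Longrightarrow> singular_at x Q \<Longrightarrow> singular_at x (\<lambda>z. P z + Q z)"
  unfolding singular_at_def
  by (elim conjE exE, intro conjI pol_add exI, assumption, assumption, simp, rule gradient_add) auto

lemma singular_mult:
  assumes "pol R" "singular_at x P"
  shows "singular_at x (\<lambda>z. R z * P z)"
proof -
  obtain g h where "gradient P g" "\<forall>l. g l x = 0" "gradient R h"
    using assms gradient_exists unfolding singular_at_def by blast
  then show ?thesis
    using assms gradient_mult[of R h P g] unfolding singular_at_def by (fastforce intro: pol_mult)
qed

lemma singular_product:
  assumes "pol P" "pol Q" "P x = 0" "Q x = 0"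
  shows "singular_at x (\<lambda>z. P z * Q z)"
proof -
  obtain g h where "gradient P g" "gradient Q h"
    using assms gradient_exists by blast
  then show ?thesis
    using assms gradient_mult[of P g Q h] unfolding singular_at_def by (fastforce intro: pol_mult)
qed

text \<open>Denominators are cleared by \<open>?H\<close>. Its second factor makes both sides vanish
  where the fractions for \<open>f\<close> and \<open>s\<close> are undefined and their values
  arbitrary, so that the equation holds on all of \<open>X\<close>.\<close>

lemma max_square_singular:
  assumes x: "x \<in> X" and s: "s \<in> max_square X x"
  shows "\<exists>Q P. pol Q \<and> Q x \<noteq> 0 \<and> singular_at x P \<and> (\<forall>z\<in>X. Q z * s z = P z)"
  using s unfolding max_square_def
proof (induction rule: ideal_mult_induct)
  case zero
  show ?case by (intro exI[of _ "\<lambda>_. 1"] exI[of _ "\<lambda>_. 0"]) (auto intro: pol_const singular_zero)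
next
  case (step f s g)
  obtain Q P where QP: "pol Q" "Q x \<noteq> 0" "singular_at x P" "\<And>z. z \<in> X \<Longrightarrow> Q z * g z = P z"
    using step.IH by blast
  obtain e F G where 1: "F \<in> hom_poly_funs (0 + e)" "G \<in> hom_poly_funs e" "G x \<noteq> 0"
    "\<And>z. z \<in> X \<Longrightarrow> G z \<noteq> 0 \<Longrightarrow> f z = F z / G z"
    using stalkE[OF max_ideal_stalk[OF step.hyps(1)]] by metis
  obtain e' F' G' where 2: "F' \<in> hom_poly_funs (0 + e')" "G' \<in> hom_poly_funs e'" "G' x \<noteq> 0"
    "\<And>z. z \<in> X \<Longrightarrow> G' z \<noteq> 0 \<Longrightarrow> s z = F' z / G' z"
    using stalkE[OF max_ideal_stalk[OF step.hyps(2)]] by metis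
  have "f x = 0" "s x = 0" using step.hyps by (auto simp: max_ideal_def)
  then have F0: "F x = 0" "F' x = 0" using 1(3,4) 2(3,4) x by auto
  note p = hom_imp_pol[OF 1(1)] hom_imp_pol[OF 1(2)] hom_imp_pol[OF 2(1)] hom_imp_pol[OF 2(2)]
  let ?H = "\<lambda>z. G z * G' z"
  show ?case
  proof (intro exI conjI ballI)
    show "pol (\<lambda>z. Q z * (?H z * ?H z))" by (intro pol_mult QP p)
    show "Q x * (?H x * ?H x) \<noteq> 0" using QP 1 2 by simp
    show "singular_at x (\<lambda>z. (?H z * ?H z) * P z + (?H z * Q z) * (F z * F' z))"
      by (intro singular_add singular_mult singular_product pol_mult QP p F0)
    fix z assume z: "z \<in> X"
    show "Q z * (?H z * ?H z) * (g z + f z * s z) = (?H z * ?H z) * P z + (?H z * Q z) * (F z * F' z)"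
    proof (cases "?H z = 0")
      case False
      then have "F z = G z * f z" "F' z = G' z * s z" using 1(4)[OF z] 2(4)[OF z] by auto
      then show ?thesis using QP(4)[OF z, symmetric] by (simp add: algebra_simps)
    qed auto
  qed
qed

section \<open>Cramer's rule without division\<close>

lemma det_nonzero_iff:
  fixes A :: "'a::field ^ 'm::finite ^ 'm"
  shows "det A \<noteq> 0 \<longleftrightarrow> (\<forall>v. A *v v = 0 \<longrightarrow> v = 0)"
  unfolding invertible_det_nz[symmetric] invertible_left_inverse matrix_left_invertible_ker ..

text \<open>The entry \<open>(l, i)\<close> of the adjugate matrix. It is polynomial in the entries
  of \<open>A\<close>, so it also applies to matrices that depend polynomially on a point.\<close>

definition cofactor_col :: "'a::comm_ring_1 ^ 'm::finite ^ 'm \<Rightarrow> 'm \<Rightarrow> 'm \<Rightarrow> 'a" where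
  "cofactor_col A l i = det (\<chi> r s. if s = l then (if r = i then 1 else 0) else A $ r $ s)"

lemma det_replace_col:
  fixes A :: "'a::field ^ 'm::finite ^ 'm"
  shows "det (\<chi> r s. if s = l then b r else A $ r $ s) = (\<Sum>i\<in>UNIV. b i * cofactor_col A l i)"
proof -
  have tr: "det (\<chi> r s. if s = l then b r else A $ r $ s) =
      det (\<chi> s. if s = l then (\<chi> r. b r) else (\<chi> r. A $ r $ s))" for b :: "'m \<Rightarrow> 'a"
  proof -
    have "transpose (\<chi> r s. if s = l then b r else A $ r $ s) =
        (\<chi> s. if s = l then (\<chi> r. b r) else (\<chi> r. A $ r $ s))"
      by (simp add: transpose_def vec_eq_iff)
    then show ?thesis using det_transpose[of "\<chi> r s. if s = l then b r else A $ r $ s"] by simp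
  qed
  have b: "(\<chi> r. b r) = (\<Sum>i\<in>UNIV. b i *s axis i 1)"
  proof -
    have "(\<Sum>i\<in>UNIV. b i * axis i 1 $ r) = b r" for r
    proof -
      have "(\<Sum>i\<in>UNIV. b i * axis i 1 $ r) = (\<Sum>i\<in>UNIV. if i = r then b i else 0)"
        by (rule sum.cong) (auto simp: axis_def)
      then show ?thesis by simp
    qed
    then show ?thesis by (simp add: vec_eq_iff)
  qed
  have ax: "(\<chi> r. if r = i then 1 else 0) = axis i (1 :: 'a)" for i :: 'm
    by (auto simp: axis_def vec_eq_iff)
  have "det (\<chi> s. if s = l then (\<Sum>i\<in>UNIV. b i *s axis i 1) else (\<chi> r. A $ r $ s)) =
      (\<Sum>i\<in>UNIV. det (\<chi> s. if s = l then b i *s axis i 1 else (\<chi> r. A $ r $ s)))"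
    by (rule det_linear_row_sum) simp
  also have "\<dots> = (\<Sum>i\<in>UNIV. b i * cofactor_col A l i)"
    by (simp only: det_row_mul cofactor_col_def tr ax)
  finally show ?thesis unfolding tr b .
qed

lemma cramer_expand:
  fixes A :: "'a::field ^ 'm::finite ^ 'm"
  shows "det A * v $ l = (\<Sum>i\<in>UNIV. (A *v v) $ i * cofactor_col A l i)"
  using cramer_lemma[where k = l and A = A and x = v] unfolding det_replace_col[of l "\<lambda>i. (A *v v) $ i" A]
  by (simp add: mult.commute)

lemma pol_cofactor_col:
  assumes "\<And>r s. pol (\<lambda>x. A x $ r $ s)"
  shows "pol (\<lambda>x. cofactor_col (A x) l i)"
  unfolding cofactor_col_def by (intro pol_det) (auto intro!: pol_const pol_if assms)

section \<open>Jets in the neighbourhood of a smooth point\<close>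

text \<open>Up to the factor \<open>D y\<close>, the coordinate differences in \<open>J\<close>
  generate all others modulo the square of the ideal of the diagonal. The coordinates in
  \<open>J\<close> are thus controlled as local parameters at all \<open>y\<close> with
  \<open>D y\<close> nonzero simultaneously.\<close>

locale reduction =
  fixes Ch :: "('a::field ^ 'm::finite) set" and J :: "'m set"
    and D :: "'a ^ 'm \<Rightarrow> 'a" and C :: "'m \<Rightarrow> 'm \<Rightarrow> 'a ^ 'm \<Rightarrow> 'a"
    and H :: "'m \<Rightarrow> 'a ^ 'm \<Rightarrow> 'a ^ 'm \<Rightarrow> 'a"
  assumes pol_D: "pol D" and pol_C: "\<And>l j. pol (C l j)" and H: "\<And>l. diag_power 2 (H l)"
    and reduce: "\<And>l y z. y \<in> Ch \<Longrightarrow> z \<in> Ch \<Longrightarrow>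
      D y * (z $ l - y $ l) = (\<Sum>j\<in>J. C l j y * (z $ j - y $ j)) + H l y z"
begin

definition monomial :: "'m multiset \<Rightarrow> 'a ^ 'm \<Rightarrow> 'a ^ 'm \<Rightarrow> 'a" where
  "monomial M y z = (\<Prod>j\<in>#M. z $ j - y $ j)"

lemma diag_power_monomial: "diag_power (size M) (monomial M)"
proof (induction M)
  case empty
  then show ?case by (simp add: monomial_def diag_power.base pol2_const)
next
  case (add j M)
  have "monomial (add_mset j M) = (\<lambda>y z. monomial M y z * (z $ j - y $ j))"
    by (simp add: monomial_def fun_eq_iff mult.commute)
  then show ?case using diag_power.step[OF add, of j] by simp
qed

definition msets_eq :: "nat \<Rightarrow> 'm multiset set" where
  "msets_eq r = {M. set_mset M \<subseteq> J \<and> size M = r}"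

lemma finite_msets_eq: "finite (msets_eq r)"
  by (rule finite_subset[OF _ conjunct1[OF card_msets[OF finite[of J], of r]]])
    (auto simp: msets_eq_def msets_def)

text \<open>The leading form of degree \<open>r\<close> is expressed in the differences of
  \<open>J\<close>, with coefficients polynomial in the base point; each use of
  \<open>reduce\<close> costs one factor \<open>D y\<close>.\<close>

lemma leading_part:
  "diag_power r f \<Longrightarrow> \<exists>K \<rho> g. (\<forall>M. pol (\<rho> M)) \<and> diag_power (Suc r) g \<and>
    (\<forall>y\<in>Ch. \<forall>z\<in>Ch. D y ^ K * f y z = (\<Sum>M\<in>msets_eq r. \<rho> M y * monomial M y z) + g y z)"
proof (induction rule: diag_power.induct)
  case (base f)
  have "msets_eq 0 = {{#}}" by (auto simp: msets_eq_def)
  then show ?case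
    by (intro exI[of _ 0] exI[of _ "\<lambda>_ y. f y y"] exI[of _ "\<lambda>y z. f y z - f y y"])
      (use pol2_minus_diag[OF base] pol2_diag[OF base] in \<open>simp add: monomial_def\<close>)
next
  case (add r f f')
  obtain K \<rho> g where 1: "\<And>M. pol (\<rho> M)" "diag_power (Suc r) g"
    "\<And>y z. y \<in> Ch \<Longrightarrow> z \<in> Ch \<Longrightarrow> D y ^ K * f y z = (\<Sum>M\<in>msets_eq r. \<rho> M y * monomial M y z) + g y z"
    using add.IH(1) by blast
  obtain K' \<rho>' g' where 2: "\<And>M. pol (\<rho>' M)" "diag_power (Suc r) g'"
    "\<And>y z. y \<in> Ch \<Longrightarrow> z \<in> Ch \<Longrightarrow> D y ^ K' * f' y z = (\<Sum>M\<in>msets_eq r. \<rho>' M y * monomial M y z) + g' y z"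
    using add.IH(2) by blast
  show ?case
  proof (intro exI conjI allI ballI)
    fix M
    show "pol (\<lambda>y. D y ^ K' * \<rho> M y + D y ^ K * \<rho>' M y)" by (intro pol_add pol_mult pol_power pol_D 1 2)
    show "diag_power (Suc r) (\<lambda>y z. D y ^ K' * g y z + D y ^ K * g' y z)"
      by (intro diag_power.add diag_power_left_mult pol_power pol_D 1 2)
    fix y z assume yz: "y \<in> Ch" "z \<in> Ch"
    have "D y ^ (K + K') * (f y z + f' y z) = D y ^ K' * (D y ^ K * f y z) + D y ^ K * (D y ^ K' * f' y z)"
      by (simp add: power_add algebra_simps)
    then show "D y ^ (K + K') * (f y z + f' y z) =
        (\<Sum>M\<in>msets_eq r. (D y ^ K' * \<rho> M y + D y ^ K * \<rho>' M y) * monomial M y z) +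
        (D y ^ K' * g y z + D y ^ K * g' y z)"
      unfolding 1(3)[OF yz] 2(3)[OF yz] by (simp add: algebra_simps sum.distrib sum_distrib_left)
  qed
next
  case (step r f l)
  obtain K \<rho> g where 1: "\<And>M. pol (\<rho> M)" "diag_power (Suc r) g"
    "\<And>y z. y \<in> Ch \<Longrightarrow> z \<in> Ch \<Longrightarrow> D y ^ K * f y z = (\<Sum>M\<in>msets_eq r. \<rho> M y * monomial M y z) + g y z"
    using step.IH by blast
  \<comment> \<open>The product of the old leading form with the reduced new difference yields
    \<open>M\<close> once for every way of splitting off one variable; these ways are collected
    here.\<close>
  let ?P = "\<lambda>M. {p \<in> msets_eq r \<times> J. add_mset (snd p) (fst p) = M}"
  define \<rho>' where "\<rho>' M y = (\<Sum>p\<in>?P M. \<rho> (fst p) y * C l (snd p) y)" for M y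
  define g' where "g' y z = (\<Sum>M\<in>msets_eq r. \<rho> M y * (monomial M y z * H l y z)) +
      D y * (g y z * (z $ l - y $ l))" for y z
  show ?case
  proof (intro exI conjI allI ballI)
    fix M show "pol (\<rho>' M)" unfolding \<rho>'_def by (intro pol_sum pol_mult 1 pol_C)
    have "diag_power (Suc (Suc r)) (\<lambda>y z. monomial M y z * H l y z)" if "M \<in> msets_eq r" for M
      using diag_power_mult[OF diag_power_monomial H, of M l] that by (simp add: msets_eq_def)
    moreover have "diag_power (Suc (Suc r)) (\<lambda>y z. g y z * (z $ l - y $ l))"
      by (rule diag_power.step) (rule 1)
    ultimately show "diag_power (Suc (Suc r)) g'"
      unfolding g'_def by (intro diag_power.add diag_power_sum diag_power_left_mult 1 pol_D)
    fix y z assume yz: "y \<in> Ch" "z \<in> Ch"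
    have "D y ^ Suc K * (f y z * (z $ l - y $ l)) = (D y ^ K * f y z) * (D y * (z $ l - y $ l))"
      by (simp add: ac_simps)
    also have "\<dots> = (\<Sum>M\<in>msets_eq r. \<rho> M y * monomial M y z) * (D y * (z $ l - y $ l)) +
        D y * (g y z * (z $ l - y $ l))"
      unfolding 1(3)[OF yz] by (simp add: algebra_simps)
    also have "(\<Sum>M\<in>msets_eq r. \<rho> M y * monomial M y z) * (D y * (z $ l - y $ l)) =
        (\<Sum>M\<in>msets_eq r. \<Sum>j\<in>J. (\<rho> M y * C l j y) * monomial (add_mset j M) y z) +
        (\<Sum>M\<in>msets_eq r. \<rho> M y * (monomial M y z * H l y z))"
      unfolding reduce[OF yz] monomial_def
      by (simp add: sum_distrib_left sum_distrib_right distrib_left sum.distrib ac_simps)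
    also have "(\<Sum>M\<in>msets_eq r. \<Sum>j\<in>J. (\<rho> M y * C l j y) * monomial (add_mset j M) y z) =
        (\<Sum>p\<in>msets_eq r \<times> J. (\<rho> (fst p) y * C l (snd p) y) * monomial (add_mset (snd p) (fst p)) y z)"
      by (simp add: sum.cartesian_product split_def)
    also have "\<dots> = (\<Sum>M\<in>msets_eq (Suc r). \<Sum>p\<in>?P M.
        (\<rho> (fst p) y * C l (snd p) y) * monomial (add_mset (snd p) (fst p)) y z)"
      by (intro sum.group[symmetric] finite_cartesian_product finite_msets_eq finite)
        (auto simp: msets_eq_def)
    also have "\<dots> = (\<Sum>M\<in>msets_eq (Suc r). \<rho>' M y * monomial M y z)"
      unfolding \<rho>'_def sum_distrib_right by (intro sum.cong refl) auto
    finally show "D y ^ Suc K * (f y z * (z $ l - y $ l)) =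
        (\<Sum>M\<in>msets_eq (Suc r). \<rho>' M y * monomial M y z) + g' y z"
      by (simp add: g'_def add.assoc)
  qed
qed

text \<open>Downward induction on \<open>r\<close>: splitting off the leading form leaves a
  remainder one power deeper, and at \<open>Suc k\<close> everything is remainder.\<close>

lemma taylor_expansion:
  assumes "r \<le> Suc k" "diag_power r f"
  shows "\<exists>K \<rho> g. (\<forall>M. pol (\<rho> M)) \<and> diag_power (Suc k) g \<and>
    (\<forall>y\<in>Ch. \<forall>z\<in>Ch. D y ^ K * f y z = (\<Sum>M\<in>msets J k. \<rho> M y * monomial M y z) + g y z)"
  using assms
proof (induction r arbitrary: f rule: inc_induct)
  case base
  then show ?case
    by (intro exI[of _ 0] exI[of _ "\<lambda>_ _. 0"] exI[of _ f]) (simp add: pol_const)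
next
  case (step r)
  obtain K \<rho> g where 1: "\<And>M. pol (\<rho> M)" "diag_power (Suc r) g"
    "\<And>y z. y \<in> Ch \<Longrightarrow> z \<in> Ch \<Longrightarrow> D y ^ K * f y z = (\<Sum>M\<in>msets_eq r. \<rho> M y * monomial M y z) + g y z"
    using leading_part[OF step.prems] by blast
  obtain K' \<rho>' g' where 2: "\<And>M. pol (\<rho>' M)" "diag_power (Suc k) g'"
    "\<And>y z. y \<in> Ch \<Longrightarrow> z \<in> Ch \<Longrightarrow> D y ^ K' * g y z = (\<Sum>M\<in>msets J k. \<rho>' M y * monomial M y z) + g' y z"
    using step.IH[OF 1(2)] by blast
  have sub: "msets_eq r \<subseteq> msets J k" using step.hyps by (auto simp: msets_eq_def msets_def)
  let ?s = "\<lambda>M y. if M \<in> msets_eq r then D y ^ K' * \<rho> M y else 0"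
  show ?case
  proof (intro exI conjI allI ballI)
    fix M show "pol (\<lambda>y. ?s M y + \<rho>' M y)"
      by (intro pol_add pol_if pol_mult pol_power pol_D pol_const 1 2)
    show "diag_power (Suc k) g'" by (rule 2)
    fix y z assume yz: "y \<in> Ch" "z \<in> Ch"
    have "(\<Sum>M\<in>msets_eq r. D y ^ K' * \<rho> M y * monomial M y z) = (\<Sum>M\<in>msets J k. ?s M y * monomial M y z)"
      by (rule sum.mono_neutral_cong_left) (use sub card_msets[of J k] in auto)
    moreover have "D y ^ (K + K') * f y z = D y ^ K' * (D y ^ K * f y z)"
      by (simp add: power_add algebra_simps)
    ultimately show "D y ^ (K + K') * f y z = (\<Sum>M\<in>msets J k. (?s M y + \<rho>' M y) * monomial M y z) + g' y z"
      using 2(3)[OF yz] unfolding 1(3)[OF yz]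
      by (simp add: distrib_left distrib_right sum.distrib sum_distrib_left mult.assoc add.assoc)
  qed
qed

text \<open>The expansions of the individual coordinates need different powers of \<open>D\<close>;
  the sum of the exponents gives one common denominator \<open>E\<close>.\<close>

lemma coordinate_expansion:
  "\<exists>E \<rho> g. pol E \<and> (\<forall>y. D y \<noteq> 0 \<longrightarrow> E y \<noteq> 0) \<and> (\<forall>M i. pol (\<rho> M i)) \<and> (\<forall>i. diag_power (Suc k) (g i)) \<and>
    (\<forall>i. \<forall>y\<in>Ch. \<forall>z\<in>Ch. E y * z $ i = (\<Sum>M\<in>msets J k. \<rho> M i y * monomial M y z) + g i y z)"
proof -
  have "\<forall>i. \<exists>w. (\<forall>M. pol (fst (snd w) M)) \<and> diag_power (Suc k) (snd (snd w)) \<and>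
    (\<forall>y\<in>Ch. \<forall>z\<in>Ch. D y ^ fst w * z $ i =
      (\<Sum>M\<in>msets J k. fst (snd w) M y * monomial M y z) + snd (snd w) y z)"
  proof
    fix i
    obtain K \<rho> g where "\<forall>M. pol (\<rho> M)" "diag_power (Suc k) g"
      "\<forall>y\<in>Ch. \<forall>z\<in>Ch. D y ^ K * z $ i = (\<Sum>M\<in>msets J k. \<rho> M y * monomial M y z) + g y z"
      using taylor_expansion[of 0 k, OF _ diag_power.base[OF pol2.right[OF pol_nth[of i]]]] by auto
    then show "\<exists>w. (\<forall>M. pol (fst (snd w) M)) \<and> diag_power (Suc k) (snd (snd w)) \<and>
      (\<forall>y\<in>Ch. \<forall>z\<in>Ch. D y ^ fst w * z $ i =
        (\<Sum>M\<in>msets J k. fst (snd w) M y * monomial M y z) + snd (snd w) y z)"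
      by (intro exI[of _ "(K, \<rho>, g)"]) simp
  qed
  from choice[OF this] obtain w where w: "\<And>i M. pol (fst (snd (w i)) M)"
    "\<And>i. diag_power (Suc k) (snd (snd (w i)))"
    "\<And>i y z. y \<in> Ch \<Longrightarrow> z \<in> Ch \<Longrightarrow> D y ^ fst (w i) * z $ i =
      (\<Sum>M\<in>msets J k. fst (snd (w i)) M y * monomial M y z) + snd (snd (w i)) y z" by blast
  define K where "K i = (\<Sum>l\<in>UNIV - {i}. fst (w l))" for i
  show ?thesis
  proof (intro exI conjI allI ballI impI)
    show "pol (\<lambda>y. D y ^ (\<Sum>l\<in>UNIV. fst (w l)))" by (intro pol_power pol_D)
    show "D y ^ (\<Sum>l\<in>UNIV. fst (w l)) \<noteq> 0" if "D y \<noteq> 0" for y using that by simp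
    show "pol (\<lambda>y. D y ^ K i * fst (snd (w i)) M y)" for M i by (intro pol_mult pol_power pol_D w)
    show "diag_power (Suc k) (\<lambda>y z. D y ^ K i * snd (snd (w i)) y z)" for i
      by (intro diag_power_left_mult pol_power pol_D w)
    fix i y z assume yz: "y \<in> Ch" "z \<in> Ch"
    have "(\<Sum>l\<in>UNIV. fst (w l)) = fst (w i) + K i" unfolding K_def by (rule sum.remove) auto
    then have "D y ^ (\<Sum>l\<in>UNIV. fst (w l)) * z $ i = D y ^ K i * (D y ^ fst (w i) * z $ i)"
      by (simp add: power_add ac_simps)
    then show "D y ^ (\<Sum>l\<in>UNIV. fst (w l)) * z $ i =
        (\<Sum>M\<in>msets J k. D y ^ K i * fst (snd (w i)) M y * monomial M y z) + D y ^ K i * snd (snd (w i)) y z"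
      unfolding w(3)[OF yz] by (simp add: distrib_left sum_distrib_left mult.assoc)
  qed
qed

end

locale cotangent_chart =
  fixes X :: "('a::field ^ 'm::finite) set" and x :: "'a ^ 'm" and b :: 'm and J :: "'m set"
    and lam :: "'m \<Rightarrow> 'm \<Rightarrow> 'a"
  assumes x: "x \<in> X" and xb: "x $ b \<noteq> 0" and scale: "\<And>y c. y \<in> X \<Longrightarrow> c \<noteq> 0 \<Longrightarrow> c *s y \<in> X"
    and span: "\<And>i. (\<lambda>z. coord_diff b x i z - (\<Sum>j\<in>J. lam i j * coord_diff b x j z)) \<in> max_square X x"
begin

text \<open>A slice of the cone containing exactly one representative of each point of
  \<open>X\<close> whose \<open>b\<close>-th coordinate is nonzero; differences of coordinates make
  sense on it.\<close>

definition chart :: "('a ^ 'm) set" where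
  "chart = {z \<in> X. z $ b = x $ b}"

text \<open>Clearing denominators in the spanning relation for the coordinate \<open>i\<close> gives
  a polynomial \<open>R\<close> that vanishes on the chart and whose gradient at \<open>x\<close> is
  \<open>q\<close> times that of the linear relation. Taylor's formula for \<open>R\<close> between
  two points of the chart leaves the linear part and a remainder in the square of the ideal of the
  diagonal.\<close>

lemma relation:
  "\<exists>N h q. (\<forall>l. pol (N l)) \<and> diag_power 2 h \<and> q \<noteq> 0 \<and>
    (\<forall>y\<in>chart. \<forall>z\<in>chart. (\<Sum>l\<in>UNIV. N l y * (z $ l - y $ l)) = h y z) \<and>
    (\<forall>l. N l x = q * ((if l = i then 1 else 0) - (if l \<in> J then lam i l else 0)))"
proof -
  obtain Q P where QP: "pol Q" "Q x \<noteq> 0" "singular_at x P"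
    "\<And>z. z \<in> X \<Longrightarrow> Q z * (coord_diff b x i z - (\<Sum>j\<in>J. lam i j * coord_diff b x j z)) = P z"
    using max_square_singular[OF x span[of i]] by blast
  define L where "L z = (z $ i - x $ i) - (\<Sum>j\<in>J. lam i j * (z $ j - x $ j))" for z
  define gL where "gL l = (if l = i then 1 else 0) - (if l \<in> J then lam i l else 0)" for l
  have "(\<Sum>l\<in>UNIV. gL l * (z $ l - y $ l)) = L z - L y" for y z
  proof -
    have "gL l * (z $ l - y $ l) = (if l = i then z $ l - y $ l else 0) - (if l \<in> J then lam i l * (z $ l - y $ l) else 0)" for l
      by (simp add: gL_def left_diff_distrib)
    then have "(\<Sum>l\<in>UNIV. gL l * (z $ l - y $ l)) = (z $ i - y $ i) - (\<Sum>l\<in>J. lam i l * (z $ l - y $ l))"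
      by (simp add: sum_subtractf sum.If_cases)
    then show ?thesis by (simp add: L_def right_diff_distrib sum_subtractf)
  qed
  then have gradL: "gradient L (\<lambda>l _. gL l)"
    unfolding gradient_def by (simp add: pol_const diag_power_zero)
  have polL: "pol L" unfolding L_def by (intro pol_diff pol_nth pol_const pol_sum pol_mult)
  obtain gQ where gQ: "gradient Q gQ" using gradient_exists[OF QP(1)] by blast
  obtain gP where gP: "gradient P gP" "\<And>l. gP l x = 0" and P: "pol P" "P x = 0"
    using QP(3) unfolding singular_at_def by blast
  define R where "R z = Q z * L z + (- x $ b) * P z" for z
  define N where "N l y = (Q y * gL l + L y * gQ l y) + ((- x $ b) * gP l y + P y * 0)" for l y
  have grad: "gradient R N"
    unfolding R_def N_def by (intro gradient_add gradient_mult gQ gradL gP gradient_const QP polL P pol_const)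
  have R0: "R z = 0" if z: "z \<in> chart" for z
  proof -
    have zX: "z \<in> X" and zb: "z $ b = x $ b" using z by (auto simp: chart_def)
    have "x $ b * coord_diff b x j z = z $ j - x $ j" for j
      using xb by (simp add: coord_diff_def zb diff_divide_distrib[symmetric])
    then have "L z = x $ b * coord_diff b x i z - (\<Sum>j\<in>J. lam i j * (x $ b * coord_diff b x j z))"
      by (simp add: L_def)
    then have "L z = x $ b * (coord_diff b x i z - (\<Sum>j\<in>J. lam i j * coord_diff b x j z))"
      by (simp add: right_diff_distrib sum_distrib_left ac_simps)
    then show ?thesis using QP(4)[OF zX] by (simp add: R_def mult.left_commute)
  qed
  show ?thesis
  proof (intro exI conjI allI ballI)
    show "pol (N l)" for l using grad by (simp add: gradient_def)
    show "diag_power 2 (\<lambda>y z. -1 * (R z - R y - (\<Sum>l\<in>UNIV. N l y * (z $ l - y $ l))))"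
      using grad by (intro diag_power_scale) (simp add: gradient_def)
    show "Q x \<noteq> 0" by (rule QP)
    show "(\<Sum>l\<in>UNIV. N l y * (z $ l - y $ l)) = -1 * (R z - R y - (\<Sum>l\<in>UNIV. N l y * (z $ l - y $ l)))"
      if "y \<in> chart" "z \<in> chart" for y z using R0 that by simp
    show "N l x = Q x * ((if l = i then 1 else 0) - (if l \<in> J then lam i l else 0))" for l
      by (simp add: N_def gL_def gP P L_def)
  qed
qed

text \<open>The relations that express all coordinates by those in \<open>J\<close> modulo \<open>\<mm>\<^sub>x\<^sup>2\<close> are differentiated, and
  the resulting linear system for the differences \<open>z\<^sub>l - y\<^sub>l\<close> is solved by Cramer's rule.\<close>

lemma elimination: "\<exists>D C H. reduction chart J D C H \<and> D x \<noteq> 0"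
proof -
  have "\<forall>i. \<exists>w. (\<forall>l. pol (fst w l)) \<and> diag_power 2 (fst (snd w)) \<and> snd (snd w) \<noteq> 0 \<and>
    (\<forall>y\<in>chart. \<forall>z\<in>chart. (\<Sum>l\<in>UNIV. fst w l y * (z $ l - y $ l)) = fst (snd w) y z) \<and>
    (\<forall>l. fst w l x = snd (snd w) * ((if l = i then 1 else 0) - (if l \<in> J then lam i l else 0)))"
  proof
    fix i
    obtain N h q where "\<forall>l. pol (N l)" "diag_power 2 h" "q \<noteq> 0"
      "\<forall>y\<in>chart. \<forall>z\<in>chart. (\<Sum>l\<in>UNIV. N l y * (z $ l - y $ l)) = h y z"
      "\<forall>l. N l x = q * ((if l = i then 1 else 0) - (if l \<in> J then lam i l else 0))"
      using relation[of i] by blast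
    then show "\<exists>w. (\<forall>l. pol (fst w l)) \<and> diag_power 2 (fst (snd w)) \<and> snd (snd w) \<noteq> 0 \<and>
      (\<forall>y\<in>chart. \<forall>z\<in>chart. (\<Sum>l\<in>UNIV. fst w l y * (z $ l - y $ l)) = fst (snd w) y z) \<and>
      (\<forall>l. fst w l x = snd (snd w) * ((if l = i then 1 else 0) - (if l \<in> J then lam i l else 0)))"
      by (intro exI[of _ "(N, h, q)"]) simp
  qed
  from choice[OF this] obtain w where w: "\<And>i l. pol (fst (w i) l)" "\<And>i. diag_power 2 (fst (snd (w i)))"
    "\<And>i. snd (snd (w i)) \<noteq> 0"
    "\<And>i y z. y \<in> chart \<Longrightarrow> z \<in> chart \<Longrightarrow>
      (\<Sum>l\<in>UNIV. fst (w i) l y * (z $ l - y $ l)) = fst (snd (w i)) y z"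
    "\<And>i l. fst (w i) l x = snd (snd (w i)) * ((if l = i then 1 else 0) - (if l \<in> J then lam i l else 0))"
    by blast
  \<comment> \<open>Rows in \<open>J\<close> return the free differences, the others hold the
    gradients of the relations. At \<open>x\<close>, once the entries of a kernel vector in
    \<open>J\<close> vanish, every other row is a nonzero multiple of a unit row, so the matrix is
    invertible there.\<close>
  define A where "A y = (\<chi> r s. if r \<in> J then (if s = r then 1 else 0) else fst (w r) s y)" for y
  have polA: "pol (\<lambda>y. A y $ r $ s)" for r s
    unfolding A_def by (auto intro!: pol_if pol_const w)
  have J_row: "(A y *v v) $ r = v $ r" if "r \<in> J" for y v r
    using that by (simp add: A_def matrix_vector_mult_def sum_indicator)
  have "det (A x) \<noteq> 0"
    unfolding det_nonzero_iff
  proof (intro allI impI)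
    fix v assume v: "A x *v v = 0"
    have vJ: "v $ r = 0" if "r \<in> J" for r using J_row[OF that, of x v] v by simp
    have "v $ r = 0" if r: "r \<notin> J" for r
    proof -
      have "fst (w r) s x * v $ s = (if s = r then snd (snd (w r)) * v $ s else 0)" for s
        using vJ[of s] r by (cases "s \<in> J") (auto simp: w(5))
      then have "(A x *v v) $ r = (\<Sum>s\<in>UNIV. if s = r then snd (snd (w r)) * v $ s else 0)"
        using r by (simp add: matrix_vector_mult_def A_def)
      then show ?thesis using v w(3)[of r] by simp
    qed
    then show "v = 0" using vJ by (auto simp: vec_eq_iff)
  qed
  moreover have "reduction chart J (\<lambda>y. det (A y)) (\<lambda>l j y. cofactor_col (A y) l j)
     (\<lambda>l y z. \<Sum>r\<in>-J. cofactor_col (A y) l r * fst (snd (w r)) y z)"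
  proof
    show "pol (\<lambda>y. det (A y))" by (intro pol_det polA)
    show "pol (\<lambda>y. cofactor_col (A y) l j)" for l j by (intro pol_cofactor_col polA)
    show "diag_power 2 (\<lambda>y z. \<Sum>r\<in>-J. cofactor_col (A y) l r * fst (snd (w r)) y z)" for l
      by (intro diag_power_sum diag_power_left_mult pol_cofactor_col polA w)
    fix l y z assume yz: "y \<in> chart" "z \<in> chart"
    have nJ: "(A y *v (z - y)) $ r = fst (snd (w r)) y z" if "r \<notin> J" for r
      using w(4)[OF yz, of r] that by (simp add: A_def matrix_vector_mult_def)
    have "det (A y) * (z $ l - y $ l) = (\<Sum>r\<in>UNIV. (A y *v (z - y)) $ r * cofactor_col (A y) l r)"
      using cramer_expand[of "A y" "z - y" l] by simp
    also have "\<dots> = (\<Sum>r\<in>J. (A y *v (z - y)) $ r * cofactor_col (A y) l r) +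
        (\<Sum>r\<in>-J. (A y *v (z - y)) $ r * cofactor_col (A y) l r)"
      by (subst sum.union_disjoint[symmetric]) auto
    finally show "det (A y) * (z $ l - y $ l) = (\<Sum>j\<in>J. cofactor_col (A y) l j * (z $ j - y $ j)) +
        (\<Sum>r\<in>-J. cofactor_col (A y) l r * fst (snd (w r)) y z)"
      by (simp add: J_row nJ mult.commute)
  qed
  ultimately show ?thesis by blast
qed

text \<open>With \<open>y\<close> fixed, each generator of the ideal of the diagonal becomes an
  element of the maximal ideal of \<open>y\<close>. Rescaling \<open>z\<close> to the chart gives a
  function of degree zero, and the factor \<open>z $ b\<close> makes it a section of the line
  bundle.\<close>

lemma diag_power_max_power:
  assumes "diag_power r f" and y: "y \<in> chart"
  shows "(\<lambda>z. z $ b * f y ((x $ b / z $ b) *s z)) \<in> max_power X y r"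
  using assms(1)
proof (induction rule: diag_power.induct)
  case (base f)
  have yb: "y $ b \<noteq> 0" using y xb by (simp add: chart_def)
  have "pol (\<lambda>w. f y (x $ b *s w))"
    by (rule pol_compose[OF pol2_right[OF base]]) (auto intro!: pol_mult pol_const pol_nth)
  then have "(\<lambda>z. f y (x $ b *s ((1 / z $ b) *s z))) \<in> stalk X y 0"
    using stalk_pol_linear[OF _ yb] by blast
  from stalk_mult0[OF this stalk_hom[OF hom_nth[of b]]] show ?case
    by (simp add: max_power_0 vector_smult_assoc mult.commute)
next
  case (add r f g)
  from max_power_add[OF add.IH] show ?case by (simp add: distrib_left)
next
  case (step r f l)
  have yb: "y $ b = x $ b" using y by (simp add: chart_def)
  have "(\<lambda>z. x $ b * coord_diff b y l z) \<in> max_ideal X y"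
    using yb xb by (intro max_ideal_scale coord_diff_max_ideal) simp
  from max_power_SucI[OF this step.IH] have "(\<lambda>z. (x $ b * coord_diff b y l z) *
      (z $ b * f y ((x $ b / z $ b) *s z))) \<in> max_power X y (Suc r)" .
  moreover have "x $ b * coord_diff b y l z = ((x $ b / z $ b) *s z) $ l - y $ l" for z
    using xb by (simp add: coord_diff_def yb right_diff_distrib)
  ultimately show ?case by (simp add: ac_simps)
qed

text \<open>Once the coefficients of its Taylor expansion up to order \<open>k\<close> vanish, a
  linear form is reduced to a remainder in the power \<open>Suc k\<close>. The kernel thus contains
  all solutions of \<open>card (msets J k)\<close> equations whose coefficients are polynomials in
  \<open>y\<close>, valid near \<open>x\<close> and not only at \<open>x\<close>.\<close>

lemma jet_family:
  "\<exists>E \<rho>. pol E \<and> E x \<noteq> 0 \<and> (\<forall>M i. pol (\<rho> M i)) \<and>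
    (\<forall>y\<in>chart. E y \<noteq> 0 \<longrightarrow> (\<forall>c. (\<forall>M\<in>msets J k. (\<Sum>i\<in>UNIV. c $ i * \<rho> M i y) = 0) \<longrightarrow> c \<in> jet_kernel k X y))"
proof -
  obtain D C H where red: "reduction chart J D C H" and Dx: "D x \<noteq> 0" using elimination by blast
  interpret reduction chart J D C H by (rule red)
  obtain E \<rho> g where *: "pol E" "\<And>y. D y \<noteq> 0 \<Longrightarrow> E y \<noteq> 0" "\<And>M i. pol (\<rho> M i)"
    "\<And>i. diag_power (Suc k) (g i)"
    "\<And>i y z. y \<in> chart \<Longrightarrow> z \<in> chart \<Longrightarrow>
      E y * z $ i = (\<Sum>M\<in>msets J k. \<rho> M i y * monomial M y z) + g i y z"
    using coordinate_expansion[of k] by blast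
  have "c \<in> jet_kernel k X y"
    if y: "y \<in> chart" and Ey: "E y \<noteq> 0" and c: "\<forall>M\<in>msets J k. (\<Sum>i\<in>UNIV. c $ i * \<rho> M i y) = 0" for y c
  proof -
    have yX: "y \<in> X" and yb: "y $ b \<noteq> 0" using y xb by (auto simp: chart_def)
    let ?h = "\<lambda>y z. \<Sum>i\<in>UNIV. c $ i * g i y z"
    have h: "E y * lin_form c z = ?h y z" if z: "z \<in> chart" for z
    proof -
      have "E y * lin_form c z = (\<Sum>i\<in>UNIV. c $ i * (E y * z $ i))"
        by (simp add: lin_form_def sum_distrib_left ac_simps)
      also have "\<dots> = (\<Sum>M\<in>msets J k. (\<Sum>i\<in>UNIV. c $ i * \<rho> M i y) * monomial M y z) + ?h y z"
        unfolding *(5)[OF y z] distrib_left sum.distrib sum_distrib_left sum_distrib_right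
        by (subst sum.swap) (simp add: mult.assoc)
      finally show ?thesis using c by simp
    qed
    have "diag_power (Suc k) ?h" by (intro diag_power_sum diag_power_scale *)
    then have "(\<lambda>z. z $ b * ?h y ((x $ b / z $ b) *s z)) \<in> max_power X y (Suc k)"
      by (rule diag_power_max_power) (rule y)
    then have mem: "(\<lambda>z. 1 / (E y * x $ b) * (z $ b * ?h y ((x $ b / z $ b) *s z))) \<in> max_power X y (Suc k)"
      by (rule max_power_scale)
    have "lin_form c \<in> max_power X y (Suc k)"
    proof (rule max_power_germ[OF mem yX hom_nth[of b] yb])
      fix z assume z: "z \<in> X" "z $ b \<noteq> 0"
      have "(x $ b / z $ b) *s z \<in> chart"
        using scale[OF z(1), of "x $ b / z $ b"] z(2) xb by (simp add: chart_def)
      from h[OF this] have "?h y ((x $ b / z $ b) *s z) = E y * ((x $ b / z $ b) * lin_form c z)"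
        using hom_homogeneous[OF hom_lin_form[of c], of "x $ b / z $ b" z] by simp
      then show "lin_form c z = 1 / (E y * x $ b) * (z $ b * ?h y ((x $ b / z $ b) *s z))"
        using z(2) xb Ey by simp
    qed
    then show ?thesis by (simp add: jet_kernel_def)
  qed
  then show ?thesis using * Dx by blast
qed

end

section \<open>The dual variety\<close>

lemma closure_vanish:
  "x \<in> zariski_proj closure_of S \<Longrightarrow> f \<in> hom_poly_funs d \<Longrightarrow> (\<And>y. y \<in> S \<Longrightarrow> f y = 0) \<Longrightarrow> f x = 0"
  unfolding closure_zariski_proj by simp

lemma jet_kernel_scale: "c \<in> jet_kernel k X x \<Longrightarrow> s *s c \<in> jet_kernel k X x"
  using max_power_scale[of "lin_form c" X x "k + 1" s] by (simp add: jet_kernel_def lin_form_scale[abs_def])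

lemma jet_kernel_diff: "c \<in> jet_kernel k X x \<Longrightarrow> d \<in> jet_kernel k X x \<Longrightarrow> c - d \<in> jet_kernel k X x"
  using max_power_add[of "lin_form c" X x "k + 1" "\<lambda>y. -1 * lin_form d y"]
    max_power_scale[of "lin_form d" X x "k + 1" "-1"]
  by (simp add: jet_kernel_def lin_form_diff[abs_def])

lemma lin_form_axis: "lin_form (axis i 1) z = z $ i"
proof -
  have "lin_form (axis i 1) z = (\<Sum>j\<in>UNIV. if j = i then z $ j else 0)"
    unfolding lin_form_def by (rule sum.cong) (auto simp: axis_def)
  then show ?thesis by simp
qed

lemma sum_lin_form_axis:
  "(\<Sum>i\<in>T. c i * lin_form (axis i 1) z) = lin_form (\<chi> i. if i \<in> T then c i else 0) z"
  unfolding lin_form_axis by (simp add: lin_form_def if_distrib[of "\<lambda>x. x * _"] sum.If_cases cong: if_cong)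

text \<open>Two independent kernel vectors would allow the coefficients at two places
  \<open>i\<close> and \<open>j\<close> of any linear form to be removed modulo the kernel, so the
  rank would be at most \<open>CARD('m) - 2\<close>.\<close>

lemma jet_kernel_one_dim:
  fixes X :: "('a::field ^ 'm::finite) set"
  assumes rank: "jet_rank k X x = enat (CARD('m) - 1)"
    and v: "v \<in> jet_kernel k X x" "v \<noteq> 0" and c: "c \<in> jet_kernel k X x"
  shows "\<exists>s. c = s *s v"
proof -
  obtain i where i: "v $ i \<noteq> 0" using v(2) by (auto simp: vec_eq_iff)
  define v' where "v' = c - (c $ i / v $ i) *s v"
  have v': "v' \<in> jet_kernel k X x" unfolding v'_def by (intro jet_kernel_diff jet_kernel_scale v c)
  have v'i: "v' $ i = 0" using i by (simp add: v'_def)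
  have "v' = 0"
  proof (rule ccontr)
    assume "v' \<noteq> 0"
    then obtain j where j: "v' $ j \<noteq> 0" by (auto simp: vec_eq_iff)
    then have ij: "i \<noteq> j" using v'i by auto
    have "dim_mod (max_power X x (k + 1)) (range lin_form) \<le> enat (card (UNIV - {i, j}))"
    proof (rule dim_mod_le[where g = "\<lambda>l. lin_form (axis l 1)"])
      fix f assume "f \<in> range (lin_form :: 'a ^ 'm \<Rightarrow> _)"
      then obtain d where f: "f = lin_form d" by blast
      \<comment> \<open>The multiple \<open>s\<close> removes the coefficient at \<open>i\<close>;
        as \<open>v' $ i = 0\<close>, the correction by \<open>t\<close> at \<open>j\<close> does
        not bring it back.\<close>
      define s where "s = d $ i / v $ i"
      define t where "t = (d $ j - s * v $ j) / v' $ j"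
      define r where "r = s *s v - ((- t) *s v')"
      have "r \<in> jet_kernel k X x" unfolding r_def by (intro jet_kernel_diff jet_kernel_scale v v')
      moreover have "(\<chi> l. if l \<in> UNIV - {i, j} then (d - r) $ l else 0) = d - r"
        using i j v'i by (auto simp: vec_eq_iff r_def s_def t_def)
      then have "lin_form d y - (\<Sum>l\<in>UNIV - {i, j}. (d - r) $ l * lin_form (axis l 1) y) = lin_form r y" for y
        unfolding sum_lin_form_axis by (simp add: lin_form_diff)
      ultimately show "\<exists>l. (\<lambda>y. f y - (\<Sum>t\<in>UNIV - {i, j}. l t * lin_form (axis t 1) y)) \<in> max_power X x (k + 1)"
        unfolding f by (intro exI[of _ "\<lambda>l. (d - r) $ l"]) (simp add: jet_kernel_def)
    qed (auto intro: fun_subspace_max_power)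
    moreover have "card (UNIV - {i, j}) = CARD('m) - 2" using ij by (simp add: card_Diff_subset)
    moreover have "CARD('m) \<ge> 2"
      using card_mono[of "UNIV :: 'm set" "{i, j}"] ij by simp
    ultimately show False using rank by (simp add: jet_rank_def)
  qed
  then have "c = (c $ i / v $ i) *s v" by (simp add: v'_def)
  then show ?thesis by blast
qed

text \<open>Vectors \<open>p\<close> supported at \<open>i\<close> and one more place and orthogonal
  to \<open>v\<close> suffice as tests: each gives the vanishing of a two-by-two minor of
  \<open>c\<close> and \<open>v\<close>.\<close>

lemma annihilator_line:
  fixes v c :: "'a::field ^ 'm::finite"
  assumes v: "v \<noteq> 0" and sub: "\<And>p. p \<noteq> 0 \<Longrightarrow> lin_form v p = 0 \<Longrightarrow> lin_form c p = 0"
  shows "\<exists>s. c = s *s v"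
proof -
  obtain i where i: "v $ i \<noteq> 0" using v by (auto simp: vec_eq_iff)
  have "c $ j * v $ i = c $ i * v $ j" for j
  proof (cases "j = i")
    case False
    define p where "p = v $ i *s axis j 1 - v $ j *s axis i (1 :: 'a)"
    have lp: "lin_form d p = v $ i * d $ j - v $ j * d $ i" for d
    proof -
      have "d $ l * p $ l = (if l = j then v $ i * d $ j else 0) - (if l = i then v $ j * d $ i else 0)" for l
        by (auto simp: p_def axis_def)
      then show ?thesis by (simp add: lin_form_def sum_subtractf)
    qed
    have "p $ j = v $ i" using False by (simp add: p_def axis_def)
    then have "p \<noteq> 0" using i by auto
    from sub[OF this] show ?thesis by (simp add: lp mult.commute)
  qed simp
  then have "c = (c $ i / v $ i) *s v" using i by (simp add: vec_eq_iff field_simps)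
  then show ?thesis by blast
qed

lemma cofactor_col_solves:
  fixes A :: "'a::field ^ 'm::finite ^ 'm"
  assumes "det A \<noteq> 0"
  shows "A *v (\<chi> l. cofactor_col A l i) = det A *s axis i 1"
proof -
  let ?b = "axis i 1 :: 'a ^ 'm"
  have cof: "cofactor_col A l i = det (\<chi> r s. if s = l then ?b $ r else A $ r $ s)" for l
  proof -
    have "(\<chi> r s. if s = l then (if r = i then 1 else 0) else A $ r $ s) =
        (\<chi> r s. if s = l then ?b $ r else A $ r $ s)"
      by (auto simp: vec_eq_iff axis_def)
    then show ?thesis by (simp add: cofactor_col_def)
  qed
  have "A *v (\<chi> l. det (\<chi> r s. if s = l then ?b $ r else A $ r $ s) / det A) = ?b"
    using cramer[OF assms, of "\<chi> l. det (\<chi> r s. if s = l then ?b $ r else A $ r $ s) / det A" ?b] by blast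
  moreover have "(\<chi> l. cofactor_col A l i) =
      det A *s (\<chi> l. det (\<chi> r s. if s = l then ?b $ r else A $ r $ s) / det A)"
    using assms by (simp add: vec_eq_iff cof)
  ultimately show ?thesis by (simp add: vector_scalar_commute)
qed

text \<open>The moment equations confine the jet kernels on the torus to lines determined by
  \<open>w\<close>. That these kernels are nonzero is derived from \<open>card_points\<close>, by a
  count of Taylor coefficients.\<close>

locale toric_selfdual = toric_relations a u \<delta> X
  for a :: "'m::finite \<Rightarrow> int ^ 'n::finite" and u :: "'n \<Rightarrow> 'm \<Rightarrow> int" and \<delta> :: nat
    and X :: "('a::field_char_0 ^ 'm) set" +
  fixes k :: nat and w :: "'m \<Rightarrow> 'a"
  assumes w_nz: "\<And>i. w i \<noteq> 0"
    and moments: "\<And>\<gamma>. (\<And>M. size M \<le> k \<Longrightarrow> (\<Sum>i\<in>UNIV. \<gamma> i * (\<Prod>j\<in>#M. of_int (a i $ j))) = 0) \<Longrightarrow>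
      \<exists>s. \<forall>i. \<gamma> i = s * w i"
    and card_points: "CARD('m) = ((CARD('n) + k) choose k) + 1"
begin

text \<open>Describing this part by nonvanishing coordinates, and not as an orbit, makes its
  openness in \<open>X\<close> immediate.\<close>

definition torus_part :: "('a ^ 'm) set" where
  "torus_part = {y \<in> X. \<forall>i. y $ i \<noteq> 0}"

definition kernel_vec :: "'a ^ 'm \<Rightarrow> 'a ^ 'm" where
  "kernel_vec y = (\<chi> i. w i / y $ i)"

lemma torus_pt_torus_part: "torus_inv t \<Longrightarrow> torus_pt a t \<in> torus_part"
  by (simp add: torus_part_def X_def torus_pt_in torus_pt_nz)

lemma scale_X: "y \<in> X \<Longrightarrow> c \<noteq> 0 \<Longrightarrow> c *s y \<in> X"
  unfolding X_def by (rule toric_scale)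

lemma jet_kernel_torus_part_subset:
  assumes y: "y \<in> torus_part" and c: "c \<in> jet_kernel k X y"
  shows "\<exists>s. c = s *s kernel_vec y"
proof -
  have yX: "y \<in> toric_variety a" and nz: "\<And>i. y $ i \<noteq> 0" using y by (auto simp: torus_part_def X_def)
  have "\<exists>s. \<forall>i. c $ i * y $ i = s * w i"
    by (rule moments) (rule jet_kernel_moments[OF yX c[unfolded X_def]])
  then obtain s where s: "\<And>i. c $ i * y $ i = s * w i" by blast
  have "c = s *s kernel_vec y"
    using nz by (simp add: vec_eq_iff kernel_vec_def s[symmetric])
  then show ?thesis by blast
qed

text \<open>At most \<open>CARD('n)\<close> coordinates are needed for \<open>J\<close>, so by
  \<open>card_points\<close> the Taylor coefficients of order at most \<open>k\<close> are fewer
  than the homogeneous coordinates.\<close>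

lemma ex_cotangent_chart:
  assumes x: "x \<in> X" and xb: "x $ b \<noteq> 0"
    and dim: "dim_mod (max_square X x) (max_ideal X x) = enat CARD('n)"
  shows "\<exists>J lam. cotangent_chart X x b J lam \<and> card (msets J k) < CARD('m)"
proof -
  obtain J lam where J: "card J \<le> CARD('n)"
    "\<And>i. (\<lambda>z. coord_diff b x i z - (\<Sum>j\<in>J. lam i j * coord_diff b x j z)) \<in> max_square X x"
    by (rule dim_mod_subfamily[where g = "coord_diff b x", OF fun_subspace_max_square finite[of UNIV]
          coord_diff_max_ideal[OF xb] eq_refl[OF dim]]) auto
  have "cotangent_chart X x b J lam"
    by (intro cotangent_chart.intro x xb scale_X J)
  moreover have "card (msets J k) < CARD('m)"
    using card_msets[of J k] binomial_right_mono[of "card J + k" "CARD('n) + k" k] J(1) card_points by simp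
  ultimately show ?thesis by blast
qed

lemma kernel_vec_nz: "y \<in> torus_part \<Longrightarrow> kernel_vec y $ i \<noteq> 0"
  using w_nz by (simp add: kernel_vec_def torus_part_def)

text \<open>The equations sufficient for membership in the kernel are fewer than the coefficients of
  a linear form. The argument needs only the dimension of the cotangent space, so it covers boundary
  points as well.\<close>

lemma jet_kernel_nonzero:
  assumes x: "x \<in> X" and dim: "dim_mod (max_square X x) (max_ideal X x) = enat CARD('n)"
  shows "\<exists>c\<in>jet_kernel k X x. c \<noteq> 0"
proof -
  have "x \<noteq> 0" using toric_nonzero x unfolding X_def by blast
  then obtain b where xb: "x $ b \<noteq> 0" by (auto simp: vec_eq_iff)
  obtain J lam where ch: "cotangent_chart X x b J lam" and card: "card (msets J k) < CARD('m)"
    using ex_cotangent_chart[OF x xb dim] by blast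
  interpret cotangent_chart X x b J lam by (rule ch)
  obtain E \<rho> where E: "pol E" "E x \<noteq> 0" "\<And>M i. pol (\<rho> M i)" "\<And>z c. z \<in> chart \<Longrightarrow> E z \<noteq> 0 \<Longrightarrow>
      (\<forall>M\<in>msets J k. (\<Sum>i\<in>UNIV. c $ i * \<rho> M i z) = 0) \<Longrightarrow> c \<in> jet_kernel k X z"
    using jet_family[of k] by blast
  obtain c where c: "\<And>M. M \<in> msets J k \<Longrightarrow> (\<Sum>i\<in>UNIV. c i * \<rho> M i x) = 0" "\<exists>i\<in>UNIV. c i \<noteq> 0"
    using ex_nonzero_solution[OF conjunct1[OF card_msets[OF finite]] finite card, of "\<lambda>M i. \<rho> M i x"] by blast
  have "(\<chi> i. c i) \<in> jet_kernel k X x"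
    by (rule E(4)) (use x E(2) c(1) in \<open>auto simp: chart_def\<close>)
  moreover have "(\<chi> i. c i) \<noteq> 0" using c(2) by (auto simp: vec_eq_iff)
  ultimately show ?thesis by blast
qed

lemma kernel_vec_in_jet_kernel:
  assumes y: "y \<in> torus_part"
  shows "kernel_vec y \<in> jet_kernel k X y"
proof -
  have yX: "y \<in> X" and nz: "\<And>i. y $ i \<noteq> 0" using y by (auto simp: torus_part_def)
  obtain c where c: "c \<in> jet_kernel k X y" "c \<noteq> 0"
    using jet_kernel_nonzero[OF yX dim_cotangent[OF yX nz]] by blast
  obtain s where s: "c = s *s kernel_vec y" using jet_kernel_torus_part_subset[OF y c(1)] by blast
  then have "s \<noteq> 0" using c(2) by auto
  then have "(1 / s) *s c = kernel_vec y" unfolding s by simp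
  then show ?thesis using jet_kernel_scale[OF c(1), of "1 / s"] by simp
qed

text \<open>The kernel is a line spanned by a vector without zero entries, so it contains no nonzero
  form lacking the \<open>i\<close>-th coordinate; modulo the kernel the other coordinates are a
  basis.\<close>

lemma jet_rank_torus_part:
  assumes y: "y \<in> torus_part"
  shows "jet_rank k X y = enat (CARD('m) - 1)"
proof -
  fix i :: 'm
  let ?v = "kernel_vec y" and ?T = "UNIV - {i}"
  have card: "card ?T = CARD('m) - 1" by (simp add: card_Diff_subset)
  have "jet_rank k X y \<le> enat (card ?T)"
    unfolding jet_rank_def
  proof (rule dim_mod_le[where g = "\<lambda>l. lin_form (axis l 1)"])
    fix f assume "f \<in> range (lin_form :: 'a ^ 'm \<Rightarrow> _)"
    then obtain d where f: "f = lin_form d" by blast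
    define r where "r = (d $ i / ?v $ i) *s ?v"
    have "r \<in> jet_kernel k X y"
      unfolding r_def by (intro jet_kernel_scale kernel_vec_in_jet_kernel y)
    moreover have "(\<chi> l. if l \<in> ?T then (d - r) $ l else 0) = d - r"
      using kernel_vec_nz[OF y, of i] by (auto simp: vec_eq_iff r_def)
    then have "lin_form d z - (\<Sum>l\<in>?T. (d - r) $ l * lin_form (axis l 1) z) = lin_form r z" for z
      unfolding sum_lin_form_axis by (simp add: lin_form_diff)
    ultimately show "\<exists>l. (\<lambda>z. f z - (\<Sum>t\<in>?T. l t * lin_form (axis t 1) z)) \<in> max_power X y (k + 1)"
      unfolding f by (intro exI[of _ "\<lambda>l. (d - r) $ l"]) (simp add: jet_kernel_def)
  qed (auto intro: fun_subspace_max_power)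
  moreover have "enat (card ?T) \<le> jet_rank k X y"
    unfolding jet_rank_def
  proof (rule dim_mod_ge[where g = "\<lambda>l. lin_form (axis l 1)"])
    show "family_indep (max_power X y (k + 1)) ?T (\<lambda>l. lin_form (axis l 1))"
      unfolding family_indep_def sum_lin_form_axis
    proof (intro allI impI ballI)
      fix c l assume c: "lin_form (\<chi> i'. if i' \<in> ?T then c i' else 0) \<in> max_power X y (k + 1)" and l: "l \<in> ?T"
      then have "(\<chi> i'. if i' \<in> ?T then c i' else 0) \<in> jet_kernel k X y" by (simp add: jet_kernel_def)
      then obtain s where s: "(\<chi> i'. if i' \<in> ?T then c i' else 0) = s *s ?v"
        using jet_kernel_torus_part_subset[OF y] by blast
      then have "s * ?v $ i = 0" by (auto simp: vec_eq_iff dest: spec[of _ i])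
      then have "s = 0" using kernel_vec_nz[OF y, of i] by simp
      then show "c l = 0" using s l by (auto simp: vec_eq_iff dest: spec[of _ l])
    qed
  qed (auto intro: fun_subspace_max_power)
  ultimately show ?thesis unfolding card by (rule antisym)
qed

lemma torus_part_subset_cst_locus: "torus_part \<subseteq> cst_locus k X"
proof -
  have "openin (subtopology zariski_proj X) torus_part"
    unfolding openin_subtopology
  proof (intro exI conjI)
    have "(\<lambda>z :: 'a ^ 'm. \<Prod>i\<in>UNIV. z $ i) \<in> hom_poly_funs (\<Sum>i\<in>(UNIV :: 'm set). 1)"
      by (intro hom_prod hom_nth)
    then show "openin zariski_proj {z :: 'a ^ 'm. z \<noteq> 0 \<and> (\<Prod>i\<in>UNIV. z $ i) \<noteq> 0}" by (rule openin_basic)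
    show "torus_part = {z. z \<noteq> 0 \<and> (\<Prod>i\<in>UNIV. z $ i) \<noteq> 0} \<inter> X"
      using toric_nonzero unfolding torus_part_def X_def by auto
  qed
  moreover have "(subtopology zariski_proj X) closure_of torus_part = X"
  proof
    show "(subtopology zariski_proj X) closure_of torus_part \<subseteq> X"
      using closure_of_subset_topspace[of "subtopology zariski_proj X" torus_part] by simp
    have "X \<subseteq> zariski_proj closure_of torus_part"
      unfolding X_def toric_variety_eq
      by (rule closure_of_mono) (auto intro: torus_pt_torus_part)
    moreover have "X \<inter> torus_part = torus_part" unfolding torus_part_def by auto
    ultimately show "X \<subseteq> (subtopology zariski_proj X) closure_of torus_part"
      by (simp add: closure_of_subtopology)
  qed
  moreover have "smooth_point X y" if "y \<in> torus_part" for y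
    using that dim_cotangent[of y] krull_dim_toric
    by (auto simp: smooth_point_def torus_part_def max_square_def)
  moreover have "\<forall>y\<in>torus_part. jet_rank k X y = enat (CARD('m) - 1)"
    using jet_rank_torus_part by blast
  ultimately show ?thesis unfolding cst_locus_def by blast
qed

text \<open>An open set through \<open>x\<close> meets the dense orbit, where the rank is known, and
  constancy carries this rank to \<open>x\<close>. The Krull dimension translates smoothness into
  the size of the cotangent space.\<close>

lemma cst_locusD:
  assumes x: "x \<in> cst_locus k X"
  shows "x \<in> X" "dim_mod (max_square X x) (max_ideal X x) = enat CARD('n)"
    "jet_rank k X x = enat (CARD('m) - 1)"
proof -
  obtain V r where V: "x \<in> V" "openin (subtopology zariski_proj X) V"
    "\<forall>x\<in>V. smooth_point X x" "\<forall>x\<in>V. jet_rank k X x = r"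
    using x unfolding cst_locus_def by blast
  have "smooth_point X x" using V by blast
  then show xX: "x \<in> X" and "dim_mod (max_square X x) (max_ideal X x) = enat CARD('n)"
    by (simp_all add: smooth_point_def max_square_def krull_dim_toric)
  obtain T where T: "openin zariski_proj T" "V = T \<inter> X" using V(2) unfolding openin_subtopology by blast
  have "x \<in> zariski_proj closure_of {torus_pt a t | t. torus_inv t}"
    using xX unfolding X_def toric_variety_eq .
  moreover have "x \<in> T" using V(1) T(2) by blast
  ultimately obtain y where "y \<in> {torus_pt a t | t. torus_inv t}" "y \<in> T"
    using T(1) unfolding in_closure_of by blast
  then obtain t where t: "torus_inv t" "torus_pt a t \<in> T" by blast
  then have "torus_pt a t \<in> V" using T(2) torus_pt_torus_part[OF t(1)] by (auto simp: torus_part_def)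
  then have "jet_rank k X x = jet_rank k X (torus_pt a t)" using V(1,4) by simp
  then show "jet_rank k X x = enat (CARD('m) - 1)"
    using jet_rank_torus_part[OF torus_pt_torus_part[OF t(1)]] by simp
qed

section \<open>Inversion of the torus, specialization of kernel lines, and the dual variety\<close>

lemma torus_pt_inverse:
  "torus_inv t \<Longrightarrow> (\<chi> i. inverse (torus_pt a t $ i)) = torus_pt a (\<chi> j. inverse (t $ j))"
  by (simp add: torus_pt_def vec_eq_iff power_int_inverse prod_inversef[symmetric, unfolded o_def])

lemma torus_inv_inverse: "torus_inv t \<Longrightarrow> torus_inv (\<chi> j. inverse (t $ j))"
  by (simp add: torus_inv_def)

lemma inverse_torus_part:
  assumes y: "y \<in> torus_part"
  shows "(\<chi> i. inverse (y $ i)) \<in> X"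
proof -
  have yX: "y \<in> toric_variety a" and nz: "\<forall>i. y $ i \<noteq> 0" using y by (auto simp: torus_part_def X_def)
  show ?thesis unfolding X_def toric_variety_iff
  proof (intro conjI allI ballI impI)
    show "(\<chi> i. inverse (y $ i)) \<noteq> 0" using nz by (simp add: vec_eq_iff)
    fix d and f :: "'a ^ 'm \<Rightarrow> 'a"
    assume f: "f \<in> hom_poly_funs d" "\<forall>t. torus_inv t \<longrightarrow> f (torus_pt a t) = 0"
    obtain g e where g: "g \<in> hom_poly_funs e"
      "\<And>z. \<forall>i. z $ i \<noteq> 0 \<Longrightarrow> g z = (\<Prod>i\<in>UNIV. z $ i) ^ d * f (\<chi> i. inverse (z $ i))"
      using hom_inverse[OF f(1)] by blast
    have "g y = 0"
    proof (rule toric_vanish[OF yX g(1)])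
      fix t :: "'a ^ 'n" assume t: "torus_inv t"
      show "g (torus_pt a t) = 0"
        using g(2)[of "torus_pt a t"] torus_pt_nz[OF t, of a] f(2) torus_inv_inverse[OF t]
        by (simp add: torus_pt_inverse[OF t])
    qed
    then show "f (\<chi> i. inverse (y $ i)) = 0" using g(2)[OF nz] nz by simp
  qed
qed

text \<open>Near \<open>x\<close> the kernel lines are spanned by a vector \<open>\<kappa>\<close> of polynomials, and an equation that holds
  for \<open>\<kappa>\<close> on the torus also holds at \<open>x\<close>.\<close>

lemma jet_kernel_specialization:
  assumes x: "x \<in> cst_locus k X" and c: "c \<in> jet_kernel k X x" "c \<noteq> 0"
  shows "(\<chi> i. inverse (w i) * c $ i) \<in> X"
proof -
  note xX = cst_locusD(1)[OF x] and dim = cst_locusD(2)[OF x] and rank = cst_locusD(3)[OF x]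
  have "x \<noteq> 0" using toric_nonzero xX unfolding X_def by blast
  then obtain b where xb: "x $ b \<noteq> 0" by (auto simp: vec_eq_iff)
  obtain J lam where ch: "cotangent_chart X x b J lam" and card: "card (msets J k) < CARD('m)"
    using ex_cotangent_chart[OF xX xb dim] by blast
  interpret cotangent_chart X x b J lam by (rule ch)
  obtain E \<rho> where E: "pol E" "E x \<noteq> 0" "\<And>M i. pol (\<rho> M i)" "\<And>z c. z \<in> chart \<Longrightarrow> E z \<noteq> 0 \<Longrightarrow>
      (\<forall>M\<in>msets J k. (\<Sum>i\<in>UNIV. c $ i * \<rho> M i z) = 0) \<Longrightarrow> c \<in> jet_kernel k X z"
    using jet_family[of k] by blast
  have x_chart: "x \<in> chart" using xX by (simp add: chart_def)
  obtain v where v_ker: "v \<in> jet_kernel k X x" and "v \<noteq> 0" using jet_kernel_nonzero[OF xX dim] by blast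
  then obtain i0 where i0: "v $ i0 \<noteq> 0" by (auto simp: vec_eq_iff)
  note line = jet_kernel_one_dim[OF rank v_ker \<open>v \<noteq> 0\<close>]
  fix r0 :: 'm
  have "card (msets J k) \<le> card (UNIV - {r0})" using card by (simp add: card_Diff_subset)
  then obtain h where h: "h ` msets J k \<subseteq> UNIV - {r0}" "inj_on h (msets J k)"
    using card_le_inj[of "msets J k" "UNIV - {r0}"] card_msets[OF finite[of J]] by auto
  \<comment> \<open>The equations for the kernel occupy rows other than \<open>r0\<close>, with zero
    rows as padding; row \<open>r0\<close> reads off the coordinate \<open>i0\<close>, at which the
    kernel line of \<open>x\<close> is nonzero. This normalization is what makes \<open>A x\<close>
    invertible.\<close>
  define A where "A y = (\<chi> r s. if r = r0 then (if s = i0 then 1 else 0)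
    else if r \<in> h ` msets J k then \<rho> (inv_into (msets J k) h r) s y else 0)" for y
  have polA: "pol (\<lambda>y. A y $ r $ s)" for r s
    unfolding A_def by (auto intro!: pol_if pol_const E)
  have row: "(A y *v v') $ h M = (\<Sum>i\<in>UNIV. v' $ i * \<rho> M i y)" if "M \<in> msets J k" for y v' M
  proof -
    have "h M \<noteq> r0" using h(1) that by blast
    moreover have "inv_into (msets J k) h (h M) = M" using h(2) that by (rule inv_into_f_f)
    ultimately show ?thesis using that by (simp add: A_def matrix_vector_mult_def mult.commute)
  qed
  have row0: "(A y *v v') $ r0 = v' $ i0" for y v'
    by (simp add: A_def matrix_vector_mult_def sum_indicator)
  have detA: "det (A x) \<noteq> 0" unfolding det_nonzero_iff
  proof (intro allI impI)
    fix v' assume v': "A x *v v' = 0"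
    have "v' \<in> jet_kernel k X x"
      by (rule E(4)[OF x_chart E(2)]) (use row v' in \<open>auto simp flip: row\<close>)
    then obtain s where s: "v' = s *s v" using line by blast
    moreover have "v' $ i0 = 0" using row0[of x v'] v' by simp
    ultimately show "v' = 0" using i0 by simp
  qed
  \<comment> \<open>The adjugate column belonging to \<open>r0\<close> is annihilated by all other
    rows when \<open>A y\<close> is invertible, so it solves the kernel equations while depending
    polynomially on \<open>y\<close>.\<close>
  define \<kappa> where "\<kappa> y = (\<chi> l. cofactor_col (A y) l r0)" for y
  have A\<kappa>: "A y *v \<kappa> y = det (A y) *s axis r0 1" if "det (A y) \<noteq> 0" for y
    unfolding \<kappa>_def by (rule cofactor_col_solves[OF that])
  have \<kappa>_ker: "\<kappa> y \<in> jet_kernel k X y" if y: "y \<in> chart" "E y \<noteq> 0" "det (A y) \<noteq> 0" for y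
  proof (rule E(4)[OF y(1,2)], intro ballI)
    fix M assume M: "M \<in> msets J k"
    have "h M \<noteq> r0" using h(1) M by blast
    then show "(\<Sum>i\<in>UNIV. \<kappa> y $ i * \<rho> M i y) = 0"
      unfolding row[OF M, symmetric] A\<kappa>[OF y(3)] by (simp add: axis_def)
  qed
  have "\<kappa> x \<noteq> 0"
  proof
    assume "\<kappa> x = 0"
    then have "(det (A x) *s axis r0 1) $ r0 = (0 :: 'a)" using A\<kappa>[OF detA] by simp
    then show False using detA by (simp add: axis_def)
  qed
  then obtain s where s: "c = s *s \<kappa> x"
    using jet_kernel_one_dim[OF rank \<kappa>_ker[OF x_chart E(2) detA] _ c(1)] by blast
  show ?thesis unfolding X_def toric_variety_iff
  proof (intro conjI allI ballI impI)
    show "(\<chi> i. inverse (w i) * c $ i) \<noteq> 0" using c(2) w_nz by (simp add: vec_eq_iff)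
    fix d and f :: "'a ^ 'm \<Rightarrow> 'a"
    assume f: "f \<in> hom_poly_funs d" "\<forall>t. torus_inv t \<longrightarrow> f (torus_pt a t) = 0"
    let ?f = "\<lambda>y. f (\<chi> i. inverse (w i) * \<kappa> y $ i)"
    \<comment> \<open>The two factors absorb the points where \<open>\<kappa> y\<close> is not known
      to lie in the kernel. Both are nonzero at \<open>x\<close>, where they are cancelled
      again.\<close>
    have zero: "E y * det (A y) * ?f y = 0" if y: "y \<in> chart" "y \<in> torus_part" for y
    proof (cases "E y = 0 \<or> det (A y) = 0")
      case False
      then obtain s where s: "\<kappa> y = s *s kernel_vec y"
        using jet_kernel_torus_part_subset[OF y(2) \<kappa>_ker[OF y(1)]] by blast
      have "(\<chi> i. inverse (w i) * \<kappa> y $ i) = s *s (\<chi> i. inverse (y $ i))"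
        unfolding s using w_nz by (simp add: vec_eq_iff kernel_vec_def divide_inverse)
      moreover have "f (\<chi> i. inverse (y $ i)) = 0"
        using inverse_torus_part[OF y(2)] f toric_vanish unfolding X_def by blast
      ultimately show ?thesis by (simp add: hom_homogeneous[OF f(1)])
    qed auto
    have "pol (\<lambda>y. E y * det (A y) * ?f y)"
      by (intro pol_mult E pol_det polA pol_compose[OF hom_imp_pol[OF f(1)]])
        (auto simp: \<kappa>_def intro!: pol_mult pol_const pol_cofactor_col polA)
    then obtain e F where F: "F \<in> hom_poly_funs e"
      "\<And>z. z $ b \<noteq> 0 \<Longrightarrow> F z = z $ b ^ e * (E ((x $ b / z $ b) *s z) * det (A ((x $ b / z $ b) *s z)) *
        ?f ((x $ b / z $ b) *s z))"
      using pol_homogenize[OF _ xb, of _ b] by blast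
    have "F x = 0"
    proof (rule toric_vanish[OF xX[unfolded X_def] F(1)])
      fix t :: "'a ^ 'n" assume t: "torus_inv t"
      let ?z = "torus_pt a t"
      have zb: "?z $ b \<noteq> 0" by (rule torus_pt_nz[OF t])
      let ?y = "(x $ b / ?z $ b) *s ?z"
      have "?y \<in> X" using torus_pt_torus_part[OF t] zb xb by (intro scale_X) (auto simp: torus_part_def)
      then have "?y \<in> chart" "?y \<in> torus_part"
        using zb xb torus_pt_nz[OF t] by (auto simp: chart_def torus_part_def)
      from zero[OF this] show "F ?z = 0" using F(2)[OF zb] by simp
    qed
    then have "?f x = 0" using F(2)[OF xb] xb E(2) detA by simp
    moreover have "(\<chi> i. inverse (w i) * c $ i) = s *s (\<chi> i. inverse (w i) * \<kappa> x $ i)"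
      unfolding s by (simp add: vec_eq_iff)
    ultimately show "f (\<chi> i. inverse (w i) * c $ i) = 0" by (simp add: hom_homogeneous[OF f(1)])
  qed
qed

text \<open>As the kernel is a line, the osculating space is itself a hyperplane, and the only
  equations vanishing on it are the multiples of its own.\<close>

lemma osculating_hyperplane:
  assumes x: "x \<in> cst_locus k X" and sub: "osculating_space k X x \<subseteq> hyperplane c"
  shows "c \<in> jet_kernel k X x"
proof -
  obtain v where v: "v \<in> jet_kernel k X x" "v \<noteq> 0" 
    using jet_kernel_nonzero[OF cst_locusD(1,2)[OF x]] by blast
  have "\<exists>s. c = s *s v"
  proof (rule annihilator_line[OF v(2)])
    fix p assume p: "p \<noteq> 0" "lin_form v p = 0"
    have "lin_form d p = 0" if d: "d \<in> jet_kernel k X x" for d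
      using jet_kernel_one_dim[OF cst_locusD(3)[OF x] v d] p(2) by (auto simp: lin_form_scale)
    then have "p \<in> osculating_space k X x" using p(1) by (simp add: osculating_space_def)
    then show "lin_form c p = 0" using sub by (auto simp: hyperplane_def)
  qed
  then show ?thesis using jet_kernel_scale[OF v(1)] by blast
qed

text \<open>One direction specializes kernel vectors at all points of the constancy locus and passes
  to the closure. For the other, \<open>w\<close> times the orbit point with parameter
  \<open>t\<close> is the kernel vector at the inverse orbit point.\<close>

lemma dual_variety_iff: "c \<in> dual_variety k X \<longleftrightarrow> (\<chi> i. inverse (w i) * c $ i) \<in> X"
proof
  assume c: "c \<in> dual_variety k X"
  show "(\<chi> i. inverse (w i) * c $ i) \<in> X" unfolding X_def toric_variety_iff
  proof (intro conjI allI ballI impI)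
    have "c \<noteq> 0" using c unfolding dual_variety_def closure_zariski_proj by blast
    then show "(\<chi> i. inverse (w i) * c $ i) \<noteq> 0" using w_nz by (simp add: vec_eq_iff)
    fix d and f :: "'a ^ 'm \<Rightarrow> 'a"
    assume f: "f \<in> hom_poly_funs d" "\<forall>t. torus_inv t \<longrightarrow> f (torus_pt a t) = 0"
    show "f (\<chi> i. inverse (w i) * c $ i) = 0"
    proof (rule closure_vanish[OF c[unfolded dual_variety_def] hom_diag[OF f(1)]])
      fix c' assume "c' \<in> {c. c \<noteq> 0 \<and> (\<exists>x\<in>cst_locus k X. osculating_space k X x \<subseteq> hyperplane c)}"
      then obtain x where c': "c' \<noteq> 0" "x \<in> cst_locus k X" "osculating_space k X x \<subseteq> hyperplane c'"
        by blast
      have "(\<chi> i. inverse (w i) * c' $ i) \<in> toric_variety a"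
        using jet_kernel_specialization[OF c'(2) osculating_hyperplane[OF c'(2,3)] c'(1)]
        unfolding X_def .
      then show "f (\<chi> i. inverse (w i) * c' $ i) = 0"
        by (rule toric_vanish[OF _ f(1)]) (use f(2) in simp)
    qed
  qed
next
  assume c: "(\<chi> i. inverse (w i) * c $ i) \<in> X"
  show "c \<in> dual_variety k X" unfolding dual_variety_def closure_zariski_proj
  proof (intro conjI allI ballI impI)
    have "(\<chi> i. inverse (w i) * c $ i) \<noteq> 0" using c toric_nonzero unfolding X_def by blast
    then show "c \<noteq> 0" by (auto simp: vec_eq_iff)
    fix d and f :: "'a ^ 'm \<Rightarrow> 'a"
    assume f: "f \<in> hom_poly_funs d"
      "\<forall>y\<in>{c. c \<noteq> 0 \<and> (\<exists>x\<in>cst_locus k X. osculating_space k X x \<subseteq> hyperplane c)}. y \<noteq> 0 \<longrightarrow> f y = 0"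
    have "f (\<chi> i. w i * (\<chi> i. inverse (w i) * c $ i) $ i) = 0"
    proof (rule toric_vanish[OF c[unfolded X_def] hom_diag[OF f(1)]])
      fix t :: "'a ^ 'n" assume t: "torus_inv t"
      define y where "y = torus_pt a (\<chi> j. inverse (t $ j))"
      have y: "y \<in> torus_part" unfolding y_def by (intro torus_pt_torus_part torus_inv_inverse t)
      have yt: "y = (\<chi> i. inverse (torus_pt a t $ i))" unfolding y_def by (rule torus_pt_inverse[OF t, symmetric])
      have "osculating_space k X y \<subseteq> hyperplane (kernel_vec y)"
        using kernel_vec_in_jet_kernel[OF y] by (auto simp: osculating_space_def hyperplane_def)
      moreover have "kernel_vec y \<noteq> 0" using kernel_vec_nz[OF y] by (metis zero_index)
      moreover have "y \<in> cst_locus k X" using y torus_part_subset_cst_locus by blast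
      ultimately have "f (kernel_vec y) = 0" using f(2) by blast
      moreover have "kernel_vec y = (\<chi> i. w i * torus_pt a t $ i)"
        using torus_pt_nz[OF t, of a] by (simp add: kernel_vec_def yt vec_eq_iff divide_inverse)
      ultimately show "f (\<chi> i. w i * torus_pt a t $ i) = 0" by simp
    qed
    moreover have "(\<chi> i. w i * (\<chi> i. inverse (w i) * c $ i) $ i) = c"
      using w_nz by (simp add: vec_eq_iff)
    ultimately show "f c = 0" by simp
  qed
qed

theorem selfdual_toric: "selfdual k X"
  unfolding selfdual_def
proof (intro exI conjI)
  let ?f = "\<lambda>p :: 'a ^ 'm. \<chi> i. w i * p $ i" and ?g = "\<lambda>p :: 'a ^ 'm. \<chi> i. inverse (w i) * p $ i"
  show "Vector_Spaces.linear (*s) (*s) ?f"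
    by unfold_locales (simp_all add: vec_eq_iff algebra_simps)
  have fg: "?f (?g p) = p" "?g (?f p) = p" for p using w_nz by (simp_all add: vec_eq_iff)
  show "bij ?f" by (rule bij_betw_byWitness[of _ ?g]) (auto simp: vec_eq_iff w_nz)
  show "?f ` X = dual_variety k X"
  proof (intro set_eqI iffI)
    fix c assume "c \<in> ?f ` X"
    then obtain p where "p \<in> X" "c = ?f p" by blast
    then show "c \<in> dual_variety k X" unfolding dual_variety_iff using fg(2)[of p] by simp
  next
    fix c assume "c \<in> dual_variety k X"
    then have "?f (?g c) \<in> ?f ` X" unfolding dual_variety_iff by (rule imageI)
    then show "c \<in> ?f ` X" unfolding fg(1) .
  qed
qed

end

section \<open>General configurations\<close>

text \<open>Up to alternating signs the coefficients are elementary symmetric functions of positive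
  integers. The field carries no order, so nonvanishing is recorded by a positive natural number
  \<open>q\<close>.\<close>

lemma coeff_linear_product:
  assumes "finite Z" "\<And>z. z \<in> Z \<Longrightarrow> z > 0"
  shows "i \<le> card Z \<Longrightarrow> \<exists>q>0. coeff (\<Prod>z\<in>Z. [:- of_nat z, 1 :: 'a::field_char_0:]) i = (-1) ^ (card Z + i) * of_nat q"
  using assms
proof (induction Z arbitrary: i rule: finite_induct)
  case empty
  then show ?case by (intro exI[of _ 1]) simp
next
  case (insert z Z)
  let ?P = "\<Prod>z\<in>Z. [:- of_nat z, 1 :: 'a:]"
  have z: "z > 0" using insert.prems by simp
  have deg: "degree ?P = card Z" by (subst degree_prod_eq_sum_degree) auto
  have IH: "\<exists>q>0. coeff ?P i = (-1) ^ (card Z + i) * of_nat q" if "i \<le> card Z" for i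
    using insert.IH[OF that] insert.prems by simp
  have co: "coeff (\<Prod>z\<in>insert z Z. [:- of_nat z, 1 :: 'a:]) i =
      - of_nat z * coeff ?P i + (case i of 0 \<Rightarrow> 0 | Suc i' \<Rightarrow> coeff ?P i')" for i
    using insert.hyps by (simp add: coeff_pCons split: nat.split)
  show ?case
  proof (cases i)
    case 0
    obtain q where "q > 0" "coeff ?P 0 = (-1) ^ (card Z + 0) * of_nat q" using IH[of 0] by auto
    then show ?thesis
      using insert.hyps z unfolding co 0 by (intro exI[of _ "z * q"]) simp
  next
    case (Suc i')
    have "i' \<le> card Z" using insert.prems(1) insert.hyps Suc by simp
    from IH[OF this] obtain q where q: "q > 0" "coeff ?P i' = (-1) ^ (card Z + i') * of_nat q" by blast
    show ?thesis
    proof (cases "i \<le> card Z")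
      case True
      from IH[OF this] obtain r where r: "r > 0" "coeff ?P i = (-1) ^ (card Z + i) * of_nat r" by blast
      have "coeff (\<Prod>z\<in>insert z Z. [:- of_nat z, 1 :: 'a:]) i =
          (-1) ^ (card (insert z Z) + i) * of_nat (z * r + q)"
        using insert.hyps unfolding co r(2) by (simp add: Suc q(2) algebra_simps)
      then show ?thesis using q(1) by (intro exI[of _ "z * r + q"]) auto
    next
      case False
      then have "coeff ?P i = 0" by (intro coeff_eq_0) (simp add: deg)
      then have "coeff (\<Prod>z\<in>insert z Z. [:- of_nat z, 1 :: 'a:]) i =
          (-1) ^ (card (insert z Z) + i) * of_nat q"
        using insert.hyps unfolding co by (simp add: Suc q(2))
      then show ?thesis using q(1) by blast
    qed
  qed
qed

text \<open>The polynomial \<open>\<Sum> v\<^sub>c X\<^bsup>\<tau> c\<^esup>\<close> has degree at most \<open>N\<close> and \<open>N\<close> distinct positive roots, so it is a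
  multiple of the product of the linear factors, which has no zero coefficient.\<close>

lemma vandermonde_kernel:
  fixes v :: "'m::finite \<Rightarrow> 'a::field_char_0" and Z :: "nat set"
  assumes Z: "finite Z" "\<And>z. z \<in> Z \<Longrightarrow> z > 0" "card Z + 1 = CARD('m)" "card Z > 0"
    and \<tau>: "bij_betw \<tau> (UNIV :: 'm set) {..<CARD('m)}"
    and v: "\<And>z. z \<in> Z \<Longrightarrow> (\<Sum>c\<in>UNIV. v c * of_nat z ^ \<tau> c) = 0" "v i = 0"
  shows "v c = 0"
proof -
  define V where "V = (\<Sum>c\<in>UNIV. monom (v c) (\<tau> c))"
  define P where "P = (\<Prod>z\<in>Z. [:- of_nat z, 1 :: 'a:])"
  \<comment> \<open>The coefficient in degree \<open>card Z\<close> cancels while all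
    \<open>card Z\<close> roots remain, which forces \<open>Q\<close> to be zero.\<close>
  define Q where "Q = V - smult (coeff V (card Z)) P"
  have \<tau>le: "\<tau> c \<le> card Z" for c using bij_betw_apply[OF \<tau>, of c] Z(3) by simp
  have \<tau>inj: "\<tau> c = \<tau> c' \<longleftrightarrow> c = c'" for c c' using \<tau> by (auto simp: bij_betw_def inj_on_def)
  have coV: "coeff V (\<tau> c) = v c" for c
    unfolding V_def by (simp add: coeff_sum \<tau>inj)
  have degV: "degree V \<le> card Z"
    unfolding V_def by (intro degree_sum_le) (auto intro: order_trans[OF degree_monom_le \<tau>le])
  have degP: "degree P = card Z" unfolding P_def by (subst degree_prod_eq_sum_degree) auto
  have "lead_coeff P = 1" unfolding P_def by (simp add: lead_coeff_prod)
  then have "coeff P (card Z) = 1" using degP by simp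
  then have "coeff Q (card Z) = 0" by (simp add: Q_def)
  moreover have "degree Q \<le> card Z"
    unfolding Q_def using degV degP by (intro degree_diff_le) (auto intro: order_trans[OF degree_smult_le])
  ultimately have degQ: "Q = 0 \<or> degree Q < card Z" by (metis le_neq_implies_less leading_coeff_0_iff)
  have roots: "of_nat ` Z \<subseteq> {x. poly Q x = 0}"
  proof clarify
    fix z assume z: "z \<in> Z"
    have "poly V (of_nat z) = 0" using v(1)[OF z] by (simp add: V_def poly_sum poly_monom)
    moreover have "poly P (of_nat z) = 0" unfolding P_def poly_prod using z Z(1) by (intro prod_zero) auto
    ultimately show "poly Q (of_nat z) = 0" by (simp add: Q_def)
  qed
  have "Q = 0"
  proof (rule ccontr)
    assume "Q \<noteq> 0"
    then have "card (of_nat ` Z :: 'a set) \<le> degree Q"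
      using card_mono[OF poly_roots_finite roots] card_poly_roots_bound[of Q] by auto
    moreover have "card (of_nat ` Z :: 'a set) = card Z" by (rule card_image) (simp add: inj_on_def)
    ultimately show False using degQ \<open>Q \<noteq> 0\<close> by simp
  qed
  then have V: "V = smult (coeff V (card Z)) P" by (simp add: Q_def)
  obtain q where q: "q > 0" "coeff P (\<tau> i) = (-1) ^ (card Z + \<tau> i) * of_nat q"
    using coeff_linear_product[OF Z(1,2) \<tau>le] unfolding P_def by blast
  have "coeff V (\<tau> i) = coeff V (card Z) * coeff P (\<tau> i)" by (subst V) simp
  then have "coeff V (card Z) = 0" using coV[of i] v(2) q by simp
  then have "V = 0" using V by simp
  then show ?thesis using coV[of c] by simp
qed

text \<open>Up to sign, the determinant is the maximal minor that omits the column \<open>i\<close> from the matrix with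
  the rows \<open>G M\<close>.\<close>

definition jet_matrix :: "('n multiset \<Rightarrow> 'm) \<Rightarrow> nat \<Rightarrow> 'm \<Rightarrow> 'm \<Rightarrow> ('n multiset \<Rightarrow> 'm \<Rightarrow> 'a::comm_ring_1) \<Rightarrow> 'a ^ 'm::finite ^ 'm" where
  "jet_matrix h k r0 i G = (\<chi> r c. if r = r0 then (if c = i then 1 else 0)
     else G (inv_into (msets UNIV k) h r) c)"

text \<open>The monomials number all rows but \<open>r0\<close>; the spare row prescribes one
  coordinate and makes the system square.\<close>

locale jet_index =
  fixes h :: "'n::finite multiset \<Rightarrow> 'm::finite" and k :: nat and r0 :: 'm
  assumes h: "bij_betw h (msets UNIV k) (UNIV - {r0})"
begin

lemma row_r0: "(jet_matrix h k r0 i G *v v) $ r0 = v $ i"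
  by (simp add: jet_matrix_def matrix_vector_mult_def sum_indicator)

lemma h_neq: "M \<in> msets UNIV k \<Longrightarrow> h M \<noteq> r0"
  using h by (auto simp: bij_betw_def)

lemma row_h: "M \<in> msets UNIV k \<Longrightarrow> (jet_matrix h k r0 i G *v v) $ h M = (\<Sum>c\<in>UNIV. G M c * v $ c)"
  using h_neq[of M] bij_betw_inv_into_left[OF h, of M] by (simp add: jet_matrix_def matrix_vector_mult_def)

lemma row_cases: "r = r0 \<or> (\<exists>M\<in>msets UNIV k. r = h M)"
  using h by (auto simp: bij_betw_def)

lemma det_jet_matrix:
  fixes G :: "'n multiset \<Rightarrow> 'm \<Rightarrow> 'a::field"
  shows "det (jet_matrix h k r0 i G) \<noteq> 0 \<longleftrightarrow>
    (\<forall>v. v $ i = 0 \<and> (\<forall>M\<in>msets UNIV k. (\<Sum>c\<in>UNIV. G M c * v $ c) = 0) \<longrightarrow> v = 0)"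
proof -
  have "jet_matrix h k r0 i G *v v = 0 \<longleftrightarrow>
      v $ i = 0 \<and> (\<forall>M\<in>msets UNIV k. (\<Sum>c\<in>UNIV. G M c * v $ c) = 0)" for v
  proof -
    have "jet_matrix h k r0 i G *v v = 0 \<longleftrightarrow> (\<forall>r. (jet_matrix h k r0 i G *v v) $ r = 0)"
      by (simp add: vec_eq_iff)
    also have "\<dots> \<longleftrightarrow> (jet_matrix h k r0 i G *v v) $ r0 = 0 \<and>
        (\<forall>M\<in>msets UNIV k. (jet_matrix h k r0 i G *v v) $ h M = 0)"
      using row_cases by metis
    finally show ?thesis by (simp add: row_r0 row_h)
  qed
  then show ?thesis unfolding det_nonzero_iff by simp
qed

text \<open>One unknown more than equations gives a nonzero solution \<open>w\<close>. A zero entry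
  \<open>w i\<close> would contradict the minor omitting \<open>i\<close>; any other solution,
  corrected by a multiple of \<open>w\<close> to vanish at \<open>r0\<close>, is zero by the minor
  omitting \<open>r0\<close>.\<close>

lemma kernel_line:
  fixes G :: "'n multiset \<Rightarrow> 'm \<Rightarrow> 'a::field"
  assumes det: "\<And>i. det (jet_matrix h k r0 i G) \<noteq> 0"
  obtains w :: "'m \<Rightarrow> 'a" where "\<And>i. w i \<noteq> 0"
    "\<And>\<gamma>. (\<And>M. size M \<le> k \<Longrightarrow> (\<Sum>i\<in>UNIV. \<gamma> i * G M i) = 0) \<Longrightarrow> \<exists>s. \<forall>i. \<gamma> i = s * w i"
proof -
  have "card (msets (UNIV :: 'n set) k) = card (UNIV - {r0})" using h by (rule bij_betw_same_card)
  then have "card (msets (UNIV :: 'n set) k) < CARD('m)"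
    by (simp add: card_Diff_subset)
  from ex_nonzero_solution[OF conjunct1[OF card_msets[OF finite]] finite this, of G]
  obtain w where w: "\<And>M. M \<in> msets UNIV k \<Longrightarrow> (\<Sum>i\<in>UNIV. w i * G M i) = 0" "\<exists>i\<in>UNIV. w i \<noteq> 0" by blast
  have wz: "w i \<noteq> 0" for i
  proof
    assume "w i = 0"
    then have "(\<chi> c. w c) = 0"
      using det[of i] w(1) unfolding det_jet_matrix by (simp add: mult.commute)
    then show False using w(2) by (simp add: vec_eq_iff)
  qed
  show ?thesis
  proof (rule that[OF wz])
    fix \<gamma> assume \<gamma>: "\<And>M. size M \<le> k \<Longrightarrow> (\<Sum>i\<in>UNIV. \<gamma> i * G M i) = 0"
    let ?s = "\<gamma> r0 / w r0"
    let ?v = "\<chi> c. \<gamma> c - ?s * w c"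
    have "(\<Sum>c\<in>UNIV. G M c * ?v $ c) = 0" if M: "M \<in> msets UNIV k" for M
    proof -
      have "(\<Sum>c\<in>UNIV. G M c * ?v $ c) = (\<Sum>i\<in>UNIV. \<gamma> i * G M i) - ?s * (\<Sum>i\<in>UNIV. w i * G M i)"
        by (simp add: right_diff_distrib sum_subtractf sum_distrib_left ac_simps)
      then show ?thesis using \<gamma>[of M] w(1)[OF M] M by (simp add: msets_def)
    qed
    moreover have "?v $ r0 = 0" using wz[of r0] by simp
    ultimately have v0: "?v = 0" using det[of r0] unfolding det_jet_matrix by blast
    have "\<gamma> c = ?s * w c" for c using arg_cong[OF v0, of "\<lambda>v. v $ c"] by simp
    then show "\<exists>s. \<forall>i. \<gamma> i = s * w i" by (intro exI[of _ ?s] allI)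
  qed
qed

end

lemma det_of_int:
  "det (\<chi> r c. (of_int (A $ r $ c) :: 'a::comm_ring_1)) = of_int (det (A :: int ^ 'm::finite ^ 'm))"
  by (simp add: det_def)

lemma of_int_cofactor_col:
  "cofactor_col (\<chi> r c. (of_int (A $ r $ c) :: 'a::comm_ring_1)) l i =
    of_int (cofactor_col (A :: int ^ 'm::finite ^ 'm) l i)"
proof -
  have "(\<chi> r s. if s = l then (if r = i then 1 else 0) else (\<chi> r c. (of_int (A $ r $ c) :: 'a)) $ r $ s) =
    (\<chi> r c. of_int ((\<chi> r s. if s = l then (if r = i then 1 else 0) else A $ r $ s) $ r $ c))"
    by (simp add: vec_eq_iff)
  then show ?thesis unfolding cofactor_col_def by (simp only: det_of_int)
qed

text \<open>The product of a matrix with its adjugate, transferred to the integers from Cramer's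
  rule over the field. It supplies integer vectors dual to the rows of \<open>A\<close>.\<close>

lemma integer_cofactors:
  fixes A :: "int ^ 'm::finite ^ 'm"
  assumes "det (\<chi> r c. (of_int (A $ r $ c) :: 'a::field_char_0)) \<noteq> 0"
  shows "(\<Sum>l\<in>UNIV. A $ r $ l * cofactor_col A l i) = (if r = i then det A else 0)"
proof -
  let ?B = "\<chi> r c. (of_int (A $ r $ c) :: 'a)"
  have "(?B *v (\<chi> l. cofactor_col ?B l i)) $ r = (det ?B *s axis i 1) $ r"
    using cofactor_col_solves[OF assms] by simp
  then have "of_int (\<Sum>l\<in>UNIV. A $ r $ l * cofactor_col A l i) = (of_int (if r = i then det A else 0) :: 'a)"
    unfolding of_int_cofactor_col det_of_int by (auto simp: matrix_vector_mult_def axis_def)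
  then show ?thesis by (simp only: of_int_eq_iff)
qed

text \<open>On the line from \<open>x\<close> to the point with all coordinates 1, only finitely
  many parameters make some coordinate zero. The form vanishes at all the others, hence identically
  on the line.\<close>

lemma hom_vanish_everywhere:
  fixes f :: "'a::field_char_0 ^ 'm::finite \<Rightarrow> 'a"
  assumes f: "f \<in> hom_poly_funs d" and van: "\<And>z. (\<forall>i. z $ i \<noteq> 0) \<Longrightarrow> f z = 0"
  shows "f x = 0"
proof -
  define r where "r i = [:x $ i, 1 - x $ i:]" for i
  obtain P where P: "\<And>s. poly P s = f (\<chi> i. poly (r i) s)" using hom_along_curve[OF f] by blast
  have "poly (P * (\<Prod>i\<in>UNIV. r i)) s = 0" for s
  proof (cases "\<forall>i. poly (r i) s \<noteq> 0")
    case True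
    then show ?thesis using van by (simp add: P)
  next
    case False
    then show ?thesis by (auto simp: poly_prod)
  qed
  then have "P * (\<Prod>i\<in>UNIV. r i) = 0" using poly_all_0_iff_0 by blast
  moreover have "r i \<noteq> 0" for i by (auto simp: r_def)
  ultimately have "P = 0" by simp
  then have "f (\<chi> i. poly (r i) 0) = 0" using P[of 0] by simp
  then show ?thesis by (simp add: r_def)
qed

text \<open>Two distinct points: the torus orbit consists of all points of \<open>\<P>\<^sup>1\<close> with nonzero coordinates.\<close>

lemma toric_variety_two_points:
  fixes a :: "'m::finite \<Rightarrow> int ^ 'n::finite"
  assumes m: "UNIV = {i0, i1 :: 'm}" "i0 \<noteq> i1" and inj: "inj a"
  shows "(toric_variety a :: ('a::{alg_closed_field, field_char_0} ^ 'm) set) = {x. x \<noteq> 0}"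
proof (intro set_eqI iffI)
  fix x :: "'a ^ 'm" assume "x \<in> toric_variety a"
  then show "x \<in> {x. x \<noteq> 0}" using toric_nonzero by blast
next
  fix x :: "'a ^ 'm" assume x: "x \<in> {x. x \<noteq> 0}"
  show "x \<in> toric_variety a" unfolding toric_variety_iff
  proof (intro conjI allI ballI impI)
    show "x \<noteq> 0" using x by simp
    fix d and f :: "'a ^ 'm \<Rightarrow> 'a"
    assume f: "f \<in> hom_poly_funs d" "\<forall>t. torus_inv t \<longrightarrow> f (torus_pt a t) = 0"
    show "f x = 0"
    proof (rule hom_vanish_everywhere[OF f(1)])
      fix z :: "'a ^ 'm" assume z: "\<forall>i. z $ i \<noteq> 0"
      have "a i1 \<noteq> a i0" using inj m(2) by (auto simp: inj_def)
      then obtain j where j: "a i1 $ j \<noteq> a i0 $ j" by (auto simp: vec_eq_iff)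
      define D where "D = a i1 $ j - a i0 $ j"
      \<comment> \<open>The wanted \<open>s\<close> satisfies
        \<open>s powi D = z $ i1 / z $ i0\<close>. Inverting the quotient for negative
        \<open>D\<close> leaves a root of positive order, which exists over an algebraically closed
        field.\<close>
      define q where "q = (if D > 0 then z $ i1 / z $ i0 else z $ i0 / z $ i1)"
      have "nat \<bar>D\<bar> > 0" using j by (simp add: D_def)
      then obtain s where s: "s ^ nat \<bar>D\<bar> = q" using nth_root_exists by blast
      have "q \<noteq> 0" using z by (simp add: q_def)
      then have s0: "s \<noteq> 0" using s \<open>nat \<bar>D\<bar> > 0\<close> by (auto simp: power_0_left)
      have sD: "s powi D = z $ i1 / z $ i0"
      proof (cases "D > 0")
        case True
        then show ?thesis using s by (simp add: power_int_def q_def)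
      next
        case False
        then have "inverse s ^ nat (- D) = z $ i1 / z $ i0"
          using s j by (simp add: power_inverse q_def D_def split: if_splits)
        then show ?thesis using False j by (simp add: power_int_def D_def)
      qed
      define t where "t = (\<chi> l. if l = j then s else 1)"
      have t: "torus_inv t" using s0 by (simp add: torus_inv_def t_def)
      have pt: "torus_pt a t $ i = s powi (a i $ j)" for i
      proof -
        have "torus_pt a t $ i = (\<Prod>l\<in>UNIV. if l = j then s powi (a i $ l) else 1)"
          unfolding torus_pt_def vec_lambda_beta by (rule prod.cong) (simp_all add: t_def)
        then show ?thesis by simp
      qed
      define c where "c = z $ i0 / torus_pt a t $ i0"
      have "torus_pt a t $ i1 = s powi D * torus_pt a t $ i0"
        using s0 by (simp add: pt D_def flip: power_int_add)
      then have z1: "c * torus_pt a t $ i1 = z $ i1"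
        using sD z torus_pt_nz[OF t, of a i0] by (simp add: c_def)
      have z0: "c * torus_pt a t $ i0 = z $ i0" using torus_pt_nz[OF t, of a i0] by (simp add: c_def)
      have "c * torus_pt a t $ i = z $ i" for i
      proof -
        have "i = i0 \<or> i = i1" using m(1) by blast
        then show ?thesis using z0 z1 by (elim disjE) simp_all
      qed
      then have "c *s torus_pt a t = z" by (simp add: vec_eq_iff)
      then have "f z = c ^ d * f (torus_pt a t)" using hom_homogeneous[OF f(1), of c "torus_pt a t"] by simp
      then show "f z = 0" using f(2) t by simp
    qed
  qed
qed

text \<open>For \<open>k = 0\<close> there are no monomials of degree one to supply dual vectors
  \<open>u\<close>, and two points do not span a lattice of higher rank. Since the variety is the
  whole projective line anyway, the points are replaced by 0 and 1 in rank one, with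
  \<open>w\<close> and \<open>u\<close> having the entries -1 and 1.\<close>

lemma selfdual_two_points:
  fixes a :: "'m::finite \<Rightarrow> int ^ 'n::finite"
  assumes card: "CARD('m) = 2" and inj: "inj a"
  shows "selfdual 0 (toric_variety a :: ('a::{alg_closed_field, field_char_0} ^ 'm) set)"
proof -
  obtain i0 i1 :: 'm where m: "UNIV = {i0, i1}" "i0 \<noteq> i1" using card card_2_iff[of "UNIV :: 'm set"] by auto
  have sum: "(\<Sum>i\<in>UNIV. g i) = g i0 + g i1" for g :: "'m \<Rightarrow> 'b::comm_monoid_add"
    unfolding m(1) using m(2) by simp
  have eq: "i = i0 \<or> i = i1" for i using m(1) by blast
  define a' :: "'m \<Rightarrow> int ^ 1" where "a' i = (\<chi> j. if i = i1 then 1 else 0)" for i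
  have "inj a'"
  proof (rule injI)
    fix x y assume "a' x = a' y"
    then show "x = y" using eq[of x] eq[of y] m(2) by (auto simp: a'_def vec_eq_iff split: if_splits)
  qed
  interpret toric_selfdual a' "\<lambda>_ i. if i = i1 then 1 else -1" 1 "toric_variety a' :: ('a ^ 'm) set" 0
    "\<lambda>i. if i = i1 then 1 else -1"
  proof unfold_locales
    show "(if i = i1 then 1 else - 1) \<noteq> (0 :: 'a)" for i by simp
    fix \<gamma> :: "'m \<Rightarrow> 'a"
    assume "\<And>M. size M \<le> 0 \<Longrightarrow> (\<Sum>i\<in>UNIV. \<gamma> i * (\<Prod>j\<in>#M. of_int (a' i $ j))) = 0"
    from this[of "{#}"] have "\<gamma> i0 = - \<gamma> i1" by (simp add: sum eq_neg_iff_add_eq_0)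
    then have "\<gamma> i = \<gamma> i1 * (if i = i1 then 1 else -1)" for i
      using eq[of i] by auto
    then show "\<exists>s. \<forall>i. \<gamma> i = s * (if i = i1 then 1 else -1)" by blast
  next
    fix j j' :: 1
    show "(\<Sum>l\<in>UNIV. (if l = i1 then 1 else - 1) * a' l $ j') = (if j = j' then int 1 else 0)"
      using m(2) num1_eqI[of j j'] by (simp add: sum a'_def)
  qed (use card m(2) in \<open>auto simp: sum\<close>)
  have "toric_variety a = (toric_variety a' :: ('a ^ 'm) set)"
    unfolding toric_variety_two_points[OF m inj] toric_variety_two_points[OF m \<open>inj a'\<close>] ..
  then show ?thesis using selfdual_toric by simp
qed

lemma selfdual_of_det:
  fixes a :: "'m::finite \<Rightarrow> int ^ 'n::finite" and h :: "'n multiset \<Rightarrow> 'm"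
  assumes h: "bij_betw h (msets UNIV k) (UNIV - {r0})" and k: "k > 0"
    and card: "CARD('m) = ((CARD('n) + k) choose k) + 1"
    and det: "\<And>i. det (jet_matrix h k r0 i (\<lambda>M c. \<Prod>j\<in>#M. of_int (a c $ j)) :: 'a::field_char_0 ^ 'm ^ 'm) \<noteq> 0"
  shows "selfdual k (toric_variety a :: ('a ^ 'm) set)"
proof -
  interpret jet_index h k r0 by unfold_locales (rule h)
  define A where "A = jet_matrix h k r0 r0 (\<lambda>M c. \<Prod>j\<in>#M. a c $ j)"
  have of_int_prod_mset: "(of_int (\<Prod>j\<in>#M. a c $ j) :: 'a) = (\<Prod>j\<in>#M. of_int (a c $ j))" for M c
    by (induction M) simp_all
  have "(\<chi> r c. (of_int (A $ r $ c) :: 'a)) = jet_matrix h k r0 r0 (\<lambda>M c. \<Prod>j\<in>#M. of_int (a c $ j))"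
    by (simp add: A_def jet_matrix_def vec_eq_iff of_int_prod_mset)
  then have detA: "det (\<chi> r c. (of_int (A $ r $ c) :: 'a)) \<noteq> 0" using det[of r0] by simp
  then have detZ: "det A \<noteq> 0" unfolding det_of_int by auto
  have mem: "{#} \<in> msets (UNIV :: 'n set) k" "{#j#} \<in> msets (UNIV :: 'n set) k" for j
    using k by (auto simp: msets_def)
  have hinj: "h M = h M' \<longleftrightarrow> M = M'" if "M \<in> msets UNIV k" "M' \<in> msets UNIV k" for M M'
    using h that by (auto simp: bij_betw_def inj_on_def)
  have A_row: "A $ h M $ l = (\<Prod>j\<in>#M. a l $ j)" if "M \<in> msets UNIV k" for M l
    using h_neq[OF that] bij_betw_inv_into_left[OF h that] by (simp add: A_def jet_matrix_def)
  \<comment> \<open>For \<open>k > 0\<close> the rows of \<open>A\<close> include the constant 1, at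
    \<open>{#}\<close>, and the coordinates of the points, at \<open>{#j#}\<close>. The cofactors of
    the row \<open>{#j#}\<close> are orthogonal to all other rows, and the sign turns the remaining
    pairing \<open>det A\<close> into its absolute value.\<close>
  define u where "u j l = sgn (det A) * cofactor_col A l (h {#j#})" for j l
  obtain w :: "'m \<Rightarrow> 'a" where w: "\<And>i. w i \<noteq> 0"
    "\<And>\<gamma>. (\<And>M. size M \<le> k \<Longrightarrow> (\<Sum>i\<in>UNIV. \<gamma> i * (\<Prod>j\<in>#M. of_int (a i $ j))) = 0) \<Longrightarrow>
      \<exists>s. \<forall>i. \<gamma> i = s * w i"
    using kernel_line[OF det] by blast
  interpret toric_selfdual a u "nat \<bar>det A\<bar>" "toric_variety a :: ('a ^ 'm) set" k w
  proof unfold_locales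
    show "0 < nat \<bar>det A\<bar>" using detZ by simp
    show "(\<Sum>l\<in>UNIV. u j l) = 0" for j
    proof -
      have "(\<Sum>l\<in>UNIV. u j l) = sgn (det A) * (\<Sum>l\<in>UNIV. A $ h {#} $ l * cofactor_col A l (h {#j#}))"
        by (simp add: u_def sum_distrib_left A_row[OF mem(1)])
      then show ?thesis
        using integer_cofactors[OF detA, of "h {#}" "h {#j#}"] by (simp add: hinj[OF mem(1) mem(2)])
    qed
    show "(\<Sum>l\<in>UNIV. u j l * a l $ j') = (if j = j' then int (nat \<bar>det A\<bar>) else 0)" for j j'
    proof -
      have "(\<Sum>l\<in>UNIV. u j l * a l $ j') =
          sgn (det A) * (\<Sum>l\<in>UNIV. A $ h {#j'#} $ l * cofactor_col A l (h {#j#}))"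
        by (simp add: u_def sum_distrib_left A_row[OF mem(2)] ac_simps)
      then show ?thesis
        using integer_cofactors[OF detA, of "h {#j'#}" "h {#j#}"]
        by (auto simp: hinj[OF mem(2) mem(2)] sgn_if)
    qed
  qed (use w card in auto)
  show ?thesis by (rule selfdual_toric)
qed

text \<open>With \<open>p $ (c, j) = pr j ^ \<tau> c\<close> for distinct primes
  \<open>pr j\<close>, the monomial \<open>M\<close> takes the value \<open>z M ^ \<tau> c\<close>.
  The rows are thus of Vandermonde type, and unique factorization makes the numbers
  \<open>z M\<close> distinct.\<close>

lemma ex_general_tuple:
  fixes h :: "'n::finite multiset \<Rightarrow> 'm::finite" and k :: nat
  assumes h: "bij_betw h (msets UNIV k) (UNIV - {r0})"
  obtains p :: "'a::field_char_0 ^ ('m \<times> 'n)" where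
    "\<And>i. det (jet_matrix h k r0 i (\<lambda>M c. \<Prod>j\<in>#M. p $ (c, j))) \<noteq> 0"
    "\<And>i i' j. i \<noteq> i' \<Longrightarrow> p $ (i, j) \<noteq> p $ (i', j)"
proof -
  interpret jet_index h k r0 by unfold_locales (rule h)
  obtain B :: "nat set" where B: "finite B" "card B = CARD('n)" "B \<subseteq> {p. prime p}"
    using infinite_arbitrarily_large[OF primes_infinite, of "CARD('n)"] by blast
  obtain pr where pr: "bij_betw pr (UNIV :: 'n set) B"
    using finite_same_card_bij[of "UNIV :: 'n set" B] B by auto
  have prime: "prime (pr j)" for j using pr B(3) by (auto simp: bij_betw_def)
  have "inj pr" using pr by (simp add: bij_betw_def)
  obtain \<tau> :: "'m \<Rightarrow> nat" where \<tau>: "bij_betw \<tau> UNIV {..<CARD('m)}"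
    using finite_same_card_bij[of "UNIV :: 'm set" "{..<CARD('m)}"] by auto
  define z where "z M = (\<Prod>j\<in>#M. pr j)" for M
  have z_inj: "inj z"
  proof (rule injI)
    fix M M' assume "z M = z M'"
    moreover have "prime_factorization (z M) = image_mset pr M" for M
      unfolding z_def by (rule prime_factorization_prod_mset_primes) (use prime in auto)
    ultimately have "image_mset pr M = image_mset pr M'" by metis
    then show "M = M'" using multiset.inj_map[OF \<open>inj pr\<close>] by (simp add: inj_eq)
  qed
  define p where "p = (\<chi> ij. (of_nat (pr (snd ij) ^ \<tau> (fst ij)) :: 'a))"
  have G: "(\<Prod>j\<in>#M. p $ (c, j)) = of_nat (z M) ^ \<tau> c" for M c
    by (induction M) (simp_all add: p_def z_def power_mult_distrib)
  show ?thesis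
  proof (rule that[of p])
    fix i
    show "det (jet_matrix h k r0 i (\<lambda>M c. \<Prod>j\<in>#M. p $ (c, j))) \<noteq> 0"
      unfolding det_jet_matrix G
    proof (intro allI impI)
      fix v :: "'a ^ 'm"
      assume v: "v $ i = 0 \<and> (\<forall>M\<in>msets UNIV k. (\<Sum>c\<in>UNIV. of_nat (z M) ^ \<tau> c * v $ c) = 0)"
      let ?Z = "z ` msets UNIV k"
      have card: "card ?Z = card (msets (UNIV :: 'n set) k)"
        by (rule card_image) (rule inj_on_subset[OF z_inj], simp)
      have "v $ c = 0" for c
      proof (rule vandermonde_kernel[where Z = ?Z and i = i and \<tau> = \<tau>])
        show "finite ?Z" by (simp add: card_msets)
        show "x > 0" if "x \<in> ?Z" for x
        proof -
          have "z M > 0" for M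
            by (induction M) (simp_all add: z_def prime_gt_0_nat prime)
          then show ?thesis using that by auto
        qed
        have "card (msets (UNIV :: 'n set) k) = card (UNIV - {r0})" using h by (rule bij_betw_same_card)
        then show "card ?Z + 1 = CARD('m)" unfolding card by (simp add: card_Diff_subset)
        show "0 < card ?Z" unfolding card using card_msets[of "UNIV :: 'n set" k] by simp
        show "(\<Sum>c\<in>UNIV. v $ c * of_nat x ^ \<tau> c) = 0" if "x \<in> ?Z" for x
          using that v by (auto simp: mult.commute)
      qed (use \<tau> v in auto)
      then show "v = 0" by (simp add: vec_eq_iff)
    qed
  next
    fix i i' :: 'm and j :: 'n
    assume "i \<noteq> i'"
    then have "\<tau> i \<noteq> \<tau> i'" using \<tau> by (auto simp: bij_betw_def inj_on_def)
    then have "pr j ^ \<tau> i \<noteq> pr j ^ \<tau> i'" using prime_gt_1_nat[OF prime, of j] by simp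
    then show "p $ (i, j) \<noteq> p $ (i', j)" by (simp add: p_def del: of_nat_power)
  qed
qed

theorem corollary5p2:
  fixes k :: nat
  assumes "CARD('m::finite) = ((CARD('n::finite) + k) choose k) + 1"
  shows "\<exists>U :: ('a::{alg_closed_field, field_char_0} ^ ('m \<times> 'n)) set.
           openin zariski_affine U \<and> U \<noteq> {} \<and>
           (\<forall>a :: 'm \<Rightarrow> int ^ 'n. lattice_tuple a \<in> U \<longrightarrow>
              inj a \<and> selfdual k (toric_variety a :: ('a ^ 'm) set))"
proof -
  fix r0 :: 'm and j0 :: 'n
  have "card (msets (UNIV :: 'n set) k) = card (UNIV - {r0})"
    using assms card_msets[of "UNIV :: 'n set" k] by (simp add: card_Diff_subset)
  then obtain h where h: "bij_betw h (msets (UNIV :: 'n set) k) (UNIV - {r0})"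
    using finite_same_card_bij[of "msets (UNIV :: 'n set) k" "UNIV - {r0}"] card_msets[of "UNIV :: 'n set" k] by auto
  \<comment> \<open>The first product collects all maximal minors, whose nonvanishing gives a kernel
    line without zero entries. The second makes the \<open>j0\<close>-th coordinates of the points
    pairwise distinct, so that \<open>a\<close> is injective.\<close>
  define \<Phi> :: "'a ^ ('m \<times> 'n) \<Rightarrow> 'a" where
    "\<Phi> x = (\<Prod>i\<in>UNIV. det (jet_matrix h k r0 i (\<lambda>M c. \<Prod>j\<in>#M. x $ (c, j)))) *
      (\<Prod>p\<in>{p. fst p \<noteq> snd p}. x $ (fst p, j0) - x $ (snd p, j0))" for x
  have "pol \<Phi>"
    unfolding \<Phi>_def
  proof (intro pol_mult pol_prod pol_det pol_diff pol_nth)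
    show "pol (\<lambda>x. jet_matrix h k r0 i (\<lambda>M c. \<Prod>j\<in>#M. x $ (c, j)) $ r $ s)" for i r s
      by (auto simp: jet_matrix_def intro!: pol_if pol_const pol_prod_mset pol_nth)
  qed
  then have "openin zariski_affine {x. \<Phi> x \<noteq> 0}"
    unfolding zariski_affine_def by (intro topology_generated_by_Basis) blast
  moreover have "{x. \<Phi> x \<noteq> 0} \<noteq> {}"
  proof -
    obtain p :: "'a ^ ('m \<times> 'n)" where
      "\<And>i. det (jet_matrix h k r0 i (\<lambda>M c. \<Prod>j\<in>#M. p $ (c, j))) \<noteq> 0"
      "\<And>i i' j. i \<noteq> i' \<Longrightarrow> p $ (i, j) \<noteq> p $ (i', j)"
      using ex_general_tuple[OF h] by blast
    then have "\<Phi> p \<noteq> 0" by (auto simp: \<Phi>_def)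
    then show ?thesis by blast
  qed
  moreover have "inj a \<and> selfdual k (toric_variety a :: ('a ^ 'm) set)"
    if a: "lattice_tuple a \<in> {x. \<Phi> x \<noteq> 0}" for a :: "'m \<Rightarrow> int ^ 'n"
  proof
    have "\<Phi> (lattice_tuple a) \<noteq> 0" using a by simp
    then have det: "\<And>i. det (jet_matrix h k r0 i (\<lambda>M c. \<Prod>j\<in>#M. of_int (a c $ j)) :: 'a ^ 'm ^ 'm) \<noteq> 0"
      and dist: "\<And>i i'. i \<noteq> i' \<Longrightarrow> (of_int (a i $ j0) :: 'a) \<noteq> of_int (a i' $ j0)"
      by (auto simp: \<Phi>_def lattice_tuple_def)
    show inj: "inj a" by (rule injI) (use dist in metis)
    show "selfdual k (toric_variety a :: ('a ^ 'm) set)"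
    proof (cases "k = 0")
      case True
      then show ?thesis using selfdual_two_points[OF _ inj] assms by simp
    next
      case False
      then show ?thesis using selfdual_of_det[OF h _ assms det] by simp
    qed
  qed
  ultimately show ?thesis by blast
qed

end
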